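(* Let $C$ be a complete folding curve. Then $\mathrm{Ext}(C)$ is the union of $0$, $1$ or $2$ connected components, each of these components is infinite, and each of them is the intersection of $\mathrm{Ext}(C)$ with one of the two connected components of $\mathbb{R}^2\setminus |C|$.
   Context: All sequences take values in $\{+1,-1\}$. For $S=(a_1,\dots,a_n)$ write $\overline{S}=(-a_n,\dots,-a_1)$. The $n$-folding sequences are defined recursively: the only $0$-folding sequence is the empty sequence, and the $(n+1)$-folding sequences are exactly $(\overline{S},+1,S)$ and $(\overline{S},-1,S)$ with $S$ an $n$-folding sequence. A complete folding sequence is a sequence $(a_k)_{k\in\mathbb{Z}}$ each finite block $(a_{h+1},\dots,a_{h+m})$ of which is a block of consecutive terms of some $n$-folding sequence. A segment is an oriented unit edge of $\mathbb{Z}^2$ (ordered pair $(X,Y)$ of lattice points at distance $1$; support $[X,Y]$, initial point $X$, terminal point $Y$). A complete curve is a sequence $C=(C_i)_{i\in\mathbb{Z}}$ of segments such that the terminal point of $C_i$ is the initial point of $C_{i+1}$, consecutive supports are perpendicular, and all supports are pairwise distinct. Its associated sequence is $(\eta_i)_{i\in\mathbb{Z}}$ with $\eta_i=+1$ (resp. $-1$) if one turns left (resp. right) from $C_i$ to $C_{i+1}$. A complete folding curve is a complete curve whose associated sequence is a complete folding sequence. Fix $\alpha\in(0,1/4)$. The geometric realization $|C|\subset\mathbb{R}^2$ is the polygonal line obtained from the lattice path of $C$ by cutting each corner: at each vertex $X$ where $C$ passes from a segment with unit direction $u$ to a segment with unit direction $v$, the part of the path near $X$ is replaced by the polygonal line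 $X-2\alpha u\to X+\alpha(v-u)\to X+2\alpha v$. The exterior $\mathrm{Ext}(C)$ is the set of points of $\mathbb{Z}^2$ which are not endpoints of any segment of $C$. A path is a finite sequence $(X_0,\dots,X_m)$ in $\mathbb{Z}^2$ with $|X_{i}-X_{i-1}|=1$; a connected component of $\mathrm{Ext}(C)$ is a subset $K$ maximal for the property that any two points of $K$ are joined by a path consisting of points of $K$. *)

theory Defs
  imports "HOL-Analysis.Analysis" "HOL-Library.Sublist"
begin

definition bar :: "int list \<Rightarrow> int list" where
  "bar S = map uminus (rev S)"

inductive n_folding :: "nat \<Rightarrow> int list \<Rightarrow> bool" where
  zero: "n_folding 0 []"
| plus: "n_folding n S \<Longrightarrow> n_folding (Suc n) (bar S @ [1] @ S)"
| minus: "n_folding n S \<Longrightarrow> n_folding (Suc n) (bar S @ [-1] @ S)"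

text \<open>Here \<open>sublist\<close> is the library's relation of being a block of consecutive terms.\<close>

definition complete_folding_sequence :: "(int \<Rightarrow> int) \<Rightarrow> bool" where
  "complete_folding_sequence a \<longleftrightarrow>
     range a \<subseteq> {1, -1} \<and>
     (\<forall>h m. \<exists>n S. n_folding n S \<and> sublist (map (\<lambda>k. a (h + int k)) [1..<Suc m]) S)"

type_synonym lattice_point = "int \<times> int"
type_synonym segment = "lattice_point \<times> lattice_point"

definition to_plane :: "lattice_point \<Rightarrow> real \<times> real" where
  "to_plane X = (real_of_int (fst X), real_of_int (snd X))"

definition adjacent :: "lattice_point \<Rightarrow> lattice_point \<Rightarrow> bool" where
  "adjacent X Y \<longleftrightarrow> dist (to_plane X) (to_plane Y) = 1"

definition is_segment :: "segment \<Rightarrow> bool" where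
  "is_segment s \<longleftrightarrow> adjacent (fst s) (snd s)"

definition support :: "segment \<Rightarrow> (real \<times> real) set" where
  "support s = closed_segment (to_plane (fst s)) (to_plane (snd s))"

definition direction :: "segment \<Rightarrow> int \<times> int" where
  "direction s = snd s - fst s"

definition complete_curve :: "(int \<Rightarrow> segment) \<Rightarrow> bool" where
  "complete_curve C \<longleftrightarrow>
     (\<forall>i. is_segment (C i)) \<and>
     (\<forall>i. snd (C i) = fst (C (i + 1))) \<and>
     (\<forall>i. orthogonal (to_plane (direction (C i))) (to_plane (direction (C (i + 1))))) \<and>
     (\<forall>i j. i \<noteq> j \<longrightarrow> support (C i) \<noteq> support (C j))"

text \<open>For perpendicular unit vectors \<open>u\<close>, \<open>v\<close> the determinant \<open>det (u, v)\<close> is \<open>1\<close> if \<open>v\<close>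
  is \<open>u\<close> rotated by a quarter turn to the left, and \<open>-1\<close> if to the right.\<close>

definition turn :: "int \<times> int \<Rightarrow> int \<times> int \<Rightarrow> int" where
  "turn u v = sgn (fst u * snd v - snd u * fst v)"

definition associated_sequence :: "(int \<Rightarrow> segment) \<Rightarrow> int \<Rightarrow> int" where
  "associated_sequence C i = turn (direction (C i)) (direction (C (i + 1)))"

definition complete_folding_curve :: "(int \<Rightarrow> segment) \<Rightarrow> bool" where
  "complete_folding_curve C \<longleftrightarrow>
     complete_curve C \<and> complete_folding_sequence (associated_sequence C)"

definition trimmed_segment :: "real \<Rightarrow> segment \<Rightarrow> (real \<times> real) set" where
  "trimmed_segment \<alpha> s =
     (let u = to_plane (direction s)
      in closed_segment (to_plane (fst s) + (2 * \<alpha>) *\<^sub>R u) (to_plane (snd s) - (2 * \<alpha>) *\<^sub>R u))"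

definition cut_corner :: "real \<Rightarrow> segment \<Rightarrow> segment \<Rightarrow> (real \<times> real) set" where
  "cut_corner \<alpha> s t =
     (let X = to_plane (snd s); u = to_plane (direction s); v = to_plane (direction t)
      in closed_segment (X - (2 * \<alpha>) *\<^sub>R u) (X + \<alpha> *\<^sub>R (v - u)) \<union>
         closed_segment (X + \<alpha> *\<^sub>R (v - u)) (X + (2 * \<alpha>) *\<^sub>R v))"

definition realization :: "real \<Rightarrow> (int \<Rightarrow> segment) \<Rightarrow> (real \<times> real) set" where
  "realization \<alpha> C = (\<Union>i. trimmed_segment \<alpha> (C i) \<union> cut_corner \<alpha> (C i) (C (i + 1)))"

definition Ext :: "(int \<Rightarrow> segment) \<Rightarrow> lattice_point set" where
  "Ext C = {X. \<forall>i. X \<noteq> fst (C i) \<and> X \<noteq> snd (C i)}"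

definition lattice_path :: "lattice_point list \<Rightarrow> bool" where
  "lattice_path p \<longleftrightarrow> p \<noteq> [] \<and> successively adjacent p"

definition lattice_connected :: "lattice_point set \<Rightarrow> bool" where
  "lattice_connected K \<longleftrightarrow>
     (\<forall>X\<in>K. \<forall>Y\<in>K. \<exists>p. lattice_path p \<and> hd p = X \<and> last p = Y \<and> set p \<subseteq> K)"

text \<open>Components are nonempty; without this requirement the empty set would be a
  component of the empty set.\<close>

definition lattice_components :: "lattice_point set \<Rightarrow> lattice_point set set" where
  "lattice_components E =
     {K. K \<noteq> {} \<and> K \<subseteq> E \<and> lattice_connected K \<and>
         (\<forall>K'. K \<subseteq> K' \<and> K' \<subseteq> E \<and> lattice_connected K' \<longrightarrow> K' = K)}"

end

theory Submission imports Defs begin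

text \<open>
  Because the turns of a folding curve alternate at every second vertex, the remaining vertices form
  again a folding curve, on the lattice enlarged by \<open>1 + \<i>\<close> (the derived curve). Two diagonally
  adjacent vertices of the alternating class have opposite turns. All curve neighbours of an exterior
  point turn to the same side, so no exterior point can have four curve neighbours; passing to derived
  curves, every component of the exterior is infinite.

  Exterior points on the left of the curve are reached from vertices with a right turn. For two such
  points attached to the vertices with indices \<open>i \<le> j\<close> we show by induction on \<open>j - i\<close> that they are
  connected in the exterior: passing to the derived curve halves the difference, and the only
  obstruction is an exterior point attached to vertices on both sides of \<open>i\<close>. In that case a closed
  loop made of an arc of the curve and of that point would enclose a component of the exterior,
  contradicting infinity.

  For the topological part, the plane is tiled by octagons (one per lattice square) and diamonds (one
  per lattice point). A potential of the flow along the curve colours them with two colours, such that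
  the rounded curve is the common boundary of the two coloured regions.
\<close>

subsection \<open>Potentials of conservative flows on the square lattice\<close>

text \<open>Left and right of the curve come from combinatorics rather than from the Jordan curve
  theorem. A unit flow along the curve is conserved at every lattice point, hence has a stream
  function on the squares; a left turn keeps the left square and a right turn keeps the right one,
  so that function is constant along each side.

  The induction over \<open>j - i\<close> runs over all folding curves at once, since the derived
  curve is a different curve. Differences \<open>0\<close> and \<open>1\<close> are settled
  directly. Passing to the derived curve rounds both indices outward to even ones, so difference
  \<open>2\<close> with odd \<open>i\<close> would not shrink; alternation of the turns excludes it.
  Only right turns, hence the left side, are treated: the right side is the left side of the
  reversed curve.

  Which vertices of the derived curve alternate is not known. Arguments inside it therefore exhibit
  two diagonal pairs of equal turns, one in each parity class, so that one of them contradicts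
  alternation.\<close>

abbreviation units :: "lattice_point set" where
  "units \<equiv> {(1,0), (0,1), (-1,0), (0,-1)}"

lemma adjacent_iff:
  "adjacent p q \<longleftrightarrow> q - p \<in> units"
proof -
  obtain a b c d where p: "p = (a,b)" and q: "q = (c,d)" by (metis surj_pair)
  have "adjacent p q \<longleftrightarrow> (real_of_int a - real_of_int c)\<^sup>2 + (real_of_int b - real_of_int d)\<^sup>2 = 1"
    by (simp add: adjacent_def to_plane_def dist_Pair_Pair dist_real_def p q real_sqrt_eq_1_iff)
  also have "\<dots> \<longleftrightarrow> real_of_int ((a - c)\<^sup>2 + (b - d)\<^sup>2) = real_of_int 1"
    by simp
  also have "\<dots> \<longleftrightarrow> (c - a)\<^sup>2 + (d - b)\<^sup>2 = 1"
    by (simp only: of_int_eq_iff power2_commute)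
  also have "\<dots> \<longleftrightarrow> (c - a, d - b) \<in> units"
  proof
    assume *: "(c - a)\<^sup>2 + (d - b)\<^sup>2 = 1"
    then have "(c - a)\<^sup>2 \<le> 1" "(d - b)\<^sup>2 \<le> 1"
      by (smt (verit) zero_le_power2)+
    then have "\<bar>c - a\<bar> \<le> 1" "\<bar>d - b\<bar> \<le> 1"
      by (simp_all add: abs_square_le_1)
    then have "c - a \<in> {-1,0,1}" "d - b \<in> {-1,0,1}" by auto
    with * show "(c - a, d - b) \<in> units" by auto
  qed auto
  finally show ?thesis by (simp add: p q)
qed

lemma adjacent_sym: "adjacent p q \<longleftrightarrow> adjacent q p"
  by (auto simp: adjacent_def dist_commute)

lemma not_adjacent_self [simp]: "\<not> adjacent p p"
  by (simp add: adjacent_def)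

lemma adjacent_cases:
  assumes "adjacent p q"
  obtains "q = p + (1,0)" | "q = p + (0,1)" | "q = p - (1,0)" | "q = p - (0,1)"
  using assms by (cases p; cases q) (auto simp: adjacent_iff)

lemma adjacent_simps [simp]:
  "adjacent p (p + (1,0))" "adjacent p (p + (0,1))" "adjacent p (p - (1,0))" "adjacent p (p - (0,1))"
  by (cases p; simp add: adjacent_iff)+

text \<open>A lattice square is named by its lower left corner; \<open>lface p q\<close> is the square on the left of the
  oriented edge from \<open>p\<close> to \<open>q\<close>.\<close>

definition lface :: "lattice_point \<Rightarrow> lattice_point \<Rightarrow> lattice_point" where
  "lface p q = (if q = p + (1,0) then p else if q = p + (0,1) then p - (1,0)
                else if q = p - (1,0) then p - (1,1) else p - (0,1))"

text \<open>A discrete stream function: the flow lives on oriented edges, its potential on the dual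
  lattice of squares.\<close>

definition is_potential :: "(lattice_point \<Rightarrow> int) \<Rightarrow> (lattice_point \<Rightarrow> lattice_point \<Rightarrow> int) \<Rightarrow> bool" where
  "is_potential w e \<longleftrightarrow> (\<forall>p q. adjacent p q \<longrightarrow> w (lface p q) - w (lface q p) = e p q)"

lemma is_potentialD: "is_potential w e \<Longrightarrow> adjacent p q \<Longrightarrow> w (lface p q) - w (lface q p) = e p q"
  unfolding is_potential_def by blast

lemma int_antidifference:
  fixes g :: "int \<Rightarrow> int"
  shows "\<exists>F. \<forall>t. F t - F (t - 1) = g t"
proof (intro exI allI)
  fix t :: int
  \<comment> \<open>Signed summation from \<open>0\<close>: for each argument at most one of the two
    sums is nonempty.\<close>
  show "(\<lambda>t. sum g {1..t} - sum g {t+1..0}) t - (\<lambda>t. sum g {1..t} - sum g {t+1..0}) (t - 1) = g t"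
  proof (cases "t \<ge> 1")
    case True
    then have "{1..t} = insert t {1..t-1}" "{t+1..0} = {}" "{t..0} = {}" by auto
    then show ?thesis by simp
  next
    case False
    then have "{t..0} = insert t {t+1..0}" "{1..t} = {}" "{1..t-1} = {}" by auto
    then show ?thesis by simp
  qed
qed

text \<open>Discrete Poincare lemma. Summing the horizontal flow up each column determines
  \<open>w\<close> up to one constant per column; conservation at the lattice points makes the
  condition on vertical edges, once arranged in row \<open>0\<close>, propagate to all rows.\<close>

lemma ex_potential:
  assumes anti: "\<And>p q. adjacent p q \<Longrightarrow> e q p = - e p q"
    and cons: "\<And>p. e p (p + (1,0)) + e p (p + (0,1)) + e p (p - (1,0)) + e p (p - (0,1)) = (0::int)"
  obtains w where "is_potential w e"
proof -
  define h where "h x y = e (x,y) (x+1,y)" for x y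
  define v where "v x y = e (x,y) (x,y+1)" for x y
  have hr: "e (x,y) (x-1,y) = - h (x-1) y" and vr: "e (x,y) (x,y-1) = - v x (y-1)" for x y
    using anti[of "(x-1,y)" "(x,y)"] anti[of "(x,y-1)" "(x,y)"]
    by (auto simp: h_def v_def adjacent_iff)
  have c: "h x y + v x y - h (x-1) y - v x (y-1) = 0" for x y
    using cons[of "(x,y)"] hr[of x y] vr[of x y] by (simp add: h_def v_def)
  have "\<forall>x. \<exists>F. \<forall>y. F y - F (y-1) = h x y"
    by (simp add: int_antidifference)
  then obtain F where F: "\<And>x y. F x y - F x (y-1) = h x y" by metis
  \<comment> \<open>The column constants are chosen so that the jumps across the vertical edges of
    row \<open>0\<close> come out right.\<close>
  obtain G where G: "\<And>x. G x - G (x-1) = F (x-1) 0 - F x 0 - v x 0"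
    using int_antidifference[of "\<lambda>x. F (x-1) 0 - F x 0 - v x 0"] by metis
  define w where "w = (\<lambda>(x,y). G x + F x y)"
  have H: "w (x,y) - w (x,y-1) = h x y" for x y
    using F by (simp add: w_def)
  have V: "w (x-1,y) - w (x,y) = v x y" for x y
  proof (induction y rule: int_induct[where k = 0])
    case base
    show ?case using G[of x] by (simp add: w_def)
  next
    case (step1 i)
    then show ?case
      using F[of x "i+1"] F[of "x-1" "i+1"] c[of x "i+1"] by (simp add: w_def)
  next
    case (step2 i)
    then show ?case
      using F[of x i] F[of "x-1" i] c[of x i] by (simp add: w_def)
  qed
  have "w (lface p q) - w (lface q p) = e p q" if "adjacent p q" for p q
  proof -
    obtain x y where p: "p = (x,y)" by fastforce
    show ?thesis
      using that
    proof (cases rule: adjacent_cases)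
      case 1 then show ?thesis using H[of x y] by (simp add: lface_def p h_def)
    next
      case 2 then show ?thesis using V[of x y] by (simp add: lface_def p v_def)
    next
      case 3 then show ?thesis using H[of "x-1" y] hr[of x y] by (simp add: lface_def p)
    next
      case 4 then show ?thesis using V[of x "y-1"] vr[of x y] by (simp add: lface_def p)
    qed
  qed
  then show thesis by (intro that[of w]) (simp add: is_potential_def)
qed

text \<open>No flow is met outside a box, and the squares outside it are joined by crossing edges
  without flow, so \<open>w\<close> takes a single value there.\<close>

lemma finite_support_potential:
  assumes pot: "is_potential w e"
    and supp: "\<And>p q. e p q \<noteq> 0 \<Longrightarrow> \<bar>fst p\<bar> \<le> n \<and> \<bar>snd p\<bar> \<le> n \<and> \<bar>fst q\<bar> \<le> n \<and> \<bar>snd q\<bar> \<le> n"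
  obtains c where "finite {p. w p \<noteq> c}"
proof
  have H: "w (x,y) - w (x,y-1) = e (x,y) (x+1,y)" for x y
    using is_potentialD[OF pot, of "(x,y)" "(x+1,y)"]
    by (simp add: adjacent_iff lface_def)
  have V: "w (x-1,y) - w (x,y) = e (x,y) (x,y+1)" for x y
    using is_potentialD[OF pot, of "(x,y)" "(x,y+1)"]
    by (simp add: adjacent_iff lface_def)
  have row0: "w (x,y) = w (0,y)" if "\<bar>y\<bar> > n" for x y
  proof (induction x rule: int_induct[where k = 0])
    case (step1 i)
    then show ?case using V[of "i+1" y] supp[of "(i+1,y)" "(i+1,y+1)"] that by force
  next
    case (step2 i)
    then show ?case using V[of i y] supp[of "(i,y)" "(i,y+1)"] that by force
  qed simp
  have col0: "w (x,y) = w (x,0)" if "\<bar>x\<bar> > n" for x y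
  proof (induction y rule: int_induct[where k = 0])
    case (step1 i)
    then show ?case using H[of x "i+1"] supp[of "(x,i+1)" "(x+1,i+1)"] that by force
  next
    case (step2 i)
    then show ?case using H[of x i] supp[of "(x,i)" "(x+1,i)"] that by force
  qed simp
  \<comment> \<open>The reference square lies beyond the upper right corner of the box; the absolute
    value covers a negative \<open>n\<close>.\<close>
  define c where "c = w (\<bar>n\<bar>+1,\<bar>n\<bar>+1)"
  have "w (x,y) = c" if "\<bar>x\<bar> > n \<or> \<bar>y\<bar> > n" for x y
    using that
  proof
    assume "\<bar>x\<bar> > n"
    then have "w (x,y) = w (x,\<bar>n\<bar>+1)" using col0 by metis
    also have "\<dots> = c" unfolding c_def
      using row0[of "\<bar>n\<bar>+1" x] row0[of "\<bar>n\<bar>+1" "\<bar>n\<bar>+1"] by simp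
    finally show ?thesis .
  next
    assume "\<bar>y\<bar> > n"
    then have "w (x,y) = w (\<bar>n\<bar>+1,y)" using row0 by metis
    also have "\<dots> = c" unfolding c_def
      using col0[of "\<bar>n\<bar>+1" y] col0[of "\<bar>n\<bar>+1" "\<bar>n\<bar>+1"] by simp
    finally show ?thesis .
  qed
  then have "{p. w p \<noteq> c} \<subseteq> {-n..n} \<times> {-n..n}" by force
  then show "finite {p. w p \<noteq> c}" by (rule finite_subset) simp
qed

lemma adjacent_induct:
  assumes "Q p" "\<And>p q. Q p \<Longrightarrow> adjacent p q \<Longrightarrow> Q q"
  shows "Q q"
proof -
  have 1: "Q (x, snd p)" for x
  proof (induction x rule: int_induct[where k = "fst p"])
    case (step1 i) then show ?case using assms(2)[of "(i, snd p)"] by (simp add: adjacent_iff)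
  next
    case (step2 i) then show ?case using assms(2)[of "(i, snd p)"] by (simp add: adjacent_iff)
  qed (simp add: assms)
  have "Q (x, y)" for x y
  proof (induction y rule: int_induct[where k = "snd p"])
    case (step1 i) then show ?case using assms(2)[of "(x, i)"] by (simp add: adjacent_iff)
  next
    case (step2 i) then show ?case using assms(2)[of "(x, i)"] by (simp add: adjacent_iff)
  qed (simp add: 1)
  then show ?thesis by (cases q) simp
qed

text \<open>Two squares with adjacent names share an edge. Together with
  \<open>adjacent_induct\<close> this permits walks from square to square in which every step
  crosses one edge.\<close>

lemma adjacent_faces:
  assumes "adjacent p q"
  obtains X Y where "adjacent X Y" "lface X Y = p" "lface Y X = q"
  using assms
proof (cases rule: adjacent_cases)
  case 1 then show thesis by (intro that[of "p + (1,0)" "p + (1,1)"]; cases p) (auto simp: adjacent_iff lface_def)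
next
  case 2 then show thesis by (intro that[of "p + (1,1)" "p + (0,1)"]; cases p) (auto simp: adjacent_iff lface_def)
next
  case 3 then show thesis by (intro that[of "p + (0,1)" "p"]; cases p) (auto simp: adjacent_iff lface_def)
next
  case 4 then show thesis by (intro that[of "p" "p + (1,0)"]; cases p) (auto simp: adjacent_iff lface_def)
qed

subsection \<open>The two sides of a turning curve\<close>

text \<open>Indexed by the vertex at which the turn takes place, hence shifted by one against
  \<open>associated_sequence\<close>, whose index names the incoming segment.\<close>

definition tr :: "(int \<Rightarrow> lattice_point) \<Rightarrow> int \<Rightarrow> int" where
  "tr P i = turn (P i - P (i - 1)) (P (i + 1) - P i)"

definition free :: "(int \<Rightarrow> lattice_point) \<Rightarrow> lattice_point \<Rightarrow> lattice_point \<Rightarrow> bool" where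
  "free P X Y \<longleftrightarrow> adjacent X Y \<and> (\<forall>i. {P i, P (i + 1)} \<noteq> {X, Y})"

lemma free_sym: "free P X Y \<longleftrightarrow> free P Y X"
  by (auto simp: free_def adjacent_sym insert_commute)

text \<open>\<open>(- b, a)\<close> and \<open>(b, - a)\<close> are \<open>(a, b)\<close> rotated to
  the left and to the right. The square inside a turn touches both edges of the turn.\<close>

lemma lface_turn:
  assumes "(a, b) \<in> units"
  shows "lface (p - (a, b)) p = lface p (p + (- b, a))" "lface p (p - (a, b)) = lface (p + (b, - a)) p"
proof -
  obtain x y where p: "p = (x, y)" by fastforce
  show "lface (p - (a, b)) p = lface p (p + (- b, a))"
    using assms by (elim insertE emptyE Pair_inject) (simp_all add: lface_def p)
  show "lface p (p - (a, b)) = lface (p + (b, - a)) p"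
    using assms by (elim insertE emptyE Pair_inject) (simp_all add: lface_def p)
qed

text \<open>The two remaining edges at \<open>p\<close> lie in the outer angle of the turn. Of the
  three squares in that angle the outer two lie beside the incoming and the outgoing edge, and each
  remaining edge borders one of these two. The first claim is for a right turn, the second for a
  left turn.\<close>

lemma lface_side_faces:
  assumes "(a, b) \<in> units" "(c, d) \<in> units"
    and "p + (c, d) \<noteq> p - (a, b)"
  shows "p + (c, d) \<noteq> p + (b, - a) \<Longrightarrow>
      lface p (p + (c, d)) = lface p (p + (b, - a)) \<or> lface (p + (c, d)) p = lface p (p + (b, - a)) \<or>
      lface p (p + (c, d)) = lface (p - (a, b)) p \<or> lface (p + (c, d)) p = lface (p - (a, b)) p"
    and "p + (c, d) \<noteq> p + (- b, a) \<Longrightarrow>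
      lface p (p + (c, d)) = lface (p + (- b, a)) p \<or> lface (p + (c, d)) p = lface (p + (- b, a)) p \<or>
      lface p (p + (c, d)) = lface p (p - (a, b)) \<or> lface (p + (c, d)) p = lface p (p - (a, b))"
proof -
  obtain x y where p: "p = (x, y)" by fastforce
  show "lface p (p + (c, d)) = lface p (p + (b, - a)) \<or> lface (p + (c, d)) p = lface p (p + (b, - a)) \<or>
      lface p (p + (c, d)) = lface (p - (a, b)) p \<or> lface (p + (c, d)) p = lface (p - (a, b)) p"
    if "p + (c, d) \<noteq> p + (b, - a)"
    using assms that by (elim insertE emptyE Pair_inject) (simp_all add: lface_def p)
  show "lface p (p + (c, d)) = lface (p + (- b, a)) p \<or> lface (p + (c, d)) p = lface (p + (- b, a)) p \<or>
      lface p (p + (c, d)) = lface p (p - (a, b)) \<or> lface (p + (c, d)) p = lface p (p - (a, b))"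
    if "p + (c, d) \<noteq> p + (- b, a)"
    using assms that by (elim insertE emptyE Pair_inject) (simp_all add: lface_def p)
qed

locale turning_curve =
  fixes P :: "int \<Rightarrow> lattice_point"
  assumes adj: "adjacent (P i) (P (i + 1))"
    and perp: "fst (P i - P (i - 1)) * fst (P (i + 1) - P i) +
               snd (P i - P (i - 1)) * snd (P (i + 1) - P i) = 0"
    and edge_inj: "{P i, P (i + 1)} = {P j, P (j + 1)} \<Longrightarrow> i = j"
begin

lemma adj': "adjacent (P (i - 1)) (P i)"
  using adj[of "i - 1"] by simp

text \<open>Describes the curve around \<open>P i\<close> by the incoming direction alone, so that
  local claims reduce to checking the four values of \<open>(a, b)\<close>.\<close>

lemma local_shape:
  obtains a b where "(a, b) \<in> units" "P (i - 1) = P i - (a, b)"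
    "tr P i = 1 \<and> P (i + 1) = P i + (- b, a) \<or> tr P i = -1 \<and> P (i + 1) = P i + (b, - a)"
proof -
  obtain a b where ab: "P i - P (i - 1) = (a, b)" by fastforce
  obtain c d where cd: "P (i + 1) - P i = (c, d)" by fastforce
  have 1: "(a, b) \<in> units"
    using adj'[of i] ab by (simp add: adjacent_iff)
  have 2: "(c, d) \<in> units"
    using adj[of i] cd by (simp add: adjacent_iff)
  have 3: "a * c + b * d = 0" using perp[of i] ab cd by simp
  have t: "tr P i = sgn (a * d - b * c)" using ab cd by (simp add: tr_def turn_def)
  have "P (i - 1) = P i - (a, b)" using ab by (simp add: algebra_simps)
  moreover have "P (i + 1) = P i + (c, d)" using cd by (simp add: algebra_simps)
  ultimately show thesis
    using 1 2 3 t by (intro that[of a b]) auto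
qed

lemma tr_cases: "tr P i = 1 \<or> tr P i = -1"
  by (rule local_shape[of i]) auto

lemma left_turn_face:
  assumes "tr P i = 1"
  shows "lface (P (i - 1)) (P i) = lface (P i) (P (i + 1))"
proof (rule local_shape[of i])
  fix a b assume "(a, b) \<in> units" "P (i - 1) = P i - (a, b)"
    "tr P i = 1 \<and> P (i + 1) = P i + (- b, a) \<or> tr P i = -1 \<and> P (i + 1) = P i + (b, - a)"
  then show ?thesis using lface_turn(1)[of a b "P i"] assms by simp
qed

lemma right_turn_face:
  assumes "tr P i = -1"
  shows "lface (P i) (P (i - 1)) = lface (P (i + 1)) (P i)"
proof (rule local_shape[of i])
  fix a b assume "(a, b) \<in> units" "P (i - 1) = P i - (a, b)"
    "tr P i = 1 \<and> P (i + 1) = P i + (- b, a) \<or> tr P i = -1 \<and> P (i + 1) = P i + (b, - a)"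
  then show ?thesis using lface_turn(2)[of a b "P i"] assms by simp
qed

lemma turn_side_faces:
  assumes "adjacent (P i) Y" "Y \<noteq> P (i - 1)" "Y \<noteq> P (i + 1)"
  shows "tr P i = -1 \<Longrightarrow> lface (P i) Y = lface (P i) (P (i + 1)) \<or> lface Y (P i) = lface (P i) (P (i + 1)) \<or>
      lface (P i) Y = lface (P (i - 1)) (P i) \<or> lface Y (P i) = lface (P (i - 1)) (P i)"
    and "tr P i = 1 \<Longrightarrow> lface (P i) Y = lface (P (i + 1)) (P i) \<or> lface Y (P i) = lface (P (i + 1)) (P i) \<or>
      lface (P i) Y = lface (P i) (P (i - 1)) \<or> lface Y (P i) = lface (P i) (P (i - 1))"
proof -
  obtain a b where ab: "(a, b) \<in> units" "P (i - 1) = P i - (a, b)"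
    "tr P i = 1 \<and> P (i + 1) = P i + (- b, a) \<or> tr P i = -1 \<and> P (i + 1) = P i + (b, - a)"
    by (rule local_shape)
  obtain c d where cd': "Y - P i = (c, d)" by fastforce
  then have cd: "(c, d) \<in> units" "Y = P i + (c, d)"
    using assms(1) unfolding adjacent_iff by (simp, simp flip: cd')
  show "lface (P i) Y = lface (P i) (P (i + 1)) \<or> lface Y (P i) = lface (P i) (P (i + 1)) \<or>
      lface (P i) Y = lface (P (i - 1)) (P i) \<or> lface Y (P i) = lface (P (i - 1)) (P i)" if "tr P i = -1"
    using lface_side_faces(1)[OF ab(1) cd(1), of "P i"] ab(2,3) cd(2) assms(2,3) that by simp
  show "lface (P i) Y = lface (P (i + 1)) (P i) \<or> lface Y (P i) = lface (P (i + 1)) (P i) \<or>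
      lface (P i) Y = lface (P i) (P (i - 1)) \<or> lface Y (P i) = lface (P i) (P (i - 1))" if "tr P i = 1"
    using lface_side_faces(2)[OF ab(1) cd(1), of "P i"] ab(2,3) cd(2) assms(2,3) that by simp
qed

lemma inj_next: "inj_on (\<lambda>i. P (i + 1)) {i. P i = X}"
proof (rule inj_onI)
  fix i j assume "i \<in> {i. P i = X}" "j \<in> {i. P i = X}" "P (i + 1) = P (j + 1)"
  then show "i = j" using edge_inj[of i j] by simp
qed

lemma inj_prev: "inj_on (\<lambda>i. P (i - 1)) {i. P i = X}"
proof (rule inj_onI)
  fix i j assume "i \<in> {i. P i = X}" "j \<in> {i. P i = X}" "P (i - 1) = P (j - 1)"
  then show "i = j" using edge_inj[of "i - 1" "j - 1"] by simp
qed

text \<open>Existence suffices in place of counting, because the curve runs through every edge at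
  most once.\<close>

definition flow :: "lattice_point \<Rightarrow> lattice_point \<Rightarrow> int" where
  "flow X Y = of_bool (\<exists>i. P i = X \<and> P (i + 1) = Y) - of_bool (\<exists>i. P i = Y \<and> P (i + 1) = X)"

lemma flow_curve: "flow (P i) (P (i + 1)) = 1"
proof -
  have "\<not> (P j = P (i + 1) \<and> P (j + 1) = P i)" for j
  proof
    assume *: "P j = P (i + 1) \<and> P (j + 1) = P i"
    then have "i = j" by (intro edge_inj) (simp add: doubleton_eq_iff)
    with * have "P (i + 1) = P i" by blast
    with adj[of i] show False by simp
  qed
  then show ?thesis by (auto simp: flow_def)
qed

lemma flow_free: "free P X Y \<Longrightarrow> flow X Y = 0"
  by (auto simp: free_def flow_def)

text \<open>Each visit of \<open>X\<close> uses one outgoing and one incoming edge, and different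
  visits use different edges, so both numbers of edges equal the number of visits.\<close>

lemma flow_conserved:
  "flow X (X + (1,0)) + flow X (X + (0,1)) + flow X (X - (1,0)) + flow X (X - (0,1)) = 0"
proof -
  let ?N = "{X + (1,0), X + (0,1), X - (1,0), X - (0,1)}"
  let ?V = "{i. P i = X}"
  have N: "Y \<in> ?N \<longleftrightarrow> adjacent X Y" for Y
    by (auto elim: adjacent_cases)
  have 1: "(\<lambda>i. P (i + 1)) ` ?V \<subseteq> ?N" "(\<lambda>i. P (i - 1)) ` ?V \<subseteq> ?N"
    using adj adj' adjacent_sym by (auto simp only: N image_subset_iff mem_Collect_eq)+
  have c: "int (card S) = (\<Sum>Y\<in>?N. of_bool (Y \<in> S))" if "S \<subseteq> ?N" for S
  proof -
    have "(\<Sum>Y\<in>?N. of_bool (Y \<in> S)) = int (card (?N \<inter> S))"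
      by (subst sum_of_bool_eq) (auto simp: Int_def)
    then show ?thesis using that by (simp add: Int_absorb1)
  qed
  have "(\<Sum>Y\<in>?N. of_bool (\<exists>i. P i = X \<and> P (i + 1) = Y)) = int (card ((\<lambda>i. P (i + 1)) ` ?V))"
    unfolding c[OF 1(1)] by (rule sum.cong, simp, rule arg_cong[where f = of_bool]) (simp only: image_iff mem_Collect_eq Bex_def, metis)
  also have "\<dots> = int (card ((\<lambda>i. P (i - 1)) ` ?V))"
    by (simp only: card_image[OF inj_next] card_image[OF inj_prev])
  also have "\<dots> = (\<Sum>Y\<in>?N. of_bool (\<exists>i. P i = Y \<and> P (i + 1) = X))"
    unfolding c[OF 1(2)]
  proof (rule sum.cong, simp, rule arg_cong[where f = of_bool])
    fix Y
    show "(Y \<in> (\<lambda>i. P (i - 1)) ` ?V) = (\<exists>i. P i = Y \<and> P (i + 1) = X)"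
      by (metis (mono_tags, lifting) add_diff_cancel diff_add_cancel image_iff mem_Collect_eq)
  qed
  finally have "(\<Sum>Y\<in>?N. flow X Y) = 0"
    by (simp only: flow_def sum_subtractf)
  moreover have "(\<Sum>Y\<in>?N. flow X Y) =
      flow X (X + (1,0)) + flow X (X + (0,1)) + flow X (X - (1,0)) + flow X (X - (0,1))"
    by (cases X) simp
  ultimately show ?thesis by simp
qed

text \<open>The edges of the curve jump by the same amount, and a turn to one side keeps the face on
  that side.\<close>

lemma potential_along_curve:
  assumes "is_potential w e" "a \<le> b" "\<And>i. a \<le> i \<Longrightarrow> i \<le> b \<Longrightarrow> e (P i) (P (i + 1)) = c"
  shows "w (lface (P b) (P (b + 1))) = w (lface (P a) (P (a + 1))) \<and>
         w (lface (P (b + 1)) (P b)) = w (lface (P (a + 1)) (P a))"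
  using assms(2,3)
proof (induction b rule: int_ge_induct)
  case (step b)
  have j: "w (lface (P i) (P (i + 1))) - w (lface (P (i + 1)) (P i)) = e (P i) (P (i + 1))" for i
    using assms(1) adj by (rule is_potentialD)
  have "e (P b) (P (b + 1)) = c" "e (P (b + 1)) (P (b + 1 + 1)) = c"
    using step(1) step.prems[of b] step.prems[of "b + 1"] by simp_all
  then show ?case
    using tr_cases[of "b + 1"] left_turn_face[of "b + 1"] right_turn_face[of "b + 1"]
      j[of b] j[of "b + 1"] step by auto
qed simp

text \<open>A two-colouring of the squares in which exactly the edges of the curve separate
  different colours. Keeping only these properties of the potential makes the notion invariant under
  reversal with exchanged colours.\<close>

definition side :: "(lattice_point \<Rightarrow> bool) \<Rightarrow> bool" where
  "side f \<longleftrightarrow> (\<forall>i. f (lface (P i) (P (i + 1)))) \<and> (\<forall>i. \<not> f (lface (P (i + 1)) (P i))) \<and>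
     (\<forall>X Y. free P X Y \<longrightarrow> f (lface X Y) = f (lface Y X))"

text \<open>The potential has one value \<open>c\<close> beside the whole curve on the left and
  \<open>c - 1\<close> on the right; the colour is membership in the level \<open>c\<close>.\<close>

lemma ex_side: obtains f where "side f"
proof -
  obtain w where w: "is_potential w flow"
    using ex_potential[of flow] flow_conserved by (auto simp: flow_def)
  define c where "c = w (lface (P 0) (P 1))"
  have jump: "w (lface (P i) (P (i + 1))) - w (lface (P (i + 1)) (P i)) = 1" for i
    using is_potentialD[OF w adj] flow_curve by simp
  have l: "w (lface (P i) (P (i + 1))) = c" for i
  proof (cases "0 \<le> i")
    case True
    then show ?thesis using potential_along_curve[OF w True] flow_curve by (simp add: c_def)
  next
    case False
    then show ?thesis using potential_along_curve[OF w, of i 0] flow_curve by (simp add: c_def)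
  qed
  have "w (lface X Y) = w (lface Y X)" if "free P X Y" for X Y
    using is_potentialD[OF w, of X Y] flow_free[OF that] that by (simp add: free_def)
  moreover have "w (lface (P (i + 1)) (P i)) \<noteq> c" for i
    using jump[of i] l[of i] by simp
  ultimately have "side (\<lambda>p. w p = c)"
    using l unfolding side_def by metis
  then show thesis by (rule that)
qed

text \<open>A free edge at \<open>P i\<close> lies in the outer angle of the turn, which belongs to
  the left side exactly at a right turn. This links turns to sides.\<close>

lemma free_faces:
  assumes "side f" "free P (P i) Y"
  shows "f (lface (P i) Y) \<longleftrightarrow> tr P i = -1" "f (lface Y (P i)) \<longleftrightarrow> tr P i = -1"
proof -
  have ne: "Y \<noteq> P (i - 1)" "Y \<noteq> P (i + 1)"
    using assms(2) spec[of "\<lambda>j. {P j, P (j + 1)} \<noteq> {P i, Y}" "i - 1"]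
      spec[of "\<lambda>j. {P j, P (j + 1)} \<noteq> {P i, Y}" i]
    by (auto simp: free_def insert_commute)
  have a: "adjacent (P i) Y" using assms(2) by (simp add: free_def)
  have e: "f (lface (P i) Y) = f (lface Y (P i))" using assms unfolding side_def by blast
  have s: "f (lface (P (i - 1)) (P i))" "f (lface (P i) (P (i + 1)))"
    "\<not> f (lface (P i) (P (i - 1)))" "\<not> f (lface (P (i + 1)) (P i))"
    using assms(1) spec[of "\<lambda>j. f (lface (P j) (P (j + 1)))" "i - 1"]
      spec[of "\<lambda>j. \<not> f (lface (P (j + 1)) (P j))" "i - 1"] unfolding side_def by auto
  show 1: "f (lface (P i) Y) \<longleftrightarrow> tr P i = -1"
    using turn_side_faces[OF a ne] tr_cases[of i] e s by auto
  show "f (lface Y (P i)) \<longleftrightarrow> tr P i = -1"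
    using 1 e by simp
qed

end

lemma ext_free: "X \<notin> range P \<Longrightarrow> adjacent X Y \<Longrightarrow> free P X Y"
  unfolding free_def by (auto simp: doubleton_eq_iff)

text \<open>All four edges at an exterior point are free, so the four squares around it have one
  colour. As \<open>X\<close> also names the square with lower left corner \<open>X\<close>, the
  value \<open>f X\<close> serves as the side of the point \<open>X\<close>.\<close>

lemma (in turning_curve) ext_faces:
  assumes "side f" "X \<notin> range P" "adjacent X Y"
  shows "f (lface X Y) = f X" "f (lface Y X) = f X"
proof -
  have *: "f (lface X Z) = f (lface Z X)" if "adjacent X Z" for Z
    using assms(1) ext_free[OF assms(2) that] unfolding side_def by blast
  have "f (lface X Y) = f X \<and> f (lface Y X) = f X"
    using assms(3) *[of "X + (1,0)"] *[of "X + (0,1)"] *[of "X - (1,0)"] *[of "X - (0,1)"]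
    by (cases X, cases rule: adjacent_cases) (auto simp: lface_def adjacent_iff)
  then show "f (lface X Y) = f X" "f (lface Y X) = f X" by auto
qed

context turning_curve
begin

lemma ext_tr_iff:
  assumes "side f" "X \<notin> range P" "adjacent X (P i)"
  shows "f X \<longleftrightarrow> tr P i = -1"
  using ext_faces(1)[OF assms] free_faces(2)[OF assms(1) ext_free[OF assms(2,3), THEN free_sym[THEN iffD1]]]
  by simp

lemma ext_side_adjacent:
  assumes "side f" "X \<notin> range P" "Y \<notin> range P" "adjacent X Y"
  shows "f X = f Y"
  using ext_faces(1)[OF assms(1,2,4)] ext_faces(2)[OF assms(1,3) assms(4)[THEN adjacent_sym[THEN iffD1]]]
  by simp

lemma free_tr_eq:
  assumes "free P (P i) (P j)"
  shows "tr P i = tr P j"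
proof -
  obtain f where f: "side f" by (rule ex_side)
  have "tr P i = -1 \<longleftrightarrow> tr P j = -1"
    using free_faces(1)[OF f assms] free_faces(2)[OF f assms[THEN free_sym[THEN iffD1]]] by simp
  then show ?thesis using tr_cases[of i] tr_cases[of j] by auto
qed

lemma ext_ext_tr_eq:
  assumes "X \<notin> range P" "Y \<notin> range P" "adjacent X Y" "adjacent X (P i)" "adjacent Y (P j)"
  shows "tr P i = tr P j"
proof -
  obtain f where f: "side f" by (rule ex_side)
  have "tr P i = -1 \<longleftrightarrow> tr P j = -1"
    using ext_tr_iff[OF f assms(1,4)] ext_tr_iff[OF f assms(2,5)] ext_side_adjacent[OF f assms(1-3)]
    by simp
  then show ?thesis using tr_cases[of i] tr_cases[of j] by auto
qed

lemma ext_tr_eq: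
  assumes "X \<notin> range P" "adjacent X (P i)" "adjacent X (P j)"
  shows "tr P i = tr P j"
proof -
  obtain f where f: "side f" by (rule ex_side)
  have "tr P i = -1 \<longleftrightarrow> tr P j = -1"
    using ext_tr_iff[OF f assms(1,2)] ext_tr_iff[OF f assms(1,3)] by simp
  then show ?thesis using tr_cases[of i] tr_cases[of j] by auto
qed

end

subsection \<open>Folding sequences\<close>

lemma length_bar [simp]: "length (bar S) = length S"
  by (simp add: bar_def)

lemma nth_bar: "k < length S \<Longrightarrow> bar S ! k = - S ! (length S - 1 - k)"
  by (simp add: bar_def rev_nth)

lemma sublist_bar: "sublist xs ys \<Longrightarrow> sublist (bar xs) (bar ys)"
  by (simp add: bar_def map_mono_sublist)

lemma n_folding_bar: "n_folding n S \<Longrightarrow> n_folding n (bar S)"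
proof (induction rule: n_folding.induct)
  case zero then show ?case by (simp add: bar_def n_folding.zero)
next
  case (plus n S)
  have "bar (bar S @ [1] @ S) = bar S @ [-1] @ S"
    by (simp add: bar_def rev_map)
  then show ?case using n_folding.minus[OF plus(1)] by simp
next
  case (minus n S)
  have "bar (bar S @ [-1] @ S) = bar S @ [1] @ S"
    by (simp add: bar_def rev_map)
  then show ?case using n_folding.plus[OF minus(1)] by simp
qed

lemma n_folding_Suc_iff:
  "n_folding (Suc n) S \<longleftrightarrow> (\<exists>U s. n_folding n U \<and> s \<in> {1, -1} \<and> S = bar U @ [s] @ U)"
proof
  show "n_folding (Suc n) S \<Longrightarrow> \<exists>U s. n_folding n U \<and> s \<in> {1, -1} \<and> S = bar U @ [s] @ U"
    by (erule n_folding.cases) blast+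
  show "\<exists>U s. n_folding n U \<and> s \<in> {1, -1} \<and> S = bar U @ [s] @ U \<Longrightarrow> n_folding (Suc n) S"
    using n_folding.plus n_folding.minus by blast
qed

text \<open>With positions counted from \<open>0\<close>, the odd ones carry a folding sequence of
  the next lower order and the even ones alternate. In \<open>bar U @ [s] @ U\<close> the list
  \<open>U\<close> has odd length, so the reversal in \<open>bar\<close> keeps the parity of
  positions and the middle letter has an odd one; both properties pass from \<open>U\<close> to the
  two halves.\<close>

lemma n_folding_unfold:
  assumes "n_folding (Suc n) S"
  shows "\<exists>S'. n_folding n S' \<and> length S = 2 * length S' + 1 \<and>
    (\<forall>m<length S'. S ! (2 * m + 1) = S' ! m) \<and> (\<forall>m<length S'. S ! (2 * m + 2) = - S ! (2 * m))"
  using assms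
proof (induction n arbitrary: S)
  case 0
  then show ?case
    by (auto simp: n_folding_Suc_iff bar_def intro!: exI[of _ "[]"] n_folding.zero elim: n_folding.cases)
next
  case (Suc n)
  obtain U s where U: "n_folding (Suc n) U" "s \<in> {1, -1}" "S = bar U @ [s] @ U"
    using Suc.prems unfolding n_folding_Suc_iff[of "Suc n"] by blast
  obtain U' where U': "n_folding n U'" and len: "length U = 2 * length U' + 1"
    and odd: "\<And>m. m < length U' \<Longrightarrow> U ! (2 * m + 1) = U' ! m"
    and even: "\<And>m. m < length U' \<Longrightarrow> U ! (2 * m + 2) = - U ! (2 * m)"
    using Suc.IH[OF U(1)] by blast
  define L where "L = length U'"
  define S' where "S' = bar U' @ [s] @ U'"
  have lS': "length S' = 2 * L + 1" by (simp add: S'_def L_def)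
  have "n_folding (Suc n) S'" unfolding n_folding_Suc_iff S'_def using U' U(2) by blast
  moreover have "length S = 2 * length S' + 1"
    by (simp add: U(3) len S'_def)
  moreover have "S ! (2 * m + 1) = S' ! m" if "m < length S'" for m
  proof -
    consider "m < L" | "m = L" | "L < m" by linarith
    then show ?thesis
    proof cases
      case 1
      then have "2 * L - (2 * m + 1) = 2 * (L - 1 - m) + 1" by simp
      then have "S ! (2 * m + 1) = - U ! (2 * (L - 1 - m) + 1)"
        using 1 len by (simp add: U(3) nth_append nth_bar L_def)
      also have "\<dots> = - U' ! (L - 1 - m)" using odd[of "L - 1 - m"] 1 by (simp add: L_def)
      also have "\<dots> = S' ! m" using 1 by (simp add: S'_def nth_append nth_bar L_def)
      finally show ?thesis .
    next
      case 2
      then show ?thesis using len by (simp add: U(3) S'_def nth_append L_def)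
    next
      case 3
      define k where "k = m - L - 1"
      have k: "m = L + 1 + k" "k < L" using 3 that lS' by (auto simp: k_def)
      then have "S ! (2 * m + 1) = U ! (2 * k + 1)"
        using len by (simp add: U(3) nth_append L_def)
      also have "\<dots> = U' ! k" using odd k by (simp add: L_def)
      also have "\<dots> = S' ! m" using k by (simp add: S'_def nth_append L_def)
      finally show ?thesis .
    qed
  qed
  moreover have "S ! (2 * m + 2) = - S ! (2 * m)" if "m < length S'" for m
  proof -
    consider "m < L" | "m = L" | "L < m" by linarith
    then show ?thesis
    proof cases
      case 1
      then have a: "2 * L - (2 * m + 2) = 2 * (L - 1 - m)" "2 * L - 2 * m = 2 * (L - 1 - m) + 2" by simp_all
      have "S ! (2 * m + 2) = - U ! (2 * (L - 1 - m))"
        using 1 len a(1) by (simp add: U(3) nth_append nth_bar L_def)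
      moreover have "S ! (2 * m) = - U ! (2 * (L - 1 - m) + 2)"
        using 1 len a(2) by (simp add: U(3) nth_append nth_bar L_def)
      ultimately show ?thesis using even[of "L - 1 - m"] 1 by (simp add: L_def)
    next
      \<comment> \<open>The even entries next to the middle letter are the last entry of
        \<open>bar U\<close>, which is \<open>- U ! 0\<close>, and the first entry
        \<open>U ! 0\<close> of the second half.\<close>
      case 2
      then show ?thesis using len by (simp add: U(3) nth_append nth_bar L_def)
    next
      case 3
      define k where "k = m - L - 1"
      have k: "m = L + 1 + k" "k < L" using 3 that lS' by (auto simp: k_def)
      then have "S ! (2 * m + 2) = U ! (2 * k + 2)" "S ! (2 * m) = U ! (2 * k)"
        using len by (simp_all add: U(3) nth_append L_def)
      then show ?thesis using even k by (simp add: L_def)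
    qed
  qed
  ultimately show ?case by blast
qed

lemma complete_folding_sequence_shift:
  assumes "complete_folding_sequence a"
  shows "complete_folding_sequence (\<lambda>i. a (i + e))"
  unfolding complete_folding_sequence_def
proof (intro conjI allI)
  show "range (\<lambda>i. a (i + e)) \<subseteq> {1, -1}"
    using assms by (auto simp: complete_folding_sequence_def)
  fix h m
  have "map (\<lambda>k. a (h + int k + e)) [1..<Suc m] = map (\<lambda>k. a ((h + e) + int k)) [1..<Suc m]"
    by (simp add: algebra_simps)
  then show "\<exists>n S. n_folding n S \<and> sublist (map (\<lambda>k. a (h + int k + e)) [1..<Suc m]) S"
    using assms unfolding complete_folding_sequence_def by metis
qed

text \<open>Running through a curve backwards reverses the order of its turns and changes their
  signs. On finite blocks this is \<open>bar\<close>, which preserves folding sequences.\<close>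

lemma complete_folding_sequence_reverse:
  assumes "complete_folding_sequence a"
  shows "complete_folding_sequence (\<lambda>i. - a (- i))"
  unfolding complete_folding_sequence_def
proof (intro conjI allI)
  show "range (\<lambda>i. - a (- i)) \<subseteq> {1, -1}"
    using assms by (force simp: complete_folding_sequence_def)
  fix h m
  \<comment> \<open>The block of \<open>a\<close> at the positions \<open>- h - m\<close> to
    \<open>- h - 1\<close>, the mirror image of \<open>h + 1\<close> to
    \<open>h + m\<close>.\<close>
  let ?xs = "map (\<lambda>k. a ((- h - int m - 1) + int k)) [1..<Suc m]"
  obtain n S where S: "n_folding n S" "sublist ?xs S"
    using assms unfolding complete_folding_sequence_def by metis
  have "map (\<lambda>k. - a (- (h + int k))) [1..<Suc m] = bar ?xs"
  proof (rule nth_equalityI)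
    fix k assume "k < length (map (\<lambda>k. - a (- (h + int k))) [1..<Suc m])"
    then have k: "k < m" by (simp del: upt_Suc)
    then have 1: "(- h - int m - 1) + int (Suc (m - Suc k)) = - (h + int (Suc k))" by simp
    have 2: "bar ?xs ! k = - a ((- h - int m - 1) + int (Suc (m - Suc k)))"
      using k by (simp add: nth_bar del: upt_Suc of_nat_Suc)
    have 3: "map (\<lambda>k. - a (- (h + int k))) [1..<Suc m] ! k = - a (- (h + int (Suc k)))"
      using k by (simp del: upt_Suc of_nat_Suc)
    show "map (\<lambda>k. - a (- (h + int k))) [1..<Suc m] ! k = bar ?xs ! k"
      unfolding 1 2 3 ..
  qed simp
  moreover have "sublist (bar ?xs) (bar S)"
    using S(2) by (rule sublist_bar)
  ultimately show "\<exists>n S. n_folding n S \<and> sublist (map (\<lambda>k. - a (- (h + int k))) [1..<Suc m]) S"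
    using n_folding_bar[OF S(1)] by metis
qed

text \<open>Every window around \<open>0\<close> is a block of some finite folding sequence, where
  \<open>n_folding_unfold\<close> applies. The offset of the block depends on the window; a
  compactness argument finds one parity of offsets that serves all windows.\<close>

lemma complete_folding_sequence_unfold:
  assumes a: "complete_folding_sequence a"
  obtains e where "\<And>x. even (x + e) \<Longrightarrow> a (x + 2) = - a x"
    "complete_folding_sequence (\<lambda>k. a (2 * k + 1 + e))"
proof -
  define Q where "Q N e \<longleftrightarrow> (\<exists>n S p. n_folding n S \<and> even (p + e) \<and>
     (\<forall>x. - int N \<le> x \<and> x \<le> int N \<longrightarrow> 0 \<le> x + p \<and> x + p < int (length S) \<and> a x = S ! nat (x + p)))"
    for N and e :: int
  have ex: "Q N 0 \<or> Q N 1" for N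
  proof -
    let ?xs = "map (\<lambda>k. a ((- int N - 1) + int k)) [1..<Suc (2 * N + 1)]"
    obtain n S where S: "n_folding n S" "sublist ?xs S"
      using a unfolding complete_folding_sequence_def by metis
    then obtain ps ss where ps: "S = ps @ ?xs @ ss" by (auto simp: sublist_def)
    define p where "p = int (length ps) + int N"
    have "0 \<le> x + p \<and> x + p < int (length S) \<and> a x = S ! nat (x + p)"
      if "- int N \<le> x \<and> x \<le> int N" for x
    proof -
      define j where "j = nat (x + int N)"
      have j: "x = int j - int N" "j < 2 * N + 1" using that by (auto simp: j_def)
      then have x: "nat (x + p) = length ps + j" by (simp add: p_def)
      have "S ! nat (x + p) = ?xs ! j"
        using j(2) unfolding x by (subst ps) (simp add: nth_append del: upt_Suc)
      also have "\<dots> = a x" using j by (simp del: upt_Suc)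
      finally show ?thesis using j by (simp add: p_def ps)
    qed
    then have "Q N (p mod 2)"
      unfolding Q_def using S(1) by (intro exI[of _ n] exI[of _ S] exI[of _ p]) (auto simp: mod2_eq_if)
    then show ?thesis by (metis even_iff_mod_2_eq_zero odd_iff_mod_2_eq_one)
  qed
  have anti: "Q N e" if "Q M e" "N \<le> M" for N M e
  proof -
    have "- int M \<le> x \<and> x \<le> int M" if "- int N \<le> x \<and> x \<le> int N" for x
      using that \<open>N \<le> M\<close> by linarith
    with \<open>Q M e\<close> show ?thesis unfolding Q_def by meson
  qed
  \<comment> \<open>A parity that serves a window serves all smaller ones. If both parities failed,
    each at some window, then neither would serve the larger of the two windows.\<close>
  have "\<exists>e. \<forall>N. Q N e"
  proof (rule ccontr)
    assume "\<nexists>e. \<forall>N. Q N e"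
    then obtain M N where "\<not> Q M 0" "\<not> Q N 1" by blast
    then show False using ex[of "max M N"] anti by (metis max.cobounded1 max.cobounded2)
  qed
  then obtain e where e: "\<And>N. Q N e" by blast
  have win: "\<exists>n S S' c. n_folding n S' \<and> length S = 2 * length S' + 1 \<and>
      (\<forall>m<length S'. S ! (2 * m + 1) = S' ! m) \<and> (\<forall>m<length S'. S ! (2 * m + 2) = - S ! (2 * m)) \<and>
     (\<forall>x. - int N \<le> x \<and> x \<le> int N \<longrightarrow>
        0 \<le> x + 2 * c - e \<and> x + 2 * c - e < int (length S) \<and> a x = S ! nat (x + 2 * c - e))" for N
  proof -
    obtain n S p where S: "n_folding n S" and p: "even (p + e)" and
      x: "\<forall>x. - int N \<le> x \<and> x \<le> int N \<longrightarrow> 0 \<le> x + p \<and> x + p < int (length S) \<and> a x = S ! nat (x + p)"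
      using e[of N] unfolding Q_def by blast
    obtain c where "p + e = 2 * c" using p evenE by blast
    \<comment> \<open>Hence \<open>x + e\<close> and the position \<open>x + p\<close> of
      \<open>a x\<close> have the same parity, and the alternating positions are those with
      \<open>x + e\<close> even.\<close>
    then have c: "p = 2 * c - e" by simp
    have "S \<noteq> []" using spec[OF x, of 0] by auto
    then obtain n' where n': "n = Suc n'" using S by (auto elim: n_folding.cases)
    obtain S' where "n_folding n' S'" "length S = 2 * length S' + 1"
      "(\<forall>m<length S'. S ! (2 * m + 1) = S' ! m)" "(\<forall>m<length S'. S ! (2 * m + 2) = - S ! (2 * m))"
      using n_folding_unfold S unfolding n' by blast
    then show ?thesis using x unfolding c
      by (intro exI[of _ n'] exI[of _ S] exI[of _ S'] exI[of _ c]) (simp add: algebra_simps)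
  qed
  show thesis
  proof
    fix x assume ev: "even (x + e)"
    define N where "N = nat (\<bar>x\<bar> + 2)"
    obtain S and S' :: "int list" and c where len: "length S = 2 * length S' + 1"
      and alt: "\<forall>m<length S'. S ! (2 * m + 2) = - S ! (2 * m)"
      and w': "\<forall>x. - int N \<le> x \<and> x \<le> int N \<longrightarrow>
        0 \<le> x + 2 * c - e \<and> x + 2 * c - e < int (length S) \<and> a x = S ! nat (x + 2 * c - e)"
      using win[of N] by blast
    note w = w'[rule_format, OF conjI]
    obtain y where "x + e = 2 * y" using ev evenE by blast
    then have y: "x = 2 * y - e" by simp
    have b: "- int N \<le> x" "x \<le> int N" "- int N \<le> x + 2" "x + 2 \<le> int N" by (auto simp: N_def)
    define m where "m = nat (y + c - e)"
    have m: "x + 2 * c - e = 2 * int m" "x + 2 + 2 * c - e = 2 * int m + 2"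
      using w[OF b(1,2)] by (auto simp: m_def y)
    have n: "nat (2 * int m) = 2 * m" "nat (2 * int m + 2) = 2 * m + 2" by auto
    have "m < length S'" using w[OF b(3,4)] m(2) len by auto
    then show "a (x + 2) = - a x"
      using w[OF b(1,2)] w[OF b(3,4)] alt unfolding m n by simp
  next
    show "complete_folding_sequence (\<lambda>k. a (2 * k + 1 + e))"
      unfolding complete_folding_sequence_def
    proof (intro conjI allI)
      show "range (\<lambda>k. a (2 * k + 1 + e)) \<subseteq> {1, -1}"
        using a by (auto simp: complete_folding_sequence_def)
      fix h and m :: nat
      define N where "N = nat (2 * \<bar>h\<bar> + 2 * int m + \<bar>e\<bar> + 1)"
      obtain n S S' c where S': "n_folding n S'" and len: "length S = 2 * length S' + 1"
        and odd: "\<forall>m<length S'. S ! (2 * m + 1) = S' ! m"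
        and w0: "\<forall>x. - int N \<le> x \<and> x \<le> int N \<longrightarrow>
          0 \<le> x + 2 * c - e \<and> x + 2 * c - e < int (length S) \<and> a x = S ! nat (x + 2 * c - e)"
        using win[of N] by blast
      note w = w0[rule_format, OF conjI]
      \<comment> \<open>The value \<open>k = 0\<close> is included although the block starts at
        \<open>1\<close>: it gives \<open>0 \<le> h + c\<close>, which is needed to split the
        \<open>nat\<close> conversions below.\<close>
      have el: "h + int k + c \<ge> 0 \<and> nat (h + int k + c) < length S' \<and>
          a (2 * (h + int k) + 1 + e) = S' ! nat (h + int k + c)" if "k \<le> m" for k
      proof -
        let ?x = "2 * (h + int k) + 1 + e"
        have "- int N \<le> ?x" "?x \<le> int N" using that by (auto simp: N_def)
        from w[OF this] have w': "0 \<le> 2 * (h + int k + c) + 1" "2 * (h + int k + c) + 1 < int (length S)"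
          "a ?x = S ! nat (2 * (h + int k + c) + 1)" by (auto simp: algebra_simps)
        then have "0 \<le> h + int k + c" by presburger
        moreover from this have "nat (2 * (h + int k + c) + 1) = 2 * nat (h + int k + c) + 1"
          by (simp add: nat_add_distrib nat_mult_distrib)
        ultimately show ?thesis using w' len odd by auto
      qed
      have "map (\<lambda>k. a (2 * (h + int k) + 1 + e)) [1..<Suc m] = take m (drop (nat (h + 1 + c)) S')"
      proof (rule nth_equalityI)
        show "length (map (\<lambda>k. a (2 * (h + int k) + 1 + e)) [1..<Suc m]) =
            length (take m (drop (nat (h + 1 + c)) S'))"
        proof (cases "m = 0")
          case False
          then have "nat (h + int m + c) = nat (h + 1 + c) + (m - 1)"
            using conjunct1[OF el[of 0]] by auto
          then show ?thesis using el[of m] False by (simp del: upt_Suc) linarith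
        qed simp
        fix k assume "k < length (map (\<lambda>k. a (2 * (h + int k) + 1 + e)) [1..<Suc m])"
        then have k: "k < m" by (simp del: upt_Suc)
        then have "nat (h + int (Suc k) + c) = nat (h + 1 + c) + k"
          using conjunct1[OF el[of 0]] by auto
        then show "map (\<lambda>k. a (2 * (h + int k) + 1 + e)) [1..<Suc m] ! k =
            take m (drop (nat (h + 1 + c)) S') ! k"
          using k el[of "Suc k"] by (simp add: add.commute del: upt_Suc)
      qed
      then show "\<exists>n S. n_folding n S \<and> sublist (map (\<lambda>k. a (2 * (h + int k) + 1 + e)) [1..<Suc m]) S"
        using S' by (metis sublist_take sublist_drop sublist_order.order.trans)
    qed
  qed
qed

definition folding_curve :: "(int \<Rightarrow> lattice_point) \<Rightarrow> bool" where
  "folding_curve P \<longleftrightarrow> turning_curve P \<and> complete_folding_sequence (tr P)"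

lemma tr_shift: "tr (\<lambda>i. P (i + e)) i = tr P (i + e)"
  by (simp add: tr_def algebra_simps)

lemma turning_curve_shift:
  assumes "turning_curve P"
  shows "turning_curve (\<lambda>i. P (i + e))"
proof -
  interpret turning_curve P by fact
  have s: "i + 1 + e = (i + e) + 1" "i - 1 + e = (i + e) - 1" for i by simp_all
  show ?thesis
  proof (unfold_locales, goal_cases)
    case 1 then show ?case unfolding s by (rule adj)
  next
    case 2 then show ?case unfolding s by (rule perp)
  next
    case (3 i j) then show ?case using edge_inj[of "i + e" "j + e"] unfolding s by simp
  qed
qed

lemma folding_curve_shift: "folding_curve P \<Longrightarrow> folding_curve (\<lambda>i. P (i + e))"
  using complete_folding_sequence_shift[of "tr P" e] turning_curve_shift[of P e]
  by (simp add: folding_curve_def tr_shift[abs_def])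

lemma turn_reverse: "turn (- v) (- u) = - turn u v"
  by (simp add: turn_def sgn_if mult.commute)

lemma tr_reverse: "tr (\<lambda>i. P (- i)) i = - tr P (- i)"
proof -
  have "- (i + 1) = - i - 1" "- (i - 1) = - i + 1" by simp_all
  then show ?thesis
    using turn_reverse[of "P (- i + 1) - P (- i)" "P (- i) - P (- i - 1)"]
    unfolding tr_def by (simp only: minus_diff_eq)
qed

lemma turning_curve_reverse:
  assumes "turning_curve P"
  shows "turning_curve (\<lambda>i. P (- i))"
proof -
  interpret turning_curve P by fact
  have s: "- (i + 1) = - i - 1" "- (i - 1) = - i + 1" for i :: int by simp_all
  show ?thesis
  proof (unfold_locales, goal_cases)
    case (1 i) then show ?case using adj'[of "- i"] unfolding s by (simp add: adjacent_sym)
  next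
    case (2 i) then show ?case using perp[of "- i"] unfolding s by (simp add: algebra_simps)
  next
    case (3 i j)
    then show ?case using edge_inj[of "- i - 1" "- j - 1"] unfolding s by (simp add: insert_commute)
  qed
qed

lemma folding_curve_reverse: "folding_curve P \<Longrightarrow> folding_curve (\<lambda>i. P (- i))"
  using complete_folding_sequence_reverse[of "tr P"] turning_curve_reverse[of P]
  by (simp add: folding_curve_def tr_reverse[abs_def])

subsection \<open>The derived curve\<close>

context turning_curve
begin

text \<open>In complex notation: the next step is the previous one times \<open>tr P i\<close> times
  the imaginary unit.\<close>

lemma step_rec:
  "P (i + 1) - P i = (- tr P i * snd (P i - P (i - 1)), tr P i * fst (P i - P (i - 1)))"
proof (rule local_shape[of i])
  fix a b assume *: "P (i - 1) = P i - (a, b)"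
    "tr P i = 1 \<and> P (i + 1) = P i + (- b, a) \<or> tr P i = -1 \<and> P (i + 1) = P i + (b, - a)"
  then have "P i - P (i - 1) = (a, b)" by simp
  with *(2) show ?thesis by auto
qed

lemma unit_step: "P (i + 1) - P i \<in> units"
  using adj[of i] by (simp only: adjacent_iff)

lemma step_coords:
  obtains a b where "(a, b) \<in> units"
    "fst (P (i + 1)) = fst (P i) + a" "snd (P (i + 1)) = snd (P i) + b"
  using unit_step[of i] that[of "fst (P (i + 1)) - fst (P i)" "snd (P (i + 1)) - snd (P i)"]
  by (simp add: minus_prod_def)

lemma axis_step: "fst (P (i + 1) - P i) = 0 \<longleftrightarrow> fst (P i - P (i - 1)) \<noteq> 0"
  using unit_step[of i] unit_step[of "i - 1"] step_rec[of i] tr_cases[of i]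
  by (auto simp del: split_paired_All)

lemma axis_parity:
  "(fst (P (i + 1) - P i) = 0 \<longleftrightarrow> fst (P (j + 1) - P j) = 0) \<longleftrightarrow> even (i - j)"
proof (induction i rule: int_induct[where k = j])
  case (step1 i) then show ?case using axis_step[of "i + 1"] by (auto simp: algebra_simps)
next
  case (step2 i) then show ?case using axis_step[of i] by (auto simp: algebra_simps)
qed simp

lemma sum_parity: "even (fst (P i) + snd (P i) - (fst (P j) + snd (P j))) \<longleftrightarrow> even (i - j)"
proof -
  have s: "odd (fst (P (i + 1)) + snd (P (i + 1)) - (fst (P i) + snd (P i)))" for i
    by (rule step_coords[of i]) auto
  show ?thesis
  proof (induction i rule: int_induct[where k = j])
    case (step1 i) then show ?case using s[of i] by auto
  next
    case (step2 i) then show ?case using s[of "i - 1"] by auto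
  qed simp
qed

lemma odd_fst_step: "odd (fst (P (i + 2)) - fst (P i))"
proof -
  have "odd (fst (P (i + 1 + 1)) - fst (P i))"
    by (rule step_coords[of i], rule step_coords[of "i + 1"], insert axis_step[of "i + 1"]) auto
  then show ?thesis by (simp add: add.assoc)
qed

text \<open>Of two consecutive steps exactly one is horizontal, so along every second vertex the
  first coordinate changes parity each time. Thus the position of a vertex reveals its index modulo
  \<open>4\<close> within its parity class.\<close>

lemma fst_parity: "even (fst (P (i + 2 * k)) - fst (P i)) \<longleftrightarrow> even k"
proof (induction k rule: int_induct[where k = 0])
  case (step1 k) then show ?case using odd_fst_step[of "i + 2 * k"] by (auto simp: algebra_simps)
next
  case (step2 k) then show ?case using odd_fst_step[of "i + 2 * (k - 1)"] by (auto simp: algebra_simps)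
qed simp

end

lemma alternating_parity:
  fixes T :: "int \<Rightarrow> int"
  assumes "\<And>i. odd i \<Longrightarrow> T (i + 2) = - T i" "odd i"
  shows "T (i + 2 * k) = (if even k then T i else - T i)"
proof (induction k rule: int_induct[where k = 0])
  case (step1 k) then show ?case using assms(1)[of "i + 2 * k"] assms(2) by (auto simp: algebra_simps)
next
  case (step2 k) then show ?case using assms(1)[of "i + 2 * (k - 1)"] assms(2) by (auto simp: algebra_simps)
qed simp

text \<open>Multiplication by \<open>1 + \<i>\<close> followed by a translation.\<close>

definition emb :: "lattice_point \<Rightarrow> lattice_point \<Rightarrow> lattice_point" where
  "emb o' a = o' + (fst a - snd a, fst a + snd a)"

lemma emb_inject [simp]: "emb o' a = emb o' b \<longleftrightarrow> a = b"
  by (cases a; cases b) (auto simp: emb_def)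

text \<open>The indices of \<open>P\<close> are normalised so that the odd vertices are the
  alternating ones. The even vertices are kept, read in the lattice enlarged by
  \<open>1 + \<i>\<close> with origin \<open>P 0\<close>.\<close>

definition derived :: "(int \<Rightarrow> lattice_point) \<Rightarrow> (int \<Rightarrow> lattice_point) \<Rightarrow> bool" where
  "derived P D \<longleftrightarrow> folding_curve P \<and> folding_curve D \<and> (\<forall>k. P (2 * k) = emb (P 0) (D k)) \<and>
     (\<forall>k. tr P (2 * k) = tr D k) \<and> (\<forall>i. odd i \<longrightarrow> tr P (i + 2) = - tr P i)"

text \<open>Steps are grouped in pairs. The sum of two perpendicular unit steps is a diagonal
  vector, that is \<open>1 + \<i>\<close> times a unit vector \<open>d k\<close>, and these vectors
  are the steps of \<open>D\<close>.\<close>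

lemma derived_exists_aux:
  assumes R: "folding_curve R" and alt: "\<And>i. odd i \<Longrightarrow> tr R (i + 2) = - tr R i"
    and b: "complete_folding_sequence (\<lambda>k. tr R (2 * k))"
  shows "\<exists>D. derived R D"
proof -
  interpret turning_curve R using R by (simp add: folding_curve_def)
  define u where "u k = R (2 * k + 1) - R (2 * k)" for k
  \<comment> \<open>With \<open>i\<close> the imaginary unit, a left turn between the two steps
    gives \<open>u + i u = (1 + i) u\<close>, a right turn gives
    \<open>u - i u = (1 + i) (- i u)\<close>.\<close>
  define d where "d k = (if tr R (2 * k + 1) = 1 then u k else (snd (u k), - fst (u k)))" for k
  define M where "M a = (fst a - snd a, fst a + snd a :: int)" for a :: lattice_point
  have emb: "emb o' a = o' + M a" for o' a by (simp add: emb_def M_def)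
  have Madd: "M (a + b) = M a + M b" "M (a - b) = M a - M b" for a b by (simp_all add: M_def)
  have Md: "R (2 * (k + 1)) = R (2 * k) + M (d k)" for k
  proof -
    have "R (2 * k + 1 + 1) - R (2 * k + 1) = (- tr R (2 * k + 1) * snd (u k), tr R (2 * k + 1) * fst (u k))"
      using step_rec[of "2 * k + 1"] by (simp add: u_def)
    then have "R (2 * k + 1 + 1) - R (2 * k) = u k + (- tr R (2 * k + 1) * snd (u k), tr R (2 * k + 1) * fst (u k))"
      by (simp add: u_def algebra_simps)
    also have "\<dots> = M (d k)"
      using tr_cases[of "2 * k + 1"] by (cases "u k") (auto simp: d_def M_def)
    finally show ?thesis by (simp add: algebra_simps)
  qed
  have "\<exists>a. R (2 * k) = emb (R 0) a" for k
  proof (induction k rule: int_induct[where k = 0])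
    case base show ?case by (rule exI[of _ 0]) (simp add: emb_def zero_prod_def)
  next
    case (step1 k)
    then obtain a where "R (2 * k) = R 0 + M a" unfolding emb by blast
    then have "R (2 * (k + 1)) = R 0 + M (a + d k)" unfolding Md Madd by simp
    then show ?case unfolding emb by blast
  next
    case (step2 k)
    then obtain a where "R (2 * k) = R 0 + M a" unfolding emb by blast
    then have "R (2 * (k - 1)) = R 0 + M (a - d (k - 1))"
      using Md[of "k - 1"] unfolding Madd by (simp add: algebra_simps)
    then show ?case unfolding emb by blast
  qed
  then obtain D where D: "\<And>k. R (2 * k) = emb (R 0) (D k)" by metis
  have Dd: "D (k + 1) = D k + d k" for k
  proof -
    have "emb (R 0) (D (k + 1)) = emb (R 0) (D k + d k)"
      using Md[of k] unfolding D emb Madd by simp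
    then show ?thesis by simp
  qed
  then have Ds: "D (k + 1) - D k = d k" "D k - D (k - 1) = d (k - 1)" for k
    using Dd[of "k - 1"] by simp_all
  have u: "u k \<in> units" for k
    unfolding u_def by (rule unit_step)
  have d: "d k \<in> units" for k
    using u[of k] by (auto simp: d_def)
  \<comment> \<open>The turns at \<open>2 * k - 1\<close> and \<open>2 * k + 1\<close> are opposite
    and their contributions cancel, so \<open>D\<close> turns at \<open>k\<close> as
    \<open>R\<close> does at \<open>2 * k\<close>.\<close>
  have d_rec: "d k = (- tr R (2 * k) * snd (d (k - 1)), tr R (2 * k) * fst (d (k - 1)))" for k
  proof -
    have 1: "u k = (- tr R (2 * k) * snd (R (2 * k) - R (2 * k - 1)), tr R (2 * k) * fst (R (2 * k) - R (2 * k - 1)))"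
      unfolding u_def by (rule step_rec)
    have "R (2 * k) - R (2 * k - 1) = (- tr R (2 * k - 1) * snd (u (k - 1)), tr R (2 * k - 1) * fst (u (k - 1)))"
      using step_rec[of "2 * k - 1"] by (simp add: u_def algebra_simps)
    with 1 have 2: "u k = (- tr R (2 * k) * (tr R (2 * k - 1) * fst (u (k - 1))), tr R (2 * k) * (- tr R (2 * k - 1) * snd (u (k - 1))))"
      by simp
    have 3: "tr R (2 * k + 1) = - tr R (2 * k - 1)" using alt[of "2 * k - 1"] by (simp add: algebra_simps)
    have 4: "d (k - 1) = (if tr R (2 * k - 1) = 1 then u (k - 1) else (snd (u (k - 1)), - fst (u (k - 1))))"
      by (simp add: d_def algebra_simps)
    show ?thesis
      using tr_cases[of "2 * k - 1"] unfolding d_def[of k] 4 3 2 by (cases "u (k - 1)") auto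
  qed
  have trD: "tr D k = tr R (2 * k)" for k
  proof -
    have "tr D k = turn (d (k - 1)) (d k)" by (simp only: tr_def Ds)
    then show ?thesis
      using d[of "k - 1"] tr_cases[of "2 * k"] unfolding d_rec[of k] turn_def
      by (elim insertE emptyE disjE) (simp_all del: split_paired_All)
  qed
  have inj: "k = l" if "{D k, D (k + 1)} = {D l, D (l + 1)}" for k l
  proof -
    \<comment> \<open>All steps of even index lie on one axis, and the turn at
      \<open>2 * k + 1\<close> decides whether \<open>d k\<close> lies on this axis or on the other.
      Parallel steps of \<open>D\<close> therefore belong to equal turns.\<close>
    have ax: "fst (u k) = 0 \<longleftrightarrow> fst (u l) = 0"
      unfolding u_def using axis_parity[of "2 * k" "2 * l"] by simp
    have t: "tr R (2 * k + 1) = tr R (2 * l + 1)" if "d k = d l \<or> d k = - d l"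
      using that ax u[of k] u[of l] tr_cases[of "2 * k + 1"] tr_cases[of "2 * l + 1"]
      by (auto simp: d_def split: if_splits)
    consider "D k = D l" "D (k + 1) = D (l + 1)" | "D k = D (l + 1)" "D (k + 1) = D l"
      using \<open>{D k, D (k + 1)} = {D l, D (l + 1)}\<close> by (auto simp: doubleton_eq_iff)
    then show ?thesis
    proof cases
      case 1
      then have dk: "d k = d l" using Ds(1)[of k] Ds(1)[of l] by simp
      with t have tt: "tr R (2 * k + 1) = tr R (2 * l + 1)" by blast
      have "u k = u l" using dk unfolding d_def tt by (simp add: prod_eq_iff split: if_splits)
      moreover have "R (2 * k) = R (2 * l)" using D 1 by simp
      ultimately have "R (2 * k + 1) = R (2 * l + 1)" by (simp add: u_def)
      with \<open>R (2 * k) = R (2 * l)\<close> show ?thesis using edge_inj[of "2 * k" "2 * l"] by simp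
    next
      \<comment> \<open>An edge used in opposite directions: the positions force
        \<open>k - l\<close> to be odd, so by alternation the turns at \<open>2 * k + 1\<close> and
        \<open>2 * l + 1\<close> differ, against \<open>t\<close>.\<close>
      case 2
      then have dk: "d k = - d l" using Ds(1)[of k] Ds(1)[of l] by (metis minus_diff_eq)
      have "R (2 * k) = R (2 * (l + 1))" by (simp only: D 2)
      then have "even (k - l - 1)"
        using fst_parity[of "2 * (l + 1)" "k - l - 1"] by (simp add: algebra_simps)
      moreover have "tr R (2 * k + 1) = (if even (k - l) then tr R (2 * l + 1) else - tr R (2 * l + 1))"
        using alternating_parity[of "tr R" "2 * l + 1" "k - l", OF alt] by (simp add: algebra_simps)
      ultimately show ?thesis using t dk tr_cases[of "2 * l + 1"] by auto
    qed
  qed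
  have "turning_curve D"
  proof
    show "adjacent (D i) (D (i + 1))" for i
      unfolding adjacent_iff Ds by (rule d)
    show "fst (D i - D (i - 1)) * fst (D (i + 1) - D i) + snd (D i - D (i - 1)) * snd (D (i + 1) - D i) = 0" for i
      unfolding Ds d_rec[of i] by simp
  qed (rule inj)
  moreover have "tr D = (\<lambda>k. tr R (2 * k))" using trD by blast
  ultimately have "folding_curve D" using b by (simp add: folding_curve_def)
  then show ?thesis using R D trD alt unfolding derived_def by metis
qed

lemma ex_derived:
  assumes "folding_curve P"
  obtains e D where "derived (\<lambda>i. P (i + e)) D"
proof -
  obtain e where e: "\<And>x. even (x + e) \<Longrightarrow> tr P (x + 2) = - tr P x"
    "complete_folding_sequence (\<lambda>k. tr P (2 * k + 1 + e))"
    using assms complete_folding_sequence_unfold by (metis folding_curve_def)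
  \<comment> \<open>The alternating indices \<open>x\<close> satisfy \<open>even (x + e)\<close>;
    the extra \<open>1\<close> in the shift turns them into the odd ones.\<close>
  have "\<exists>D. derived (\<lambda>i. P (i + (1 + e))) D"
  proof (rule derived_exists_aux)
    show "folding_curve (\<lambda>i. P (i + (1 + e)))" using assms by (rule folding_curve_shift)
    show "tr (\<lambda>i. P (i + (1 + e))) (i + 2) = - tr (\<lambda>i. P (i + (1 + e))) i" if "odd i" for i
      using e(1)[of "i + (1 + e)"] that unfolding tr_shift by (simp add: algebra_simps)
    show "complete_folding_sequence (\<lambda>k. tr (\<lambda>i. P (i + (1 + e))) (2 * k))"
      using e(2) unfolding tr_shift by (simp add: algebra_simps)
  qed
  then show thesis using that by blast
qed

text \<open>At odd vertices the turn is a function of the position: it alternates along them, and so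
  does the parity of the first coordinate. Diagonal neighbours differ in that parity.\<close>

lemma derived_diagonal:
  assumes "derived P D" "odd i" "\<bar>fst (P j) - fst (P i)\<bar> = 1" "\<bar>snd (P j) - snd (P i)\<bar> = 1"
  shows "tr P j = - tr P i"
proof -
  interpret turning_curve P using assms(1) by (simp add: derived_def folding_curve_def)
  have alt: "\<And>i. odd i \<Longrightarrow> tr P (i + 2) = - tr P i" using assms(1) by (simp add: derived_def)
  have o: "odd (fst (P j) - fst (P i))" "odd (snd (P j) - snd (P i))"
    using assms(3,4) by presburger+
  then have "even (fst (P j) + snd (P j) - (fst (P i) + snd (P i)))"
    by auto
  then have "even (j - i)" using sum_parity[of j i] by blast
  then obtain k where "j - i = 2 * k" using evenE by blast
  then have k: "j = i + 2 * k" by simp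
  have "odd k" using fst_parity[of i k] o(1) by (simp add: k)
  then show ?thesis using alternating_parity[of "tr P" i k, OF alt] assms(2) by (simp add: k)
qed

subsection \<open>Connectedness and enclosed regions\<close>

declare split_paired_All [simp del] split_paired_Ex [simp del]

definition conn :: "lattice_point set \<Rightarrow> lattice_point \<Rightarrow> lattice_point \<Rightarrow> bool" where
  "conn E = (\<lambda>X Y. X \<in> E \<and> Y \<in> E \<and> adjacent X Y)\<^sup>*\<^sup>*"

lemma conn_refl [simp]: "conn E X X"
  by (simp add: conn_def)

lemma conn_trans [trans]: "conn E X Y \<Longrightarrow> conn E Y Z \<Longrightarrow> conn E X Z"
  by (simp add: conn_def)

lemma conn_step: "X \<in> E \<Longrightarrow> Y \<in> E \<Longrightarrow> adjacent X Y \<Longrightarrow> conn E X Y"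
  by (auto simp: conn_def)

lemma conn_sym: "conn E X Y \<Longrightarrow> conn E Y X"
  unfolding conn_def
  by (induction rule: rtranclp_induct) (auto simp: adjacent_sym intro: converse_rtranclp_into_rtranclp)

lemma conn_mem: "conn E X Y \<Longrightarrow> X \<in> E \<Longrightarrow> Y \<in> E"
  unfolding conn_def by (induction rule: rtranclp_induct) auto

lemma conn_remove:
  assumes "conn E X Y" "\<not> conn E X Z"
  shows "conn (E - {Z}) X Y"
  using assms(1) unfolding conn_def
proof (induction rule: rtranclp_induct)
  case (step Y Y')
  then have "conn E X Y" "conn E X Y'"
    unfolding conn_def by (auto intro: rtranclp.rtrancl_into_rtrancl)
  then have "Y \<noteq> Z" "Y' \<noteq> Z" using assms(2) by auto
  with step show ?case by (auto intro: rtranclp.rtrancl_into_rtrancl)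
qed simp

text \<open>By \<open>ext_tr_iff\<close>, the exterior neighbours of a vertex with a right turn lie on the left of the
  curve.\<close>

definition attached :: "(int \<Rightarrow> lattice_point) \<Rightarrow> int \<Rightarrow> lattice_point \<Rightarrow> bool" where
  "attached P i X \<longleftrightarrow> X \<notin> range P \<and> adjacent X (P i) \<and> tr P i = -1"

definition edge_flow :: "lattice_point \<Rightarrow> lattice_point \<Rightarrow> lattice_point \<Rightarrow> lattice_point \<Rightarrow> int" where
  "edge_flow p q X Y = of_bool (p = X \<and> q = Y) - of_bool (p = Y \<and> q = X)"

lemma edge_flow_anti: "edge_flow p q X Y = - edge_flow p q Y X"
  by (simp add: edge_flow_def)

definition divergence :: "(lattice_point \<Rightarrow> lattice_point \<Rightarrow> int) \<Rightarrow> lattice_point \<Rightarrow> int" where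
  "divergence e X = e X (X + (1,0)) + e X (X + (0,1)) + e X (X - (1,0)) + e X (X - (0,1))"

lemma divergence_edge_flow:
  assumes "adjacent p q"
  shows "divergence (edge_flow p q) X = of_bool (p = X) - of_bool (q = X)"
proof -
  obtain x y where X: "X = (x, y)" by fastforce
  obtain a b where p: "p = (a, b)" by fastforce
  show ?thesis using assms
    by (cases rule: adjacent_cases) (auto simp: divergence_def edge_flow_def X p)
qed

lemma divergence_add: "divergence (\<lambda>X Y. e X Y + f X Y) Z = divergence e Z + divergence f Z"
  by (simp add: divergence_def)

text \<open>The analogue of \<open>ext_faces\<close> for a potential: without flow at
  \<open>X\<close> the four squares around \<open>X\<close> share one value, represented by
  \<open>w X\<close>.\<close>

lemma flat_faces:
  assumes "is_potential w e" "\<And>Z. adjacent X Z \<Longrightarrow> e X Z = 0" "adjacent X Y"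
  shows "w (lface X Y) = w X" "w (lface Y X) = w X"
proof -
  have *: "w (lface X Z) = w (lface Z X)" if "adjacent X Z" for Z
    using is_potentialD[OF assms(1) that] assms(2)[OF that] by simp
  have "w (lface X Y) = w X \<and> w (lface Y X) = w X"
    using assms(3) *[of "X + (1,0)"] *[of "X + (0,1)"] *[of "X - (1,0)"] *[of "X - (0,1)"]
    by (cases X, cases rule: adjacent_cases) (auto simp: lface_def adjacent_iff)
  then show "w (lface X Y) = w X" "w (lface Y X) = w X" by auto
qed

lemma lface_finite: "finite {p. \<exists>q. lface p q = z}"
proof -
  have "{p. \<exists>q. lface p q = z} \<subseteq> {z, z + (1,0), z + (1,1), z + (0,1)}"
    by (auto simp: lface_def)
  then show ?thesis by (rule finite_subset) simp
qed

context turning_curve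
begin

lemma finite_visits: "finite {i. P i = X}"
proof -
  have "(\<lambda>i. P (i + 1)) ` {i. P i = X} \<subseteq> {X + (1,0), X + (0,1), X - (1,0), X - (0,1)}"
  proof
    fix Y assume "Y \<in> (\<lambda>i. P (i + 1)) ` {i. P i = X}"
    then have "adjacent X Y" using adj by auto
    then show "Y \<in> {X + (1,0), X + (0,1), X - (1,0), X - (0,1)}"
      by (cases rule: adjacent_cases) simp_all
  qed
  then have "finite ((\<lambda>i. P (i + 1)) ` {i. P i = X})" by (rule finite_subset) simp
  then show ?thesis using inj_next finite_imageD by blast
qed

text \<open>Two visits of a vertex use four different edges, which leaves no room for a free fifth
  one.\<close>

lemma free_single_visit:
  assumes "free P (P i) X" "P j = P i"
  shows "j = i"
proof (rule ccontr)
  assume ne: "j \<noteq> i"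
  let ?p = "P i"
  let ?N = "{?p + (1,0), ?p + (0,1), ?p - (1,0), ?p - (0,1)}"
  have N: "Y \<in> ?N" if "adjacent ?p Y" for Y
    using that by (auto elim: adjacent_cases)
  have adjs: "adjacent ?p (P (i + 1))" "adjacent ?p (P (i - 1))" "adjacent ?p (P (j + 1))" "adjacent ?p (P (j - 1))"
    using adj[of i] adj'[of i] adj[of j] adj'[of j] assms(2) by (auto simp: adjacent_sym)
  have edge: "P i \<noteq> P (i + 1)" for i using adj[of i] by auto
  have 1: "P (i + 1) \<noteq> P (j + 1)" using edge_inj[of i j] ne assms(2) by auto
  have 2: "P (i - 1) \<noteq> P (j - 1)" using edge_inj[of "i - 1" "j - 1"] ne assms(2) by auto
  have 3: "P (k + 1) \<noteq> P (l - 1)" if "P k = P l" for k l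
  proof
    assume "P (k + 1) = P (l - 1)"
    then have "k = l - 1" using edge_inj[of k "l - 1"] that by (simp add: insert_commute)
    then show False using that edge[of k] by simp
  qed
  have X: "X \<noteq> P (k + 1)" "X \<noteq> P (k - 1)" if "P k = ?p" for k
    using assms(1) that spec[of "\<lambda>j. {P j, P (j + 1)} \<noteq> {P i, X}" "k - 1"]
      spec[of "\<lambda>j. {P j, P (j + 1)} \<noteq> {P i, X}" k]
    by (auto simp: free_def insert_commute)
  have "{X, P (i + 1), P (i - 1), P (j + 1), P (j - 1)} \<subseteq> ?N"
    using N adjs assms(1) by (auto simp: free_def simp del: insert_iff)
  then have "card {X, P (i + 1), P (i - 1), P (j + 1), P (j - 1)} \<le> card ?N"
    by (intro card_mono) auto
  moreover have "card {X, P (i + 1), P (i - 1), P (j + 1), P (j - 1)} = 5"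
    using 1 2 3[of i j] 3[of j i] 3[of i i] 3[of j j] X[of i] X[of j] assms(2) by (auto simp: card_insert_if)
  moreover have "card ?N \<le> 4" by (intro order.trans[OF card_insert_le_m1]) (auto simp: card_insert_if)
  ultimately show False by linarith
qed

lemma single_free:
  assumes "\<And>m. P m = P k \<Longrightarrow> m = k" "adjacent (P k) Y" "Y \<noteq> P (k - 1)" "Y \<noteq> P (k + 1)"
  shows "free P (P k) Y"
proof -
  have "{P j, P (j + 1)} \<noteq> {P k, Y}" for j
  proof
    assume "{P j, P (j + 1)} = {P k, Y}"
    then consider "P j = P k" "P (j + 1) = Y" | "P (j + 1) = P k" "P j = Y"
      by (auto simp: doubleton_eq_iff)
    then show False
    proof cases
      case 1
      with assms(1)[of j] assms(4) show False by simp
    next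
      case 2
      with assms(1)[of "j + 1"] have "j = k - 1" by simp
      with 2 assms(3) show False by simp
    qed
  qed
  with assms(2) show ?thesis by (simp add: free_def)
qed

lemma free_other:
  assumes "free P (P i) X" "adjacent (P i) Y" "Y \<noteq> P (i - 1)" "Y \<noteq> P (i + 1)"
  shows "free P (P i) Y"
  using free_single_visit[OF assms(1)] assms(2-4) by (intro single_free)

lemma loop_flow_curve:
  assumes "a \<le> b"
  shows "(\<Sum>m\<in>{a..<b}. edge_flow (P m) (P (m + 1)) (P i) (P (i + 1))) = of_bool (i \<in> {a..<b})"
proof -
  have "edge_flow (P m) (P (m + 1)) (P i) (P (i + 1)) = of_bool (m = i)" for m
  proof -
    have "\<not> (P m = P (i + 1) \<and> P (m + 1) = P i)"
    proof
      assume *: "P m = P (i + 1) \<and> P (m + 1) = P i"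
      then have "i = m" by (intro edge_inj) (simp add: doubleton_eq_iff)
      with * have "P (i + 1) = P i" by blast
      with adj[of i] show False by simp
    qed
    moreover have "P m = P i \<and> P (m + 1) = P (i + 1) \<longleftrightarrow> m = i"
      using edge_inj[of m i] by auto
    ultimately show ?thesis unfolding edge_flow_def by simp
  qed
  then have "(\<Sum>m\<in>{a..<b}. edge_flow (P m) (P (m + 1)) (P i) (P (i + 1))) = (\<Sum>m\<in>{a..<b}. of_bool (m = i))"
    by simp
  also have "\<dots> = of_bool (i \<in> {a..<b})" by (simp add: of_bool_def sum.delta)
  finally show ?thesis .
qed

lemma loop_divergence:
  assumes "a \<le> b"
  shows "divergence (\<lambda>X Y. \<Sum>m\<in>{a..<b}. edge_flow (P m) (P (m + 1)) X Y) X = of_bool (P a = X) - of_bool (P b = X)"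
  using assms
proof (induction b rule: int_ge_induct)
  case base then show ?case by (simp add: divergence_def)
next
  case (step b)
  have "{a..<b + 1} = insert b {a..<b}" using step(1) by auto
  then have "(\<lambda>X Y. \<Sum>m\<in>{a..<b + 1}. edge_flow (P m) (P (m + 1)) X Y) =
      (\<lambda>X Y. edge_flow (P b) (P (b + 1)) X Y + (\<Sum>m\<in>{a..<b}. edge_flow (P m) (P (m + 1)) X Y))"
    by auto
  then show ?case using step(2) divergence_edge_flow[OF adj[of b], of X] by (simp add: divergence_add)
qed

text \<open>The winding number around the closed walk consisting of the arc from \<open>P a\<close> to \<open>P b\<close> and of the
  flow \<open>g\<close> vanishes beside the unbounded rest of the curve, hence it is \<open>1\<close> on the left of the arc.\<close>

lemma enclosed_finite:
  assumes ab: "a < c" "c < b"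
    and g_anti: "\<And>X Y. g Y X = - g X Y"
    and g_div: "\<And>X. divergence g X = of_bool (P b = X) - of_bool (P a = X)"
    and g_curve: "\<And>i. g (P i) (P (i + 1)) = 0"
    and g_supp: "finite {X. \<exists>Y. g X Y \<noteq> 0}" "\<And>X Y. X \<in> E \<Longrightarrow> g X Y = 0"
    and E: "E \<inter> range P = {}"
    and tr: "tr P b = -1" "tr P c = -1"
    and Y: "Y \<in> E" "adjacent Y (P c)"
  shows "finite {Z. conn E Y Z}"
proof -
  define l where "l X Z = (\<Sum>m\<in>{a..<b}. edge_flow (P m) (P (m + 1)) X Z)" for X Z
  define e where "e X Z = l X Z + g X Z" for X Z
  have l_anti: "l Z X = - l X Z" for X Z
    unfolding l_def edge_flow_anti[of _ _ Z X] by (rule sum_negf)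
  have anti: "e Z X = - e X Z" for X Z
    using g_anti[of Z X] l_anti[of Z X] unfolding e_def by simp
  have "divergence e X = 0" for X
    using loop_divergence[of a b X] ab g_div[of X] divergence_add[of l g X] unfolding e_def l_def by simp
  then obtain w where w: "is_potential w e"
    using ex_potential[of e] anti unfolding divergence_def by metis
  have e_curve: "e (P i) (P (i + 1)) = of_bool (i \<in> {a..<b})" for i
    using loop_flow_curve[of a b i] ab g_curve[of i] by (simp add: e_def l_def)
  have l_supp: "X \<in> P ` {a..b}" if "l X Z \<noteq> 0" for X Z
  proof (rule ccontr)
    assume *: "X \<notin> P ` {a..b}"
    have "edge_flow (P m) (P (m + 1)) X Z = 0" if "m \<in> {a..<b}" for m
      using * that by (auto simp: edge_flow_def)
    then show False using that by (simp add: l_def)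
  qed
  define F where "F = P ` {a..b} \<union> {X. \<exists>Y. g X Y \<noteq> 0}"
  have F: "finite F" using g_supp(1) by (simp add: F_def)
  have eF: "X \<in> F" if "e X Z \<noteq> 0" for X Z
  proof (cases "l X Z = 0")
    case True
    then have "g X Z \<noteq> 0" using that by (simp add: e_def)
    then show ?thesis by (auto simp: F_def)
  next
    case False
    then show ?thesis using l_supp by (auto simp: F_def)
  qed
  define n where "n = Max ((\<lambda>X. max \<bar>fst X\<bar> \<bar>snd X\<bar>) ` F)"
  have n: "\<bar>fst X\<bar> \<le> n \<and> \<bar>snd X\<bar> \<le> n" if "X \<in> F" for X
  proof -
    have "max \<bar>fst X\<bar> \<bar>snd X\<bar> \<le> n" unfolding n_def using F that by (intro Max_ge) auto
    then show ?thesis by simp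
  qed
  have supp: "\<bar>fst p\<bar> \<le> n \<and> \<bar>snd p\<bar> \<le> n \<and> \<bar>fst q\<bar> \<le> n \<and> \<bar>snd q\<bar> \<le> n" if "e p q \<noteq> 0" for p q
  proof -
    have "e q p \<noteq> 0" using that anti[of p q] by simp
    then show ?thesis using n[OF eF[OF that]] n[OF eF, of q p] by blast
  qed
  obtain c0 where c0: "finite {p. w p \<noteq> c0}"
    using finite_support_potential[OF w supp] by blast
  \<comment> \<open>No flow runs along the curve after \<open>P b\<close>, so all left squares there
    have one value. If it were not \<open>c0\<close>, infinitely many indices would belong to
    finitely many squares, while every vertex is visited only finitely often.\<close>
  have tail: "w (lface (P b) (P (b + 1))) = c0"
  proof (rule ccontr)
    assume ne: "w (lface (P b) (P (b + 1))) \<noteq> c0"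
    have c: "w (lface (P i) (P (i + 1))) = w (lface (P b) (P (b + 1)))" if "b \<le> i" for i
      using potential_along_curve[OF w that, of 0] e_curve by simp
    have "{b..} \<subseteq> (\<Union>z\<in>{p. w p \<noteq> c0}. \<Union>p\<in>{p. \<exists>q. lface p q = z}. {i. P i = p})"
    proof
      fix i assume "i \<in> {b..}"
      then have "lface (P i) (P (i + 1)) \<in> {p. w p \<noteq> c0}" using c[of i] ne by simp
      then show "i \<in> (\<Union>z\<in>{p. w p \<noteq> c0}. \<Union>p\<in>{p. \<exists>q. lface p q = z}. {i. P i = p})"
        by (rule UN_I) (rule UN_I[of "P i"], auto)
    qed
    moreover have "finite (\<Union>z\<in>{p. w p \<noteq> c0}. \<Union>p\<in>{p. \<exists>q. lface p q = z}. {i. P i = p})"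
      using c0 lface_finite finite_visits by blast
    ultimately have "finite {b..}" by (rule finite_subset)
    then show False using infinite_Ici by blast
  qed
  have jump: "w (lface (P i) (P (i + 1))) - w (lface (P (i + 1)) (P i)) = of_bool (i \<in> {a..<b})" for i
    using is_potentialD[OF w adj] e_curve by simp
  have "w (lface (P (b + 1)) (P b)) = c0" using jump[of b] tail by simp
  \<comment> \<open>The right turn at \<open>P b\<close> carries the value on the right from the
    tail back to the last edge of the arc; crossing that edge gives \<open>c0 + 1\<close> on its
    left.\<close>
  then have "w (lface (P b) (P (b - 1))) = c0" using right_turn_face[OF tr(1)] by simp
  then have last: "w (lface (P (b - 1)) (P b)) = c0 + 1" using jump[of "b - 1"] ab by simp
  have left: "w (lface (P i) (P (i + 1))) = c0 + 1" if "a \<le> i" "i < b" for i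
    using potential_along_curve[OF w, of i "b - 1" 1] e_curve last that by simp
  have flat: "e X Z = 0" if "X \<in> E" for X Z
  proof -
    have "X \<notin> P ` {a..b}" using that E by blast
    then have "l X Z = 0" using l_supp by blast
    then show ?thesis using g_supp(2)[OF that] by (simp add: e_def)
  qed
  have Yf: "w (lface Y (P c)) = w Y" "w (lface (P c) Y) = w Y"
    using flat_faces[OF w flat[OF Y(1)] Y(2)] .
  have "Y \<notin> range P" using Y(1) E by blast
  then have "Y \<noteq> P (c - 1)" "Y \<noteq> P (c + 1)" by blast+
  moreover have "adjacent (P c) Y" using Y(2) adjacent_sym by blast
  \<comment> \<open>Since \<open>a < c < b\<close>, both curve edges at the right turn
    \<open>P c\<close> belong to the arc, and the edge to \<open>Y\<close> borders the left square
    of one of them.\<close>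
  ultimately have "w Y = c0 + 1"
    using turn_side_faces(1)[of c Y] tr(2) Yf left[of c] left[of "c - 1"] ab by auto
  have "w Z = c0 + 1" if "conn E Y Z" for Z
    using that unfolding conn_def
  proof (induction rule: rtranclp_induct)
    case base show ?case by fact
  next
    case (step Z Z')
    then have "Z \<in> E" "Z' \<in> E" "adjacent Z Z'" "adjacent Z' Z" using adjacent_sym by blast+
    then show ?case
      using flat_faces(1)[OF w flat, of Z Z'] flat_faces(2)[OF w flat, of Z' Z] step(3) by simp
  qed
  then have "{Z. conn E Y Z} \<subseteq> {p. w p \<noteq> c0}" by (intro subsetI) simp
  then show ?thesis using c0 by (rule finite_subset)
qed

end

lemma free_of_attached: "attached P i X \<Longrightarrow> free P (P i) X"
  using ext_free[of X P "P i"] free_sym[of P X "P i"] by (simp add: attached_def)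

context turning_curve
begin

text \<open>At a right turn the free edges lie on one diagonal of the vertex, which one depends only on the
  parity of the index. This is why the fourth corner of the square below cannot lie on the curve.\<close>

lemma square_first_corner:
  assumes tr: "tr P k = -1" "tr P (k + 1) = -1" and d: "P (k + 1) - P k = (a, b)"
    and S: "P (k + 1) + (- b, a) \<notin> range P" and free: "free P (P k) (P k + (- b, a))"
  shows "P k + (- b, a) \<notin> range P"
proof
  assume "P k + (- b, a) \<in> range P"
  then obtain j where j: "P j = P k + (- b, a)" by auto
  obtain x y where xy: "P k = (x, y)" by fastforce
  have ab: "(a, b) \<in> units" using unit_step[of k] d by simp
  have k1: "P (k + 1) = (x + a, y + b)" using d xy by (cases "P (k + 1)") auto
  have Sx: "(x + a - b, y + b + a) \<notin> range P" using S k1 by simp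
  have "tr P j = tr P (k + 1)"
    by (rule ext_tr_eq[OF Sx]) (use ab in \<open>auto simp: adjacent_iff j k1 xy\<close>)
  then have trj: "tr P j = -1" using tr by simp
  obtain c e where ce: "(c, e) \<in> units" "P (j - 1) = P j - (c, e)"
    "P (j + 1) = P j + (e, - c)"
    by (rule local_shape[of j]) (use trj in auto)
  have "odd (fst (P j) + snd (P j) - (fst (P k) + snd (P k)))"
    using ab by (auto simp: j xy)
  then have "odd (j - k)" using sum_parity[of j k] by blast
  then have ax: "e = 0 \<longleftrightarrow> a \<noteq> 0" using axis_parity[of j k] d ce(3) by auto
  have "P (j + 1) \<noteq> P k" "P (j - 1) \<noteq> P k"
    using free spec[of "\<lambda>i. {P i, P (i + 1)} \<noteq> {P k, P k + (- b, a)}" j]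
      spec[of "\<lambda>i. {P i, P (i + 1)} \<noteq> {P k, P k + (- b, a)}" "j - 1"]
    by (auto simp: free_def j insert_commute)
  moreover have "P (j + 1) \<noteq> (x + a - b, y + b + a)" "P (j - 1) \<noteq> (x + a - b, y + b + a)"
    using Sx by (metis rangeI)+
  \<comment> \<open>At \<open>P j\<close> the edges to \<open>P k\<close> and to the exterior corner
    are excluded. A right turn on the two others would have its outgoing step parallel to the step
    at \<open>k\<close>, but \<open>j - k\<close> is odd.\<close>
  ultimately show False
    using ab ce(1) ax unfolding ce(2,3) j xy
    by (elim insertE emptyE Pair_inject) simp_all
qed

text \<open>The same argument at the other end of the edge. Now \<open>j - k\<close> is even, while
  a right turn on the two admissible edges would leave perpendicularly to the step at
  \<open>k\<close>.\<close>

lemma square_second_corner: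
  assumes tr: "tr P k = -1" "tr P (k + 1) = -1" and d: "P (k + 1) - P k = (a, b)"
    and S: "P k + (- b, a) \<notin> range P" and free: "free P (P (k + 1)) (P (k + 1) + (- b, a))"
  shows "P (k + 1) + (- b, a) \<notin> range P"
proof
  assume "P (k + 1) + (- b, a) \<in> range P"
  then obtain j where j: "P j = P (k + 1) + (- b, a)" by auto
  obtain x y where xy: "P k = (x, y)" by fastforce
  have ab: "(a, b) \<in> units" using unit_step[of k] d by simp
  have k1: "P (k + 1) = (x + a, y + b)" using d xy by (cases "P (k + 1)") auto
  have Sx: "(x - b, y + a) \<notin> range P" using S xy by simp
  have "tr P j = tr P k"
    by (rule ext_tr_eq[OF Sx]) (use ab in \<open>auto simp: adjacent_iff j k1 xy\<close>)
  then have trj: "tr P j = -1" using tr by simp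
  obtain c e where ce: "(c, e) \<in> units" "P (j - 1) = P j - (c, e)"
    "P (j + 1) = P j + (e, - c)"
    by (rule local_shape[of j]) (use trj in auto)
  have "even (fst (P j) + snd (P j) - (fst (P k) + snd (P k)))"
    using ab by (auto simp: j xy k1)
  then have "even (j - k)" using sum_parity[of j k] by blast
  then have ax: "e = 0 \<longleftrightarrow> a = 0" using axis_parity[of j k] d ce(3) by auto
  have "P (j + 1) \<noteq> P (k + 1)" "P (j - 1) \<noteq> P (k + 1)"
    using free spec[of "\<lambda>i. {P i, P (i + 1)} \<noteq> {P (k + 1), P (k + 1) + (- b, a)}" j]
      spec[of "\<lambda>i. {P i, P (i + 1)} \<noteq> {P (k + 1), P (k + 1) + (- b, a)}" "j - 1"]
    by (auto simp: free_def j insert_commute)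
  moreover have "P (j + 1) \<noteq> (x - b, y + a)" "P (j - 1) \<noteq> (x - b, y + a)"
    using Sx by (metis rangeI)+
  ultimately show False
    using ab ce(1) ax unfolding ce(2,3) j k1
    by (elim insertE emptyE Pair_inject) simp_all
qed

text \<open>Each visit of a vertex uses one horizontal and one vertical edge, hence one of the two
  edges perpendicular to \<open>(a, b)\<close>.\<close>

lemma perpendicular_step:
  assumes "adjacent (P k) (P k + (a, b))" "P k + (a, b) \<noteq> P (k - 1)" "P k + (a, b) \<noteq> P (k + 1)"
  shows "P k + (- b, a) \<in> {P (k - 1), P (k + 1)} \<or> P k - (- b, a) \<in> {P (k - 1), P (k + 1)}"
proof -
  obtain x y where xy: "P k = (x, y)" by fastforce
  have ab: "(a, b) \<in> units" using assms(1) by (simp add: adjacent_iff)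
  obtain c e where ce: "(c, e) \<in> units" "P (k - 1) = P k - (c, e)"
    "P (k + 1) = P k + (- e, c) \<or> P (k + 1) = P k + (e, - c)"
    by (rule local_shape[of k]) auto
  from ce(3) show ?thesis
    using ab ce(1) assms(2,3) unfolding ce(2) xy
    by (elim disjE insertE emptyE Pair_inject) simp_all
qed

end

section \<open>Diagonal neighbours and the embedded lattice of the derived curve\<close>

lemma diagonal_class:
  assumes "folding_curve P"
  obtains e where "\<And>i j. odd (i - e) \<Longrightarrow> \<bar>fst (P j) - fst (P i)\<bar> = 1 \<Longrightarrow> \<bar>snd (P j) - snd (P i)\<bar> = 1
    \<Longrightarrow> tr P j = - tr P i"
proof -
  obtain e D where D: "derived (\<lambda>i. P (i + e)) D" using ex_derived[OF assms] .
  show thesis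
  proof (rule that[of e])
    fix i j assume "odd (i - e)" "\<bar>fst (P j) - fst (P i)\<bar> = 1" "\<bar>snd (P j) - snd (P i)\<bar> = 1"
    then show "tr P j = - tr P i"
      using derived_diagonal[OF D, of "i - e" "j - e"] by (simp add: tr_shift)
  qed
qed

text \<open>One of the two index parities is the alternating one, and the pair starting in it would
  need opposite turns. No knowledge of which parity it is enters, so the lemma can be used for a
  derived curve.\<close>

lemma no_two_diagonals:
  assumes "folding_curve P" "odd (i - k)"
    and "\<bar>fst (P j) - fst (P i)\<bar> = 1" "\<bar>snd (P j) - snd (P i)\<bar> = 1" "tr P i = tr P j"
    and "\<bar>fst (P l) - fst (P k)\<bar> = 1" "\<bar>snd (P l) - snd (P k)\<bar> = 1" "tr P k = tr P l"
  shows False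
proof -
  interpret turning_curve P using assms(1) by (simp add: folding_curve_def)
  obtain e where e: "\<And>i j. odd (i - e) \<Longrightarrow> \<bar>fst (P j) - fst (P i)\<bar> = 1 \<Longrightarrow> \<bar>snd (P j) - snd (P i)\<bar> = 1
    \<Longrightarrow> tr P j = - tr P i" using diagonal_class[OF assms(1)] by blast
  have "odd (i - e) \<or> odd (k - e)" using assms(2) by auto
  then show False
    using e[of i j] e[of k l] assms tr_cases[of i] tr_cases[of k] by auto
qed

locale derived_curve =
  fixes P D
  assumes der: "derived P D"
begin

sublocale turning_curve P using der by (simp add: derived_def folding_curve_def)
sublocale D: turning_curve D using der by (simp add: derived_def folding_curve_def)

abbreviation N :: "lattice_point \<Rightarrow> lattice_point" where "N \<equiv> emb (P 0)"

lemma P_folding: "folding_curve P" and D_folding: "folding_curve D"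
  using der by (simp_all add: derived_def)

lemma P_even: "P (2 * k) = N (D k)" and tr_even: "tr P (2 * k) = tr D k"
  using der by (auto simp: derived_def)

lemma diagonal:
  "odd i \<Longrightarrow> \<bar>fst (P j) - fst (P i)\<bar> = 1 \<Longrightarrow> \<bar>snd (P j) - snd (P i)\<bar> = 1 \<Longrightarrow> tr P j = - tr P i"
  using derived_diagonal[OF der] .

text \<open>The checkerboard colour of \<open>P 0\<close>. Its points are those of the embedded
  lattice, and the vertices of this colour are those with even index.\<close>

definition even_point :: "lattice_point \<Rightarrow> bool" where
  "even_point X \<longleftrightarrow> even (fst X + snd X - (fst (P 0) + snd (P 0)))"

lemma even_point_P: "even_point (P i) \<longleftrightarrow> even i"
  using sum_parity[of i 0] by (simp only: even_point_def diff_0_right)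

lemma even_point_N: "even_point X \<longleftrightarrow> (\<exists>a. X = N a)"
proof
  assume "even_point X"
  then obtain m where m: "fst X + snd X - (fst (P 0) + snd (P 0)) = 2 * m"
    unfolding even_point_def using evenE by blast
  then have "X = N (m, m - (fst X - fst (P 0)))"
    by (auto simp: emb_def prod_eq_iff)
  then show "\<exists>a. X = N a" ..
qed (auto simp: even_point_def emb_def)

lemma even_point_adjacent: "adjacent X Y \<Longrightarrow> even_point X \<longleftrightarrow> \<not> even_point Y"
  by (erule adjacent_cases) (auto simp: even_point_def)

lemma N_range: "N a \<in> range P \<longleftrightarrow> a \<in> range D"
proof
  assume "N a \<in> range P"
  then obtain i where i: "N a = P i" by auto
  then have "even i" using even_point_N[of "P i"] even_point_P[of i] by metis
  then obtain k where "i = 2 * k" using evenE by blast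
  then show "a \<in> range D" using i P_even[of k] by auto
next
  assume "a \<in> range D"
  then obtain k where "a = D k" by auto
  then have "N a = P (2 * k)" by (simp add: P_even)
  then show "N a \<in> range P" by auto
qed

text \<open>\<open>X\<close> is the centre of an embedded unit square. The corners \<open>a\<close>,
  \<open>r\<close>, \<open>s\<close>, \<open>t\<close> of that square, with \<open>s\<close>
  opposite to \<open>a\<close>, provide the four lattice neighbours of \<open>X\<close>.\<close>

lemma cell:
  assumes "adjacent X (N a)"
  obtains r s t where "adjacent a r" "adjacent a t" "adjacent r s" "adjacent t s"
    "\<bar>fst r - fst t\<bar> = 1" "\<bar>snd r - snd t\<bar> = 1" "\<bar>fst s - fst a\<bar> = 1" "\<bar>snd s - snd a\<bar> = 1"
    "r + t = a + s" "\<And>Z. adjacent X Z \<longleftrightarrow> Z \<in> {N a, N r, N s, N t}"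
proof -
  obtain x y where a: "a = (x, y)" by fastforce
  obtain p q where o: "P 0 = (p, q)" by fastforce
  obtain u v where X: "X = (u, v)" by fastforce
  have Z: "adjacent X Z \<longleftrightarrow> Z \<in> {X + (1,0), X + (0,1), X - (1,0), X - (0,1)}" for Z
    by (auto elim: adjacent_cases)
  show thesis using assms
  proof (cases rule: adjacent_cases)
    case 1 then show thesis
      by (intro that[of "(x-1,y)" "(x,y+1)" "(x-1,y+1)"]; (unfold Z)?)
        (auto simp: adjacent_iff a o X emb_def)
  next
    case 2 then show thesis
      by (intro that[of "(x-1,y)" "(x,y-1)" "(x-1,y-1)"]; (unfold Z)?)
        (auto simp: adjacent_iff a o X emb_def)
  next
    case 3 then show thesis
      by (intro that[of "(x+1,y)" "(x,y-1)" "(x+1,y-1)"]; (unfold Z)?)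
        (auto simp: adjacent_iff a o X emb_def)
  next
    case 4 then show thesis
      by (intro that[of "(x+1,y)" "(x,y+1)" "(x+1,y+1)"]; (unfold Z)?)
        (auto simp: adjacent_iff a o X emb_def)
  qed
qed

lemma cell_same_tr:
  assumes "X \<notin> range P" "adjacent X (N a)" "adjacent X (P i)" "a = D k"
  shows "tr D k = tr P i"
  using ext_tr_eq[OF assms(1), of "2 * k" i] assms(2-4) by (simp add: P_even tr_even)

text \<open>If all four neighbours were on the curve, they would have equal turns. For an even
  point, two of them are diagonal neighbours with odd index. For an odd point, they form an embedded
  square, whose two diagonals contradict \<open>no_two_diagonals\<close> for
  \<open>D\<close>.\<close>

lemma no_isolated:
  assumes "X \<notin> range P"
  obtains Y where "adjacent X Y" "Y \<notin> range P"
proof (rule ccontr)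
  assume "\<not> thesis"
  then have all: "adjacent X Y \<Longrightarrow> Y \<in> range P" for Y using that by blast
  show False
  proof (cases "even_point X")
    case True
    obtain i where i: "P i = X + (1,0)" using all[of "X + (1,0)"] by auto
    obtain j where j: "P j = X + (0,1)" using all[of "X + (0,1)"] by auto
    have "odd i" using even_point_adjacent[of X "P i"] True even_point_P[of i] by (simp add: i)
    then have "tr P j = - tr P i" using diagonal[of i j] by (simp add: i j)
    moreover have "tr P i = tr P j" by (rule ext_tr_eq[OF assms]) (simp_all add: i j)
    ultimately show False using tr_cases[of i] by simp
  next
    case False
    then have "even_point (X + (1,0))" using even_point_adjacent[of X "X + (1,0)"] by simp
    then obtain a where a: "X + (1,0) = N a" using even_point_N by blast
    then have adj: "adjacent X (N a)" using adjacent_simps(1)[of X] by simp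
    obtain r s t where rst: "adjacent a r" "\<bar>fst r - fst t\<bar> = 1" "\<bar>snd r - snd t\<bar> = 1"
      "\<bar>fst s - fst a\<bar> = 1" "\<bar>snd s - snd a\<bar> = 1" "\<And>Z. adjacent X Z \<longleftrightarrow> Z \<in> {N a, N r, N s, N t}"
      using cell[OF adj] by metis
    have in_D: "b \<in> range D" if "adjacent X (N b)" for b using all[OF that] N_range by blast
    obtain ka kr ks kt where k: "a = D ka" "r = D kr" "s = D ks" "t = D kt"
      using in_D[of a] in_D[of r] in_D[of s] in_D[of t] rst(6) by (auto simp: image_iff)
    have tr: "tr D m = tr D ka" if "D m \<in> {a, r, s, t}" for m
    proof -
      have "adjacent X (N (D m))" using that unfolding rst(6) by auto
      then show ?thesis
        using cell_same_tr[OF assms _ _ refl, of m "2 * ka"] adj k(1) by (simp add: P_even tr_even)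
    qed
    have "tr D kr = tr D kt" "tr D ka = tr D ks"
      using tr[of kr] tr[of ks] tr[of kt] k by simp_all
    moreover have "odd (fst a + snd a - (fst r + snd r))"
      using rst(1) by (cases rule: adjacent_cases) auto
    then have "odd (ka - kr)" using D.sum_parity[of ka kr] unfolding k by blast
    ultimately show False
      using no_two_diagonals[OF D_folding, of ka kr ks kt] rst k by (simp add: abs_minus_commute)
  qed
qed

text \<open>An embedded edge is a diagonal of a lattice square; \<open>Y\<close> and
  \<open>Z\<close> are the other two corners.\<close>

lemma common_neighbours:
  assumes "adjacent a b"
  obtains Y Z where "adjacent (N a) Y" "adjacent Y (N b)" "adjacent (N a) Z" "adjacent Z (N b)"
    "\<bar>fst Y - fst Z\<bar> = 1" "\<bar>snd Y - snd Z\<bar> = 1" "\<And>X. adjacent (N a) X \<Longrightarrow> adjacent X (N b) \<Longrightarrow> X = Y \<or> X = Z"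
proof -
  obtain x y where a: "a = (x, y)" by fastforce
  obtain p q where o: "P 0 = (p, q)" by fastforce
  have Na: "N a = (p + x - y, q + x + y)" by (simp add: emb_def a o)
  show thesis using assms
  proof (cases rule: adjacent_cases)
    case 1 then show thesis
      by (intro that[of "(p + x - y + 1, q + x + y)" "(p + x - y, q + x + y + 1)"])
        (auto simp: adjacent_iff a o emb_def)
  next
    case 2 then show thesis
      by (intro that[of "(p + x - y - 1, q + x + y)" "(p + x - y, q + x + y + 1)"])
        (auto simp: adjacent_iff a o emb_def)
  next
    case 3 then show thesis
      by (intro that[of "(p + x - y - 1, q + x + y)" "(p + x - y, q + x + y - 1)"])
        (auto simp: adjacent_iff a o emb_def)
  next
    case 4 then show thesis
      by (intro that[of "(p + x - y + 1, q + x + y)" "(p + x - y, q + x + y - 1)"])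
        (auto simp: adjacent_iff a o emb_def)
  qed
qed

text \<open>If both common neighbours were on the curve, they would be diagonal vertices of odd
  index with opposite turns, yet both are neighbours of the exterior point
  \<open>N a\<close>.\<close>

lemma bridge:
  assumes "a \<notin> range D" "adjacent a b"
  obtains Y where "Y \<notin> range P" "adjacent (N a) Y" "adjacent Y (N b)"
proof (rule ccontr)
  assume n: "\<not> thesis"
  obtain Y Z where YZ: "adjacent (N a) Y" "adjacent Y (N b)" "adjacent (N a) Z" "adjacent Z (N b)"
    "\<bar>fst Y - fst Z\<bar> = 1" "\<bar>snd Y - snd Z\<bar> = 1" using common_neighbours[OF assms(2)] by metis
  then have "Y \<in> range P" "Z \<in> range P" using n that by blast+
  then obtain i j where ij: "P i = Y" "P j = Z" by (metis imageE)
  have "\<not> even_point Y" using even_point_adjacent[OF YZ(1)] even_point_N by blast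
  then have "odd i" using even_point_P[of i] ij by simp
  then have "tr P j = - tr P i" using diagonal[of i j] YZ ij by (simp add: abs_minus_commute)
  moreover have "N a \<notin> range P" using assms(1) N_range by blast
  then have "tr P i = tr P j" using ext_tr_eq YZ ij by metis
  ultimately show False using tr_cases[of i] by simp
qed

lemma conn_lift:
  assumes "conn (- range D) a b"
  shows "conn (- range P) (N a) (N b)"
  using assms unfolding conn_def[of "- range D"]
proof (induction rule: rtranclp_induct)
  case (step b c)
  then have bc: "b \<notin> range D" "c \<notin> range D" "adjacent b c" by auto
  obtain Y where Y: "Y \<notin> range P" "adjacent (N b) Y" "adjacent Y (N c)" using bridge[OF bc(1,3)] .
  have "conn (- range P) (N b) Y" "conn (- range P) Y (N c)"
    using Y bc N_range by (intro conn_step; blast)+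
  then show ?case using step(3) conn_trans by blast
qed simp

lemma attached_lift:
  assumes "attached D k a"
  obtains Z where "attached P (2 * k) Z" "conn (- range P) (N a) Z"
proof -
  have a: "a \<notin> range D" "adjacent a (D k)" "tr D k = -1" using assms by (auto simp: attached_def)
  obtain Z where Z: "Z \<notin> range P" "adjacent (N a) Z" "adjacent Z (N (D k))" using bridge[OF a(1,2)] .
  have "attached P (2 * k) Z" using Z a(3) by (simp add: attached_def P_even tr_even)
  moreover have "conn (- range P) (N a) Z" using Z a(1) N_range by (intro conn_step) blast+
  ultimately show thesis by (rule that)
qed

text \<open>The vertex \<open>P (2 * k + 1)\<close> is the centre of an embedded square with the
  adjacent corners \<open>D k\<close> and \<open>D (k + 1)\<close>. Every other corner, in
  particular the one of \<open>X\<close>, is adjacent to one of these two.\<close>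

lemma attached_odd:
  assumes "attached P (2 * k + 1) X"
  obtains a where "X = N a" "attached D k a \<or> attached D (k + 1) a"
proof -
  have X: "X \<notin> range P" "adjacent X (P (2 * k + 1))" "tr P (2 * k + 1) = -1"
    using assms by (auto simp: attached_def)
  have "even_point X" using even_point_adjacent[OF X(2)] even_point_P[of "2 * k + 1"] by simp
  then obtain a where a: "X = N a" using even_point_N by blast
  have ra: "a \<notin> range D" using X(1) a N_range by blast
  let ?c = "P (2 * k + 1)"
  have c: "adjacent ?c (N (D k))" "adjacent ?c (N (D (k + 1)))" "adjacent ?c (N a)"
    using adj[of "2 * k"] adj[of "2 * k + 1"] X(2) P_even[of k] P_even[of "k + 1"]
    by (simp_all add: a adjacent_sym add.commute)
  obtain r s t where rst: "adjacent (D k) r" "adjacent (D k) t" "adjacent r s" "adjacent t s"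
    "\<bar>fst s - fst (D k)\<bar> = 1" "\<bar>snd s - snd (D k)\<bar> = 1"
    "\<And>Z. adjacent ?c Z \<longleftrightarrow> Z \<in> {N (D k), N r, N s, N t}" using cell[OF c(1)] by metis
  have "D (k + 1) \<in> {D k, r, s, t}" "a \<in> {D k, r, s, t}"
    using c(2,3) unfolding rst(7) by simp_all
  moreover have "adjacent (D k) (D (k + 1))" by (rule D.adj)
  moreover have "\<not> adjacent (D k) s" using rst(5,6) by (auto elim: adjacent_cases)
  ultimately have "adjacent a (D k) \<or> adjacent a (D (k + 1))"
    using rst(1-4) ra adjacent_sym by (metis insertE empty_iff not_adjacent_self rangeI)
  moreover have "attached D m a" if am: "adjacent a (D m)" for m
  proof -
    \<comment> \<open>The exterior neighbours \<open>N a\<close> and \<open>Y\<close> carry the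
      right turn from \<open>P (2 * k + 1)\<close> over to \<open>P (2 * m)\<close>.\<close>
    obtain Y where Y: "Y \<notin> range P" "adjacent (N a) Y" "adjacent Y (N (D m))" using bridge[OF ra am] .
    have "tr P (2 * k + 1) = tr P (2 * m)"
      using X Y unfolding a by (intro ext_ext_tr_eq[of "N a" Y]) (simp_all add: P_even)
    then show ?thesis using X(3) ra am tr_even[of m] by (simp add: attached_def)
  qed
  ultimately show thesis using that a by blast
qed

end

section \<open>Infinite components and impossible enclosures\<close>

lemma range_shift: "range (\<lambda>i::int. P (i + e)) = range P"
proof -
  have "P i = P ((i - e) + e)" for i by simp
  then show ?thesis by blast
qed

text \<open>A component of the exterior of the derived curve lifts into the even points of the
  component of \<open>X\<close>, and \<open>no_isolated\<close> supplies an odd point in addition.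
  Each passage to a derived curve thus gains one point.\<close>

lemma large_component:
  assumes "folding_curve P" "X \<notin> range P"
  shows "\<exists>S. finite S \<and> card S = n \<and> S \<subseteq> {Y. conn (- range P) X Y}"
  using assms
proof (induction n arbitrary: P X)
  case 0
  show ?case by (intro exI[of _ "{}"]) simp
next
  case (Suc n)
  obtain e D where D: "derived (\<lambda>i. P (i + e)) D" using ex_derived[OF Suc.prems(1)] .
  interpret derived_curve "\<lambda>i. P (i + e)" D using D by (rule derived_curve.intro)
  note range = range_shift[of P e]
  obtain Y where Y: "adjacent X Y" "Y \<notin> range P"
    using no_isolated[of X] Suc.prems(2) unfolding range by blast
  obtain A Z where AZ: "even_point A" "\<not> even_point Z" "{A, Z} = {X, Y}"
    using even_point_adjacent[OF Y(1)] by (cases "even_point X") blast+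
  obtain a where a: "A = N a" using AZ(1) even_point_N by blast
  have "A \<notin> range P" using AZ(3) Y Suc.prems(2) by auto
  then have ra: "a \<notin> range D" using N_range[of a] unfolding range a by simp
  have XY: "conn (- range P) X Y" using Y Suc.prems(2) by (intro conn_step) auto
  then have XA: "conn (- range P) X A" "conn (- range P) X Z"
    using AZ(3) conn_refl[of "- range P" X] by (auto simp: doubleton_eq_iff)
  obtain S where S: "finite S" "card S = n" "S \<subseteq> {b. conn (- range D) a b}"
    using Suc.IH[OF D_folding ra] by blast
  have "Z \<notin> N ` S" using AZ(2) even_point_N[of Z] by auto
  moreover have "inj_on N S" by (auto simp: inj_on_def)
  ultimately have "card (insert Z (N ` S)) = Suc n" using S by (simp add: card_image)
  moreover have "insert Z (N ` S) \<subseteq> {Y. conn (- range P) X Y}"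
  proof -
    have "conn (- range P) X (N b)" if "b \<in> S" for b
    proof -
      have "conn (- range D) a b" using S(3) that by blast
      then have "conn (- range P) A (N b)" using conn_lift[of a b] unfolding range a by simp
      then show ?thesis using XA(1) conn_trans by blast
    qed
    then show ?thesis using XA(2) by blast
  qed
  ultimately show ?case using S(1) by (intro exI[of _ "insert Z (N ` S)"]) simp
qed

lemma infinite_component:
  assumes "folding_curve P" "X \<notin> range P"
  shows "infinite {Y. conn (- range P) X Y}"
proof
  assume fin: "finite {Y. conn (- range P) X Y}"
  obtain S where S: "card S = Suc (card {Y. conn (- range P) X Y})" "S \<subseteq> {Y. conn (- range P) X Y}"
    using large_component[OF assms] by blast
  then show False using card_mono[OF fin S(2)] by simp
qed

lemma edge_flow_finite: "finite {X. \<exists>Y. edge_flow p q X Y \<noteq> 0}"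
  by (rule finite_subset[of _ "{p, q}"]) (auto simp: edge_flow_def)

text \<open>The free edge closes the arc from \<open>P a\<close> to \<open>P b\<close> to a loop
  with winding number \<open>1\<close> around the exterior point \<open>Y\<close>, whose component
  would then be finite.\<close>

lemma no_enclosed_by_edge:
  assumes P: "folding_curve P" and ab: "a < c" "c < b" and free: "free P (P a) (P b)"
    and tr: "tr P b = -1" and Y: "attached P c Y"
  shows False
proof -
  interpret turning_curve P using P by (simp add: folding_curve_def)
  have "finite {Z. conn (- range P) Y Z}"
  proof (rule enclosed_finite[OF ab, where g = "edge_flow (P b) (P a)"])
    show "edge_flow (P b) (P a) Z X = - edge_flow (P b) (P a) X Z" for X Z by (rule edge_flow_anti)
    have "adjacent (P b) (P a)" using free by (simp add: free_def adjacent_sym)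
    then show "divergence (edge_flow (P b) (P a)) X = of_bool (P b = X) - of_bool (P a = X)" for X
      by (rule divergence_edge_flow)
    show "edge_flow (P b) (P a) (P i) (P (i + 1)) = 0" for i
      using free by (auto simp: edge_flow_def free_def doubleton_eq_iff)
    show "edge_flow (P b) (P a) X Z = 0" if "X \<in> - range P" for X Z
      using that by (auto simp: edge_flow_def)
  qed (use tr Y in \<open>auto simp: attached_def edge_flow_finite\<close>)
  moreover have "Y \<notin> range P" using Y by (simp add: attached_def)
  ultimately show False using infinite_component[OF P] by blast
qed

text \<open>The loop is closed through the exterior point \<open>X\<close> itself, so only the
  exterior without \<open>X\<close> is separated. If \<open>Y\<close> is not connected to
  \<open>X\<close>, its component avoids \<open>X\<close> and would be enclosed.\<close>

lemma enclosed_by_point: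
  assumes P: "folding_curve P" and ab: "a < c" "c < b" and X: "attached P a X" "attached P b X"
    and Y: "attached P c Y"
  shows "conn (- range P) X Y"
proof (rule ccontr)
  assume nc: "\<not> conn (- range P) X Y"
  interpret turning_curve P using P by (simp add: folding_curve_def)
  have rX: "X \<notin> range P" and aX: "adjacent X (P a)" "adjacent (P b) X" and rY: "Y \<notin> range P"
    using X Y by (auto simp: attached_def adjacent_sym)
  have XY: "X \<noteq> Y" using nc by auto
  have "finite {Z. conn (- range P - {X}) Y Z}"
  proof (rule enclosed_finite[OF ab, where g = "\<lambda>U Z. edge_flow (P b) X U Z + edge_flow X (P a) U Z"])
    show "edge_flow (P b) X Z U + edge_flow X (P a) Z U = - (edge_flow (P b) X U Z + edge_flow X (P a) U Z)" for U Z
      using edge_flow_anti[of "P b" X Z U] edge_flow_anti[of X "P a" Z U] by simp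
    show "divergence (\<lambda>U Z. edge_flow (P b) X U Z + edge_flow X (P a) U Z) U = of_bool (P b = U) - of_bool (P a = U)" for U
      using aX by (simp add: divergence_add divergence_edge_flow)
    have "X \<noteq> P i" for i using rX by blast
    then show "edge_flow (P b) X (P i) (P (i + 1)) + edge_flow X (P a) (P i) (P (i + 1)) = 0" for i
      by (simp add: edge_flow_def)
    show "edge_flow (P b) X U Z + edge_flow X (P a) U Z = 0" if "U \<in> - range P - {X}" for U Z
    proof -
      have "P b \<noteq> U" "P a \<noteq> U" "X \<noteq> U" using that by blast+
      then show ?thesis by (simp add: edge_flow_def)
    qed
    have "{U. \<exists>Z. edge_flow (P b) X U Z + edge_flow X (P a) U Z \<noteq> 0} \<subseteq>
        {U. \<exists>Z. edge_flow (P b) X U Z \<noteq> 0} \<union> {U. \<exists>Z. edge_flow X (P a) U Z \<noteq> 0}" by auto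
    then show "finite {U. \<exists>Z. edge_flow (P b) X U Z + edge_flow X (P a) U Z \<noteq> 0}"
      by (rule finite_subset) (simp add: edge_flow_finite)
  qed (use X Y XY in \<open>auto simp: attached_def\<close>)
  moreover have "\<not> conn (- range P) Y X" using nc conn_sym by blast
  then have "{Z. conn (- range P) Y Z} \<subseteq> {Z. conn (- range P - {X}) Y Z}"
    using conn_remove by blast
  ultimately have "finite {Z. conn (- range P) Y Z}" using finite_subset by blast
  then show False using infinite_component[OF P rY] by blast
qed

section \<open>Exterior points at vertices of even index\<close>

context turning_curve
begin

lemma right_turn_prev:
  assumes "tr P k = -1" "P (k + 1) - P k = (a, b)"
  shows "P k - P (k - 1) = (- b, a)"
  using step_rec[of k] assms by (simp add: prod_eq_iff)

text \<open>If the curve used the edge to \<open>r\<close>, there would be two consecutive right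
  turns on it. With \<open>t\<close> on the right of this edge the curve would pass through
  \<open>s\<close>; with \<open>t\<close> on the left the square lemmas would make \<open>t\<close>
  exterior.\<close>

lemma corner_free:
  assumes single: "\<And>m. P m = P k \<Longrightarrow> m = k"
    and tr: "\<And>m. P m \<in> {P k, r} \<Longrightarrow> tr P m = -1"
    and r: "adjacent (P k) r" and t: "adjacent (P k) t" "t \<in> range P"
    and diag: "\<bar>fst r - fst t\<bar> = 1" "\<bar>snd r - snd t\<bar> = 1"
    and s: "r + t = P k + s" "s \<notin> range P"
  shows "free P (P k) r"
proof -
  obtain x y where xy: "P k = (x, y)" by fastforce
  obtain tx ty where txy0: "t - P k = (tx, ty)" by fastforce
  have t1: "t = (x + tx, y + ty)" using txy0 xy by (cases t) auto
  have t2: "(tx, ty) \<in> units" using t(1) txy0 by (simp add: adjacent_iff)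
  note t' = t1 t2
  have st: "s = r + (tx, ty)" using s(1) by (cases s; cases r) (auto simp: xy t')
  have "r \<noteq> P (k + 1)"
  proof
    assume rk: "r = P (k + 1)"
    obtain a b where ab: "P (k + 1) - P k = (a, b)" by fastforce
    have ab': "(a, b) \<in> units" using unit_step[of k] ab by simp
    have r': "r = (x + a, y + b)" using ab rk xy by (cases "P (k + 1)") auto
    have perp: "(tx, ty) = (- b, a) \<or> (tx, ty) = (b, - a)"
      using diag t'(2) ab' unfolding t'(1) r' by (elim insertE emptyE Pair_inject) simp_all
    have trs: "tr P k = -1" "tr P (k + 1) = -1" using tr rk by auto
    have "P (k + 1 + 1) - P (k + 1) = (b, - a)" using step_rec[of "k + 1"] trs ab by simp
    then have "P (k + 1 + 1) = r + (b, - a)" using rk by (simp add: algebra_simps)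
    then have "s \<noteq> r + (b, - a)" using s(2) by (metis rangeI)
    then have txy: "(tx, ty) = (- b, a)" using perp st by auto
    have "P k - P (k - 1) = (- b, a)" using right_turn_prev[OF trs(1) ab] .
    then have "P (k - 1) = (x + b, y - a)" using xy by (cases "P (k - 1)") auto
    then have "free P (P k) t"
      using txy ab' by (intro single_free[OF single t(1)]) (auto simp: t' r' simp flip: rk)
    then show False
      using square_first_corner[OF trs ab] s(2) t(2) st txy rk by (simp add: t' xy)
  qed
  moreover have "r \<noteq> P (k - 1)"
  proof
    assume rk: "r = P (k - 1)"
    obtain a b where ab: "P k - P (k - 1) = (a, b)" by fastforce
    have ab': "(a, b) \<in> units" using unit_step[of "k - 1"] ab by simp
    have r': "r = (x - a, y - b)" using ab rk xy by (cases "P (k - 1)") auto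
    have perp: "(tx, ty) = (- b, a) \<or> (tx, ty) = (b, - a)"
      using diag t'(2) ab' unfolding t'(1) r' by (elim insertE emptyE Pair_inject) simp_all
    have trs: "tr P (k - 1) = -1" "tr P (k - 1 + 1) = -1" using tr rk by auto
    have "P (k - 1) - P (k - 1 - 1) = (- b, a)" using right_turn_prev[OF trs(1)] ab by simp
    then have "P (k - 1 - 1) = r + (b, - a)" unfolding rk by (simp add: prod_eq_iff)
    then have "s \<noteq> r + (b, - a)" using s(2) by (metis rangeI)
    then have txy: "(tx, ty) = (- b, a)" using perp st by auto
    have "P (k + 1) - P k = (b, - a)" using step_rec[of k] trs ab by simp
    then have "P (k + 1) = (x + b, y - a)" using xy by (cases "P (k + 1)") auto
    then have "free P (P k) t"
      using txy ab' by (intro single_free[OF single t(1)]) (auto simp: t' r' simp flip: rk)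
    then show False
      using square_second_corner[of "k - 1" a b, OF trs] ab s(2) t(2) st txy rk by (simp add: t' xy)
  qed
  ultimately show ?thesis using single_free[OF single r] by blast
qed

end

context derived_curve
begin

text \<open>\<open>X\<close> is the centre of an embedded square with corner \<open>D k\<close>. If
  a neighbouring corner \<open>r\<close> or \<open>t\<close> is exterior, it gives the first
  alternative. Otherwise the edges from \<open>D k\<close> to \<open>r\<close> and \<open>t\<close>
  are free, and excluding enclosures places the visits of \<open>r\<close> and \<open>t\<close> on
  different sides of \<open>k\<close>: this is the second, exceptional alternative.\<close>

lemma attached_even:
  assumes "attached P (2 * k) X"
  shows "(\<exists>a. attached D k a \<and> conn (- range P) X (N a)) \<or>
    (\<exists>i j. attached P i X \<and> attached P j X \<and> i < 2 * k \<and> 2 * k < j)"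
proof -
  have X: "X \<notin> range P" "adjacent X (N (D k))" "tr D k = -1"
    using assms by (auto simp: attached_def P_even tr_even)
  obtain r s t where rst: "adjacent (D k) r" "adjacent (D k) t" "adjacent r s" "adjacent t s"
    "\<bar>fst r - fst t\<bar> = 1" "\<bar>snd r - snd t\<bar> = 1" "r + t = D k + s"
    "\<And>Z. adjacent X Z \<longleftrightarrow> Z \<in> {N (D k), N r, N s, N t}"
    using cell[OF X(2)] by metis
  have good: ?thesis if "a \<in> {r, t}" "a \<notin> range D" for a
  proof -
    have "adjacent (D k) a" "adjacent X (N a)" using that(1) rst(1,2) unfolding rst(8) by auto
    moreover from this have "adjacent a (D k)" using adjacent_sym by blast
    ultimately have "attached D k a" "conn (- range P) X (N a)"
      using that(2) X N_range[of a] by (auto simp: attached_def intro: conn_step)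
    then show ?thesis by blast
  qed
  show ?thesis
  proof (cases "r \<in> range D \<and> t \<in> range D")
    case False
    then show ?thesis using good by blast
  next
    case True
    then obtain i j where ij: "r = D i" "t = D j" by blast
    have s: "s \<notin> range D"
    proof
      assume "s \<in> range D"
      obtain Y where Y: "adjacent X Y" "Y \<notin> range P" using no_isolated[OF X(1)] .
      then have "Y \<in> {N (D k), N r, N s, N t}" by (simp add: rst(8))
      then show False
        using Y(2) \<open>s \<in> range D\<close> True N_range[of "D k"] N_range[of r] N_range[of s] N_range[of t] by blast
    qed
    have tr: "tr D m = -1" if "D m \<in> {D k, r, t}" for m
    proof -
      have "adjacent X (N (D m))" using that unfolding rst(8) by auto
      then show ?thesis
        using cell_same_tr[OF X(1) _ _ refl, of m "2 * k"] X(2,3) by (simp add: P_even tr_even)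
    qed
    have attP: "attached P (2 * m) X" if "D m \<in> {r, t}" for m
    proof -
      have "adjacent X (N (D m))" using that unfolding rst(8) by auto
      then show ?thesis using X(1) tr[of m] that by (simp add: attached_def P_even tr_even)
    qed
    have "adjacent s r" "adjacent s t" using rst(3,4) adjacent_sym by blast+
    then have attD: "attached D m s" if "D m \<in> {r, t}" for m
      using that s tr[of m] by (auto simp: attached_def)
    have single: "m = k" if "D m = D k" for m
    proof -
      have "P (2 * m) = P (2 * k)" using that by (simp add: P_even)
      then show ?thesis using free_single_visit[OF free_of_attached[OF assms]] by fastforce
    qed
    have free: "free D (D k) r" "free D (D k) t"
    proof -
      have "tr D m = -1" if "D m \<in> {D k, r}" for m using tr that by blast
      then show "free D (D k) r"
        using rst(1,2,5-7) True s by (intro D.corner_free[OF single, of r t s]) auto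
      have "tr D m = -1" if "D m \<in> {D k, t}" for m using tr that by blast
      then show "free D (D k) t"
        using rst(1,2,5-7) True s
        by (intro D.corner_free[OF single, of t r s]) (auto simp: abs_minus_commute add.commute)
    qed
    have "i \<noteq> k" "j \<noteq> k" "i \<noteq> j" using rst(1,2,5) ij by auto
    \<comment> \<open>If both visits came after \<open>k\<close>, the arc from \<open>k\<close> to
      the later one, closed by a free edge, would enclose \<open>s\<close>, which is attached at the
      earlier one. Likewise below for visits before \<open>k\<close>.\<close>
    moreover have False if "k < m" "m < l" "{D m, D l} = {r, t}" for m l
      using no_enclosed_by_edge[OF D_folding that(1,2), of s] free tr[of l] attD[of m] that(3)
      by (auto simp: doubleton_eq_iff)
    moreover have False if "m < l" "l < k" "{D m, D l} = {r, t}" for m l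
      using no_enclosed_by_edge[OF D_folding that(1,2), of s] free tr[of k] attD[of l] that(3)
      by (auto simp: doubleton_eq_iff free_sym)
    ultimately have "i < k \<and> k < j \<or> j < k \<and> k < i"
      using ij by (metis insert_commute linorder_neqE)
    then show ?thesis using attP[of i] attP[of j] ij by force
  qed
qed

end

section \<open>Exterior points at equal, consecutive and distant vertices\<close>

context derived_curve
begin

text \<open>\<open>X\<close> and \<open>Y\<close> are the centres of the two embedded squares beside
  an embedded edge, and \<open>h\<close> is the normal of that edge pointing to the side of
  \<open>X\<close>.\<close>

lemma opposite_cells:
  assumes ce: "(c, e) \<in> units" and "X \<noteq> Y"
    and X: "adjacent (N o') X" "adjacent X (N (o' + (c, e)))"
    and Y: "adjacent (N o') Y" "adjacent Y (N (o' + (c, e)))"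
  obtains h where "h \<in> {(- e, c), (e, - c)}"
    "adjacent X (N (o' + h))" "adjacent X (N (o' + (c, e) + h))"
    "adjacent Y (N (o' - h))" "adjacent Y (N (o' + (c, e) - h))"
proof -
  have pos: "Z = N o' + (c, e) \<or> Z = N o' + (- e, c)"
    if "adjacent (N o') Z" "adjacent Z (N (o' + (c, e)))" for Z
  proof -
    obtain p q where pq: "N o' = (p, q)" by fastforce
    have Ng: "N (o' + (c, e)) = (p + c - e, q + c + e)"
      using pq by (cases "P 0") (simp add: emb_def prod_eq_iff)
    show ?thesis
      using ce that(1) by (elim insertE emptyE Pair_inject adjacent_cases)
        (insert that(2)[unfolded Ng], simp_all add: adjacent_iff pq)
  qed
  have left: "adjacent (N o' + (- e, c)) (N (o' + (- e, c)))" "adjacent (N o' + (- e, c)) (N (o' + (c, e) + (- e, c)))"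
    and right: "adjacent (N o' + (c, e)) (N (o' - (- e, c)))" "adjacent (N o' + (c, e)) (N (o' + (c, e) - (- e, c)))"
    using ce by (elim insertE emptyE Pair_inject; simp add: adjacent_iff emb_def)+
  have flip: "p - (e, - c) = p + (- e, c)" "p + (e, - c) = p - (- e, c)" for p :: lattice_point
    by (simp_all add: prod_eq_iff)
  from pos[OF X] pos[OF Y] \<open>X \<noteq> Y\<close>
  consider "X = N o' + (- e, c)" "Y = N o' + (c, e)" | "X = N o' + (c, e)" "Y = N o' + (- e, c)" by blast
  then show thesis
  proof cases
    case 1 then show thesis using left right by (intro that[of "(- e, c)"]) simp_all
  next
    case 2 then show thesis using left right by (intro that[of "(e, - c)"]) (simp_all add: flip)
  qed
qed

lemma attached_same:
  assumes "attached P i X" "attached P i Y"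
  shows "conn (- range P) X Y"
proof (cases "X = Y")
  case False
  have X: "X \<notin> range P" "adjacent X (P i)" and Y: "Y \<notin> range P" "adjacent Y (P i)" and tri: "tr P i = -1"
    using assms by (auto simp: attached_def)
  obtain x y where xy: "P i = (x, y)" by fastforce
  obtain a b where ab: "(a, b) \<in> units" "P (i - 1) = P i - (a, b)"
    "P (i + 1) = P i + (b, - a)"
    by (rule local_shape[of i]) (use tri in auto)
  have nb: "Z = P i + (a, b) \<or> Z = P i + (- b, a)" if "Z \<notin> range P" "adjacent Z (P i)" for Z
  proof -
    have "Z \<noteq> P i - (a, b)" "Z \<noteq> P i + (b, - a)" using that(1) ab(2,3) by (metis rangeI)+
    moreover have "adjacent (P i) Z" using that(2) adjacent_sym by blast
    ultimately show ?thesis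
      using ab(1) unfolding xy by (elim insertE emptyE Pair_inject adjacent_cases) simp_all
  qed
  define W where "W = P i + (a - b, a + b)"
  have XY: "X = P i + (a, b) \<and> Y = P i + (- b, a) \<or> X = P i + (- b, a) \<and> Y = P i + (a, b)"
    using nb[OF X] nb[OF Y] False by auto
  then have W: "adjacent X W" "adjacent Y W" "adjacent W X" "adjacent W Y"
    using ab(1) unfolding W_def xy by (elim disjE conjE insertE emptyE Pair_inject; simp add: adjacent_iff)+
  have diag: "\<bar>fst W - fst (P i)\<bar> = 1" "\<bar>snd W - snd (P i)\<bar> = 1"
    using ab(1) unfolding W_def by (elim insertE emptyE Pair_inject; simp)+
  have "W \<notin> range P"
  proof
    assume "W \<in> range P"
    then obtain j where j: "W = P j" by blast
    have trj: "tr P j = -1" using ext_tr_eq[OF X(1), of i j] X(2) W(1) tri j by simp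
    \<comment> \<open>\<open>P i\<close> and \<open>W\<close> are diagonal neighbours with equal
      turns, which alternation excludes for odd \<open>i\<close>.\<close>
    have "even i"
    proof (rule ccontr)
      assume "odd i"
      then have "tr P j = - tr P i" using diagonal[of i j] diag j by simp
      then show False using tri trj by simp
    qed
    moreover have "even (fst (P j) + snd (P j) - (fst (P i) + snd (P i)))"
      using ab(1) unfolding j[symmetric] W_def xy by (elim insertE emptyE Pair_inject) simp_all
    then have "even (j - i)" using sum_parity[of j i] by blast
    ultimately have "even j" by auto
    then obtain k l where kl: "i = 2 * k" "j = 2 * l" using \<open>even i\<close> evenE by metis
    define c where "c = fst (D l) - fst (D k)"
    define e where "e = snd (D l) - snd (D k)"
    have w: "D l = D k + (c, e)" by (simp add: c_def e_def prod_eq_iff)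
    have "N (D l) = N (D k) + (a - b, a + b)" using j unfolding W_def kl P_even by simp
    then have "(c - e, c + e) = (a - b, a + b)" by (simp add: emb_def w prod_eq_iff)
    then have ce: "(c, e) \<in> units"
      using ab(1) by (elim insertE emptyE Pair_inject) simp_all
    then have adj_ow: "adjacent (D k) (D l)" by (simp add: adjacent_iff w)
    have XN: "adjacent (N (D k)) X" "adjacent X (N (D l))" "adjacent (N (D k)) Y" "adjacent Y (N (D l))"
      using X(2) Y(2) W(1,2) unfolding kl j P_even by (simp_all add: adjacent_sym)
    obtain h where h: "h \<in> {(- e, c), (e, - c)}"
      "adjacent X (N (D k + h))" "adjacent X (N (D l + h))"
      "adjacent Y (N (D k - h))" "adjacent Y (N (D l - h))"
      using opposite_cells[OF ce False] XN w by metis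
    \<comment> \<open>If \<open>D\<close> ran along this edge, the curve vertex of odd index between
      its ends would be one of their two common neighbours, but these are \<open>X\<close> and
      \<open>Y\<close>.\<close>
    have unused: "{D m, D (m + 1)} \<noteq> {D k, D l}" for m
    proof
      assume *: "{D m, D (m + 1)} = {D k, D l}"
      have "adjacent (N (D m)) (P (2 * m + 1))" "adjacent (P (2 * m + 1)) (N (D (m + 1)))"
        using adj[of "2 * m"] adj[of "2 * m + 1"] P_even[of m] P_even[of "m + 1"] by (simp_all add: add.commute)
      then have "adjacent (N (D k)) (P (2 * m + 1)) \<and> adjacent (P (2 * m + 1)) (N (D l))"
        using * by (auto simp: doubleton_eq_iff adjacent_sym)
      then have "P (2 * m + 1) = X \<or> P (2 * m + 1) = Y"
        using common_neighbours[OF adj_ow] XN False by metis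
      then show False using X(1) Y(1) by blast
    qed
    have core: False
      if h: "h \<in> {(- e, c), (e, - c)}" and v: "D k + h \<in> range D"
        and U: "U \<notin> range P" "adjacent U (P i)" "adjacent U W" "adjacent U (N (D k + h))" "adjacent U (N (D l + h))"
        and V: "V \<notin> range P" "adjacent V (P i)" "adjacent V (N (D l - h))"
      for h U V
    proof -
      obtain m where m: "D m = D k + h" using v by auto
      have trm: "tr D m = -1"
        using cell_same_tr[OF U(1) U(4) U(2), of m] m tri by simp
      have "D l + h \<notin> range D"
      proof
        assume v': "D l + h \<in> range D"
        obtain Z where Z: "adjacent U Z" "Z \<notin> range P" using no_isolated[OF U(1)] .
        have "adjacent U (N (D k))" using U(2) by (simp add: kl P_even)
        then obtain r s t where rst: "\<And>Z. adjacent U Z \<longleftrightarrow> Z \<in> {N (D k), N r, N s, N t}"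
          using cell by metis
        have "D l \<in> {D k, r, s, t}" "D k + h \<in> {D k, r, s, t}" "D l + h \<in> {D k, r, s, t}"
          using U(3-5) unfolding rst j kl P_even by simp_all
        moreover have "D l \<noteq> D k" "D k + h \<noteq> D k" "D l + h \<noteq> D k" "D l \<noteq> D k + h" "D l \<noteq> D l + h" "D k + h \<noteq> D l + h"
          using h ce unfolding w by (elim insertE emptyE Pair_inject; cases "D k"; simp)+
        ultimately have "{r, s, t} = {D l, D k + h, D l + h}" by auto
        then have "r \<in> range D" "s \<in> range D" "t \<in> range D" using v v' by blast+
        moreover have "Z \<in> {N (D k), N r, N s, N t}" using Z(1) rst by blast
        ultimately show False
          using Z(2) N_range[of "D k"] N_range[of r] N_range[of s] N_range[of t] by blast
      qed
      moreover have "D l + (- e, c) \<in> range D \<or> D l - (- e, c) \<in> range D"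
      proof -
        have "D l + (- c, - e) = D k" by (simp add: w prod_eq_iff)
        moreover have "D k \<noteq> D (l - 1)" "D k \<noteq> D (l + 1)"
          using unused[of "l - 1"] unused[of l] by (auto simp: insert_commute)
        ultimately have "D l + (e, - c) \<in> {D (l - 1), D (l + 1)} \<or> D l - (e, - c) \<in> {D (l - 1), D (l + 1)}"
          using D.perpendicular_step[of l "- c" "- e"] adj_ow by (simp add: adjacent_sym)
        moreover have "D l + (e, - c) = D l - (- e, c)" "D l - (e, - c) = D l + (- e, c)" by (cases "D l"; simp)+
        ultimately show ?thesis by (metis insertE rangeI singletonD)
      qed
      ultimately have "D l - h \<in> range D"
        using h by (cases "D l") auto
      then obtain n where n: "D n = D l - h" by auto
      have trn: "tr D n = -1"
        using cell_same_tr[OF V(1) V(3) V(2), of n] n tri by simp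
      have "tr D l = -1" "tr D k = -1" using tri trj by (simp_all add: kl tr_even)
      moreover have "odd (fst (D l) + snd (D l) - (fst (D k) + snd (D k)))"
        using ce unfolding w by (elim insertE emptyE Pair_inject) simp_all
      then have "odd (l - k)" using D.sum_parity[of l k] by blast
      moreover have "\<bar>fst (D m) - fst (D l)\<bar> = 1" "\<bar>snd (D m) - snd (D l)\<bar> = 1"
        "\<bar>fst (D n) - fst (D k)\<bar> = 1" "\<bar>snd (D n) - snd (D k)\<bar> = 1"
        using h ce unfolding m n w by (elim insertE emptyE Pair_inject; simp)+
      ultimately show False
        using no_two_diagonals[OF D_folding, of l k m n] trm trn by simp
    qed
    have "D k \<noteq> D (l - 1)" "D l \<noteq> D (k - 1)" "D l \<noteq> D (k + 1)"
      using unused[of "l - 1"] unused[of "k - 1"] unused[of k] by (auto simp: insert_commute)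
    then have "D k + (- e, c) \<in> {D (k - 1), D (k + 1)} \<or> D k - (- e, c) \<in> {D (k - 1), D (k + 1)}"
      using D.perpendicular_step[of k c e] adj_ow w by simp
    then have "D k + (- e, c) \<in> range D \<or> D k - (- e, c) \<in> range D" by blast
    then have "D k + h \<in> range D \<or> D k - h \<in> range D"
      using h(1) by (cases "D k") auto
    then show False
    proof
      assume "D k + h \<in> range D"
      then show False using core[of h X Y] h X Y W by blast
    next
      assume "D k - h \<in> range D"
      moreover have "- h \<in> {(- e, c), (e, - c)}" using h(1) by auto
      ultimately show False using core[of "- h" Y X] h X Y W by simp
    qed
  qed
  then show ?thesis
    using W X(1) Y(1) conn_trans[OF conn_step[of X "- range P" W] conn_step[of W "- range P" Y]] by simp
qed simp

text \<open>The lattice square on the left of the edge from \<open>P i\<close> to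
  \<open>P (i + 1)\<close> has \<open>V\<close> and \<open>S\<close> as its other corners. Both
  prove to be exterior, and their common edge links the points attached at \<open>i\<close> with
  those attached at \<open>i + 1\<close>.\<close>

lemma attached_next:
  assumes X: "attached P i X" and Y: "attached P (i + 1) Y"
  shows "conn (- range P) X Y"
proof -
  have tr: "tr P i = -1" "tr P (i + 1) = -1" using X Y by (auto simp: attached_def)
  obtain a b where ab: "P (i + 1) - P i = (a, b)" by fastforce
  have ab': "(a, b) \<in> units" using unit_step[of i] ab by simp
  obtain x y where xy: "P i = (x, y)" by fastforce
  have i1: "P (i + 1) = (x + a, y + b)" using ab xy by (cases "P (i + 1)") auto
  have "P i - P (i - 1) = (- b, a)" using right_turn_prev[OF tr(1) ab] .
  then have i0: "P (i - 1) = (x + b, y - a)" using xy by (cases "P (i - 1)") auto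
  have "P (i + 1 + 1) - P (i + 1) = (b, - a)" using step_rec[of "i + 1"] tr ab by simp
  then have i2: "P (i + 1 + 1) = (x + a + b, y + b - a)" using i1 by (cases "P (i + 1 + 1)") auto
  define V where "V = P i + (- b, a)"
  define S where "S = P (i + 1) + (- b, a)"
  have freeV: "free P (P i) V"
  proof (rule free_other[OF free_of_attached[OF X]])
    show "adjacent (P i) V" "V \<noteq> P (i - 1)" "V \<noteq> P (i + 1)"
      using ab' unfolding V_def i0 i1 xy by (elim insertE emptyE Pair_inject; simp add: adjacent_iff)+
  qed
  have freeS: "free P (P (i + 1)) S"
  proof (rule free_other[OF free_of_attached[OF Y]])
    show "adjacent (P (i + 1)) S" "S \<noteq> P (i + 1 + 1)"
      using ab' unfolding S_def i2 i1 by (elim insertE emptyE Pair_inject; simp add: adjacent_iff)+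
    show "S \<noteq> P (i + 1 - 1)"
      using ab' unfolding add_diff_cancel_right' S_def i1 xy by (elim insertE emptyE Pair_inject) simp_all
  qed
  have "V \<notin> range P \<and> S \<notin> range P"
  \<comment> \<open>Of \<open>i\<close> and \<open>i + 1\<close> one is odd, and the corner diagonal
    to that vertex is treated first: a vertex there would have the same turn by the free edge and
    the opposite one by alternation. The square lemmas then give the other corner.\<close>
  proof (cases "even i")
    case True
    have "V \<notin> range P"
    proof
      assume "V \<in> range P"
      then obtain j where j: "V = P j" by blast
      have "tr P j = tr P i" using free_tr_eq[of i j] freeV j by simp
      moreover have "\<bar>fst (P j) - fst (P (i + 1))\<bar> = 1" "\<bar>snd (P j) - snd (P (i + 1))\<bar> = 1"
        using ab' unfolding j[symmetric] V_def xy i1 by (elim insertE emptyE Pair_inject; simp)+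
      then have "tr P j = - tr P (i + 1)" using diagonal[of "i + 1" j] True by simp
      ultimately show False using tr by simp
    qed
    then show ?thesis using square_second_corner[OF tr ab] freeS by (simp add: V_def S_def)
  next
    case False
    have "S \<notin> range P"
    proof
      assume "S \<in> range P"
      then obtain j where j: "S = P j" by blast
      have "tr P j = tr P (i + 1)" using free_tr_eq[of "i + 1" j] freeS j by simp
      moreover have "\<bar>fst (P j) - fst (P i)\<bar> = 1" "\<bar>snd (P j) - snd (P i)\<bar> = 1"
        using ab' unfolding j[symmetric] S_def xy i1 by (elim insertE emptyE Pair_inject; simp)+
      then have "tr P j = - tr P i" using diagonal[of i j] False by simp
      ultimately show False using tr by simp
    qed
    then show ?thesis using square_first_corner[OF tr ab] freeV by (simp add: V_def S_def)
  qed
  then have VS: "V \<notin> range P" "S \<notin> range P" by auto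
  have "attached P i V" "attached P (i + 1) S"
    using VS tr freeV freeS adjacent_sym by (auto simp: attached_def free_def)
  then have "conn (- range P) X V" "conn (- range P) S Y"
    using attached_same X Y by blast+
  moreover have "adjacent V S" using ab' unfolding V_def S_def xy i1
    by (elim insertE emptyE Pair_inject) (simp_all add: adjacent_iff)
  then have "conn (- range P) V S" using VS by (intro conn_step) auto
  ultimately show ?thesis using conn_trans by metis
qed

text \<open>If \<open>X\<close> and \<open>Y\<close> were not connected, the hypothesis for smaller
  differences would forbid attached points strictly between \<open>I\<close> and \<open>J\<close>.
  This forces \<open>X\<close> to pass to the derived index of \<open>I\<close> rounded down to
  even, and \<open>Y\<close> to that of \<open>J\<close> rounded up, where the difference is
  smaller.\<close>

lemma attached_conn_step:
  assumes IH: "\<And>R d' i j U V. d' < d \<Longrightarrow> folding_curve R \<Longrightarrow> attached R i U \<Longrightarrow> attached R j V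
      \<Longrightarrow> j - i = int d' \<Longrightarrow> conn (- range R) U V"
    and X: "attached P I X" and Y: "attached P J Y" and d: "J - I = int d"
  shows "conn (- range P) X Y"
proof (rule ccontr)
  assume nc: "\<not> conn (- range P) X Y"
  have "d \<noteq> 0"
  proof
    assume "d = 0"
    then have "J = I" using d by simp
    then show False using nc attached_same[of I X Y] X Y by simp
  qed
  have "d \<noteq> 1"
  proof
    assume "d = 1"
    then have "J = I + 1" using d by simp
    then show False using nc attached_next[of I X Y] X Y by simp
  qed
  have between: "\<not> attached P m U" if "I < m" "m < J" for m U
  proof
    assume U: "attached P m U"
    have "conn (- range P) X U" using IH[of "nat (m - I)", OF _ P_folding X U] that d by simp
    moreover have "conn (- range P) U Y" using IH[of "nat (J - m)", OF _ P_folding U Y] that d by simp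
    ultimately show False using nc conn_trans by blast
  qed
  \<comment> \<open>The component of \<open>X\<close> meets no index in the interval from
    \<open>I + 1\<close> to \<open>J\<close>: the inner ones are excluded by \<open>between\<close>,
    and at \<open>J\<close> it would meet \<open>Y\<close>.\<close>
  have X': "m \<le> I \<or> J < m" if "attached P m U" "conn (- range P) X U" for m U
  proof (rule ccontr)
    assume "\<not> (m \<le> I \<or> J < m)"
    then have "m = J" using between[of m U] that(1) by force
    then show False using attached_same[of J U Y] that Y nc conn_trans by blast
  qed
  have Y': "J \<le> m \<or> m < I" if "attached P m U" "conn (- range P) Y U" for m U
  proof (rule ccontr)
    assume "\<not> (J \<le> m \<or> m < I)"
    then have "m = I" using between[of m U] that(1) by force
    then show False using attached_same[of I U X] that X nc conn_trans conn_sym by metis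
  qed
  have "\<exists>k x. attached D k x \<and> conn (- range P) X (N x) \<and> 2 * k = (if even I then I else I - 1)"
  proof (cases "even I")
    case True
    then obtain k where k: "I = 2 * k" using evenE by blast
    from attached_even[of k X] X consider x where "attached D k x" "conn (- range P) X (N x)"
      | n where "attached P n X" "2 * k < n" unfolding k by auto
    then show ?thesis
    proof cases
      case 1 then show ?thesis using k True by auto
    next
      \<comment> \<open>\<open>X\<close> is attached again beyond \<open>J\<close>, so the arc from
        \<open>I\<close> to \<open>n\<close> closed through \<open>X\<close> contains the vertex to
        which \<open>Y\<close> is attached.\<close>
      case 2
      then have "J < n" using X'[of n X] k by auto
      then have "conn (- range P) X Y"
        using enclosed_by_point[OF P_folding, of I J n X Y] d \<open>d \<noteq> 0\<close> X Y 2 by simp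
      then show ?thesis using nc by blast
    qed
  next
    case False
    then obtain k where k: "I = 2 * k + 1" using oddE by blast
    obtain x where x: "X = N x" "attached D k x \<or> attached D (k + 1) x"
      using attached_odd[of k X] X unfolding k by blast
    \<comment> \<open>Lifting would attach the component of \<open>X\<close> at the index
      \<open>I + 1\<close>, which is smaller than \<open>J\<close>.\<close>
    have "\<not> attached D (k + 1) x"
    proof
      assume "attached D (k + 1) x"
      then obtain Z where "attached P (2 * (k + 1)) Z" "conn (- range P) X Z"
        using attached_lift[of "k + 1" x] x(1) by blast
      then show False using X'[of "2 * (k + 1)" Z] k d \<open>d \<noteq> 0\<close> \<open>d \<noteq> 1\<close> by auto
    qed
    then show ?thesis using x k by auto
  qed
  then obtain k x where x: "attached D k x" "conn (- range P) X (N x)"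
    and k: "2 * k = (if even I then I else I - 1)" by blast
  have "\<exists>l y. attached D l y \<and> conn (- range P) Y (N y) \<and> 2 * l = (if even J then J else J + 1)"
  proof (cases "even J")
    case True
    then obtain l where l: "J = 2 * l" using evenE by blast
    from attached_even[of l Y] Y consider y where "attached D l y" "conn (- range P) Y (N y)"
      | m where "attached P m Y" "m < 2 * l" unfolding l by auto
    then show ?thesis
    proof cases
      case 1 then show ?thesis using l True by auto
    next
      case 2
      then have "m < I" using Y'[of m Y] l by auto
      then have "conn (- range P) Y X"
        using enclosed_by_point[OF P_folding, of m I J Y X] d \<open>d \<noteq> 0\<close> X Y 2 by simp
      then show ?thesis using nc conn_sym by blast
    qed
  next
    case False
    then obtain l where l: "J = 2 * l + 1" using oddE by blast
    obtain y where y: "Y = N y" "attached D l y \<or> attached D (l + 1) y"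
      using attached_odd[of l Y] Y unfolding l by blast
    have "\<not> attached D l y"
    proof
      assume "attached D l y"
      then obtain Z where "attached P (2 * l) Z" "conn (- range P) Y Z"
        using attached_lift[of l y] y(1) by blast
      then show False using Y'[of "2 * l" Z] l d \<open>d \<noteq> 0\<close> \<open>d \<noteq> 1\<close> by auto
    qed
    then show ?thesis using y l by (intro exI[of _ "l + 1"] exI[of _ y]) simp
  qed
  then obtain l y where y: "attached D l y" "conn (- range P) Y (N y)"
    and l: "2 * l = (if even J then J else J + 1)" by blast
  \<comment> \<open>The only remaining difference that rounding outward does not decrease: here
    \<open>l - k\<close> would again be \<open>2\<close>.\<close>
  have "\<not> (odd I \<and> d = 2)"
  proof
    assume *: "odd I \<and> d = 2"
    then have "J = I + 2" using d by simp
    then have "tr P J = - tr P I" using der * by (simp add: derived_def)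
    then show False using X Y by (simp add: attached_def)
  qed
  then have "l - k < int d \<and> 0 \<le> l - k"
    using k l d \<open>d \<noteq> 0\<close> \<open>d \<noteq> 1\<close> by (auto split: if_splits)
  then have "conn (- range D) x y"
    using IH[of "nat (l - k)", OF _ D_folding x(1) y(1)] by simp
  then have "conn (- range P) (N x) (N y)" by (rule conn_lift)
  then show False using nc x(2) y(2) conn_trans conn_sym by metis
qed

end

lemma attached_conn_le:
  assumes "folding_curve P" "attached P i X" "attached P j Y" "j - i = int d"
  shows "conn (- range P) X Y"
  using assms
proof (induction d arbitrary: P i j X Y rule: less_induct)
  case (less d)
  obtain e D where "derived (\<lambda>i. P (i + e)) D" using ex_derived[OF less.prems(1)] .
  then interpret derived_curve "\<lambda>i. P (i + e)" D by (rule derived_curve.intro)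
  have att: "attached (\<lambda>i. P (i + e)) (m - e) Z \<longleftrightarrow> attached P m Z" for m Z
    unfolding attached_def range_shift[of P e] by (simp add: tr_shift)
  have "conn (- range (\<lambda>i. P (i + e))) X Y"
  proof (rule attached_conn_step[of d "i - e" X "j - e" Y])
    show "conn (- range R) U V" if "d' < d" "folding_curve R" "attached R i U" "attached R j V" "j - i = int d'"
      for R d' i j U V using that by (rule less.IH)
  qed (use less.prems in \<open>simp_all add: att\<close>)
  then show ?case by (simp only: range_shift)
qed

lemma attached_conn:
  assumes "folding_curve P" "attached P i X" "attached P j Y"
  shows "conn (- range P) X Y"
proof (cases "i \<le> j")
  case True
  then show ?thesis using attached_conn_le[OF assms, of "nat (j - i)"] by simp
next
  case False
  then show ?thesis
    using attached_conn_le[OF assms(1,3,2), of "nat (i - j)"] conn_sym by simp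
qed

section \<open>Squares at a vertex, reversal and the connectedness of each side\<close>

definition corner :: "lattice_point \<Rightarrow> lattice_point \<Rightarrow> bool" where
  "corner z X \<longleftrightarrow> z \<in> {X, X - (1,0), X - (1,1), X - (0,1)}"

lemma corner_lface: "adjacent X Y \<Longrightarrow> corner (lface X Y) X" "adjacent X Y \<Longrightarrow> corner (lface X Y) Y"
  by (erule adjacent_cases; cases X; simp add: corner_def lface_def)+

lemma corner_cases:
  assumes "(a, b) \<in> units" "corner z X"
  shows "z \<in> {lface (X - (a, b)) X, lface X (X + (b, - a)), lface X (X - (a, b)), lface X (X + (a, b))}"
    and "lface X (X + (b, - a)) = lface (X + (a, b)) X"
proof -
  obtain x y where X: "X = (x, y)" by fastforce
  show "z \<in> {lface (X - (a, b)) X, lface X (X + (b, - a)), lface X (X - (a, b)), lface X (X + (a, b))}"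
    using assms unfolding corner_def X by (elim insertE emptyE Pair_inject) (simp_all add: lface_def)
  show "lface X (X + (b, - a)) = lface (X + (a, b)) X"
    using assms(1) unfolding X by (elim insertE emptyE Pair_inject) (simp_all add: lface_def)
qed

context turning_curve
begin

text \<open>By parity both visits enter along the same axis, and distinct edges force opposite
  directions. After that a left turn would reuse the edge from \<open>P c\<close> to
  \<open>P (c + 1)\<close>.\<close>

lemma second_visit:
  assumes "P d = P c" "d \<noteq> c" "P (c - 1) = P c - (a, b)" "P (c + 1) = P c + (b, - a)" "tr P c = -1"
    and ab: "(a, b) \<in> units"
  shows "P (d - 1) = P c + (a, b)" "tr P d = -1"
proof -
  obtain x y where xy: "P c = (x, y)" by fastforce
  obtain p q where pq: "(p, q) \<in> units" "P (d - 1) = P d - (p, q)"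
    "tr P d = 1 \<and> P (d + 1) = P d + (- q, p) \<or> tr P d = -1 \<and> P (d + 1) = P d + (q, - p)"
    by (rule local_shape[of d])
  have "even (d - c)" using sum_parity[of d c] assms(1) by simp
  then have ax: "p = 0 \<longleftrightarrow> a = 0"
    using axis_parity[of "d - 1" "c - 1"] pq(2) assms(1,3) by (simp add: xy)
  have "P (d - 1) \<noteq> P (c - 1)" using edge_inj[of "d - 1" "c - 1"] assms(1,2) by auto
  moreover have "P (d + 1) \<noteq> P (c + 1)" using edge_inj[of d c] assms(1,2) by auto
  ultimately have "(p, q) = (- a, - b) \<and> tr P d = -1"
    using pq ab ax assms(3,4) unfolding assms(1) xy
    by (elim insertE emptyE Pair_inject disjE conjE) simp_all
  then show "P (d - 1) = P c + (a, b)" "tr P d = -1"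
    using pq(2) assms(1) by (simp_all add: prod_eq_iff)
qed

lemma tr_visit:
  assumes "P d = P c" "tr P c = -1"
  shows "tr P d = -1"
proof (cases "d = c")
  case False
  obtain a b where "(a, b) \<in> units" "P (c - 1) = P c - (a, b)" "P (c + 1) = P c + (b, - a)"
    by (rule local_shape[of c]) (use assms(2) in auto)
  then show ?thesis using second_visit(2)[OF assms(1) False] assms(2) by blast
qed (use assms in simp)

text \<open>At a right turn the two squares on the left of the curve edges are excluded by colour.
  The square inside the turn belongs to \<open>c\<close> itself. The opposite square differs in
  colour from one across the edge straight ahead, so this edge is used, by a second visit whose turn
  contains that square.\<close>

lemma right_corner_arc:
  assumes f: "side f" and c: "tr P c = -1" "corner z (P c)" "\<not> f z"
  obtains d where "P d = P c" "tr P d = -1" "z = lface (P d) (P (d - 1))"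
proof -
  obtain a b where ab: "(a, b) \<in> units" "P (c - 1) = P c - (a, b)" "P (c + 1) = P c + (b, - a)"
    by (rule local_shape[of c]) (use c(1) in auto)
  have l: "f (lface (P i) (P (i + 1)))" for i using f unfolding side_def by blast
  have f1: "f (lface (P c - (a, b)) (P c))" using l[of "c - 1"] ab(2) by simp
  have f2: "f (lface (P c) (P c + (b, - a)))" using l[of c] ab(3) by simp
  have "z = lface (P c) (P c - (a, b)) \<or> z = lface (P c) (P c + (a, b))"
    using corner_cases(1)[OF ab(1) c(2)] f1 f2 c(3) by auto
  then show thesis
  proof
    assume "z = lface (P c) (P c - (a, b))"
    then show thesis using that[of c] c(1) ab(2) by simp
  next
    assume z: "z = lface (P c) (P c + (a, b))"
    have "\<not> free P (P c) (P c + (a, b))"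
    proof
      assume "free P (P c) (P c + (a, b))"
      then have "f z = f (lface (P c + (a, b)) (P c))" using f z unfolding side_def by blast
      then show False using f2 c(3) corner_cases(2)[OF ab(1) c(2)] by simp
    qed
    moreover have "adjacent (P c) (P c + (a, b))" using ab(1) by (simp add: adjacent_iff)
    ultimately obtain m where m: "{P m, P (m + 1)} = {P c, P c + (a, b)}" by (auto simp: free_def)
    have ne: "P c + (a, b) \<noteq> P (c - 1)" "P c + (a, b) \<noteq> P (c + 1)"
      using ab by (elim insertE emptyE Pair_inject; cases "P c"; simp)+
    obtain d where d: "P d = P c" "d \<noteq> c"
    proof (cases "P m = P c")
      case True
      then have "P (m + 1) = P c + (a, b)" using m by (auto simp: doubleton_eq_iff)
      then have "m \<noteq> c" using ne(2) by auto
      then show thesis using that[of m] True by simp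
    next
      case False
      then have m': "P (m + 1) = P c" "P m = P c + (a, b)" using m by (auto simp: doubleton_eq_iff)
      then have "m + 1 \<noteq> c" using ne(1) by auto
      then show thesis using that[of "m + 1"] m' by simp
    qed
    have "P (d - 1) = P c + (a, b)" "tr P d = -1"
      using second_visit[OF d ab(2,3) c(1) ab(1)] by auto
    then show thesis using that[of d] d z by simp
  qed
qed

end

lemma free_reverse: "free (\<lambda>i. P (- i)) X Y \<longleftrightarrow> free P X Y"
proof -
  have "(\<exists>i. {P (- i), P (- (i + 1))} = {X, Y}) \<longleftrightarrow> (\<exists>i. {P i, P (i + 1)} = {X, Y})"
  proof
    assume "\<exists>i. {P (- i), P (- (i + 1))} = {X, Y}"
    then obtain i where "{P (- i), P (- (i + 1))} = {X, Y}" by blast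
    then have "{P (- i - 1), P (- i - 1 + 1)} = {X, Y}" by (simp add: insert_commute)
    then show "\<exists>i. {P i, P (i + 1)} = {X, Y}" by blast
  next
    assume "\<exists>i. {P i, P (i + 1)} = {X, Y}"
    then obtain i where "{P i, P (i + 1)} = {X, Y}" by blast
    then have "{P (- (- i - 1)), P (- (- i - 1 + 1))} = {X, Y}" by (simp add: insert_commute add.commute)
    then show "\<exists>i. {P (- i), P (- (i + 1))} = {X, Y}" by blast
  qed
  then show ?thesis by (auto simp: free_def)
qed

lemma side_reverse:
  assumes "turning_curve P" "turning_curve.side P f"
  shows "turning_curve.side (\<lambda>i. P (- i)) (\<lambda>p. \<not> f p)"
proof -
  interpret turning_curve P by fact
  interpret R: turning_curve "\<lambda>i. P (- i)" using assms(1) by (rule turning_curve_reverse)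
  have s: "f (lface (P i) (P (i + 1)))" "\<not> f (lface (P (i + 1)) (P i))" for i
    using assms(2) unfolding side_def by blast+
  have "\<not> f (lface (P (- i)) (P (- (i + 1))))" "f (lface (P (- (i + 1))) (P (- i)))" for i
    using s[of "- i - 1"] by simp_all
  then show ?thesis using assms(2) unfolding R.side_def side_def free_reverse by blast
qed

lemma range_reverse: "range (\<lambda>i::int. P (- i)) = range P"
proof -
  have "P i = P (- (- i))" for i by simp
  then show ?thesis by blast
qed

text \<open>Mirror image of \<open>right_corner_arc\<close>: reversing the curve negates turns and
  colours. At a left turn the left squares of the incoming and the outgoing edge coincide.\<close>

lemma (in turning_curve) left_corner_arc:
  assumes f: "side f" and c: "tr P c = 1" "corner z (P c)" "f z"
  obtains d where "P d = P c" "tr P d = 1" "z = lface (P (d - 1)) (P d)"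
proof -
  interpret R: turning_curve "\<lambda>i. P (- i)" using turning_curve_axioms by (rule turning_curve_reverse)
  have "R.side (\<lambda>p. \<not> f p)" using side_reverse[OF turning_curve_axioms f] .
  then obtain d where d: "P (- d) = P c" "tr (\<lambda>i. P (- i)) d = -1" "z = lface (P (- d)) (P (- (d - 1)))"
    using R.right_corner_arc[of "\<lambda>p. \<not> f p" "- c" z] c by (auto simp: tr_reverse)
  then have "tr P (- d) = 1" by (simp add: tr_reverse)
  moreover have "- (d - 1) = - d + 1" by simp
  ultimately show thesis using that[of "- d"] d left_turn_face[of "- d"] by simp
qed

text \<open>On a lattice walk from \<open>X\<close> to \<open>P 0\<close>, the point
  \<open>Y\<close> is the last one before the curve is first met. The induction builds such walks
  backwards, starting at \<open>P 0\<close>.\<close>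

lemma (in turning_curve) near_curve:
  assumes "X \<notin> range P"
  obtains Y i where "conn (- range P) X Y" "Y \<notin> range P" "adjacent Y (P i)"
proof -
  have "X \<in> range P \<or> (\<exists>Y i. conn (- range P) X Y \<and> Y \<notin> range P \<and> adjacent Y (P i))"
  proof (rule adjacent_induct[where p = "P 0"])
    fix p q assume p: "p \<in> range P \<or> (\<exists>Y i. conn (- range P) p Y \<and> Y \<notin> range P \<and> adjacent Y (P i))"
      and "adjacent p q"
    then have qp: "adjacent q p" by (simp add: adjacent_sym)
    show "q \<in> range P \<or> (\<exists>Y i. conn (- range P) q Y \<and> Y \<notin> range P \<and> adjacent Y (P i))"
    proof (cases "q \<in> range P")
      case q: False
      show ?thesis
      proof (cases "p \<in> range P")
        case True
        then obtain i where "p = P i" by blast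
        then show ?thesis using q qp conn_refl by blast
      next
        case False
        then have "conn (- range P) q p" using q qp by (intro conn_step) auto
        then show ?thesis using p False conn_trans by blast
      qed
    qed simp
  qed simp
  then show thesis using assms that by blast
qed

lemma (in turning_curve) conn_side:
  assumes "side f" "conn (- range P) X Y"
  shows "f X = f Y"
  using assms(2) unfolding conn_def
proof (induction rule: rtranclp_induct)
  case (step Y Z)
  then show ?case using ext_side_adjacent[OF assms(1), of Y Z] by auto
qed simp

lemma left_side_conn:
  assumes P: "folding_curve P" and f: "turning_curve.side P f"
    and X: "X \<notin> range P" "f X" and Y: "Y \<notin> range P" "f Y"
  shows "conn (- range P) X Y"
proof -
  interpret turning_curve P using P by (simp add: folding_curve_def)
  have *: "\<exists>Z i. conn (- range P) X Z \<and> attached P i Z" if X: "X \<notin> range P" "f X" for X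
  proof -
    obtain Z i where Z: "conn (- range P) X Z" "Z \<notin> range P" "adjacent Z (P i)" using near_curve[OF X(1)] .
    then have "f Z" using conn_side[OF f] X(2) by blast
    then show ?thesis using Z ext_tr_iff[OF f Z(2,3)] by (auto simp: attached_def)
  qed
  obtain Z i where Z: "conn (- range P) X Z" "attached P i Z" using *[OF X] by blast
  obtain Z' j where Z': "conn (- range P) Y Z'" "attached P j Z'" using *[OF Y] by blast
  show ?thesis using attached_conn[OF P Z(2) Z'(2)] Z(1) Z'(1) conn_trans conn_sym by metis
qed

lemma same_side_conn:
  assumes P: "folding_curve P" and f: "turning_curve.side P f"
    and X: "X \<notin> range P" and Y: "Y \<notin> range P" and XY: "f X = f Y"
  shows "conn (- range P) X Y"
proof (cases "f X")
  case True
  then show ?thesis using left_side_conn[OF P f X _ Y] XY by simp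
next
  case False
  have "turning_curve P" using P by (simp add: folding_curve_def)
  then have "turning_curve.side (\<lambda>i. P (- i)) (\<lambda>p. \<not> f p)" using side_reverse f by blast
  then show ?thesis
    using left_side_conn[OF folding_curve_reverse[OF P], of "\<lambda>p. \<not> f p" X Y] X Y XY False
    by (simp add: range_reverse)
qed

subsection \<open>Octagons and diamonds\<close>

abbreviation xc :: "lattice_point \<Rightarrow> real" where "xc z \<equiv> real_of_int (fst z)"
abbreviation yc :: "lattice_point \<Rightarrow> real" where "yc z \<equiv> real_of_int (snd z)"

text \<open>The unit square with a right triangle of legs \<open>2 * \<alpha>\<close> cut off at
  each corner. The four triangles around a lattice point form its \<open>diamond\<close>, whose
  sides are the possible corner cuts of a curve.\<close>

definition octagon :: "real \<Rightarrow> lattice_point \<Rightarrow> (real \<times> real) set" where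
  "octagon \<alpha> z = {(s, t). xc z \<le> s \<and> s \<le> xc z + 1 \<and>
     yc z \<le> t \<and> t \<le> yc z + 1 \<and>
     2 * \<alpha> \<le> (s - xc z) + (t - yc z) \<and>
     2 * \<alpha> \<le> (xc z + 1 - s) + (t - yc z) \<and>
     2 * \<alpha> \<le> (s - xc z) + (yc z + 1 - t) \<and>
     2 * \<alpha> \<le> (xc z + 1 - s) + (yc z + 1 - t)}"

definition diamond :: "real \<Rightarrow> lattice_point \<Rightarrow> (real \<times> real) set" where
  "diamond \<alpha> X = {(s, t). \<bar>s - xc X\<bar> + \<bar>t - yc X\<bar> \<le> 2 * \<alpha>}"

text \<open>The predicates colour octagons and diamonds separately. Since the tiles are closed, two
  oppositely coloured unions overlap along common sides, and the complement of one of them is the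
  open version of the other.\<close>

definition region :: "real \<Rightarrow> (lattice_point \<Rightarrow> bool) \<Rightarrow> (lattice_point \<Rightarrow> bool) \<Rightarrow> (real \<times> real) set" where
  "region \<alpha> f g = (\<Union>z\<in>{z. f z}. octagon \<alpha> z) \<union> (\<Union>X\<in>{X. g X}. diamond \<alpha> X)"

definition centre :: "lattice_point \<Rightarrow> real \<times> real" where
  "centre z = (xc z + 1/2, yc z + 1/2)"

lemma closed_lattice_Union:
  fixes A :: "lattice_point \<Rightarrow> (real \<times> real) set"
  assumes cl: "\<And>z. closed (A z)"
    and near: "\<And>z s t. (s, t) \<in> A z \<Longrightarrow> \<bar>s - xc z\<bar> \<le> 2 \<and> \<bar>t - yc z\<bar> \<le> 2"
  shows "closed (\<Union>z. A z)"
  unfolding closed_def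
proof (subst open_subopen, intro ballI)
  fix p assume p: "p \<in> - (\<Union>z. A z)"
  \<comment> \<open>The margin \<open>4\<close> adds the distance \<open>2\<close> from a point of
    \<open>A z\<close> to \<open>z\<close>, the radius \<open>1\<close> of the ball and the rounding
    of \<open>p\<close>.\<close>
  define F where "F = {\<lfloor>fst p\<rfloor> - 4..\<lfloor>fst p\<rfloor> + 4} \<times> {\<lfloor>snd p\<rfloor> - 4..\<lfloor>snd p\<rfloor> + 4}"
  have "closed (\<Union>z\<in>F. A z)" using cl by (simp add: F_def closed_UN)
  then have "open (ball p 1 - (\<Union>z\<in>F. A z))" by (intro open_Diff open_ball)
  moreover have "p \<in> ball p 1 - (\<Union>z\<in>F. A z)" using p by auto
  moreover have "ball p 1 - (\<Union>z\<in>F. A z) \<subseteq> - (\<Union>z. A z)"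
  proof
    fix q assume q: "q \<in> ball p 1 - (\<Union>z\<in>F. A z)"
    have "\<bar>fst q - fst p\<bar> < 1" "\<bar>snd q - snd p\<bar> < 1"
      using q dist_fst_le[of p q] dist_snd_le[of p q] by (auto simp: dist_real_def)
    then have "z \<in> F" if "q \<in> A z" for z
      using near[of "fst q" "snd q" z] that by (cases z) (auto simp: F_def, linarith+)
    then show "q \<in> - (\<Union>z. A z)" using q by blast
  qed
  ultimately show "\<exists>T. open T \<and> p \<in> T \<and> T \<subseteq> - (\<Union>z. A z)" by blast
qed

lemma closed_octagon: "closed (octagon \<alpha> z)"
  unfolding octagon_def case_prod_beta
  by (intro closed_Collect_conj closed_Collect_le continuous_intros)

lemma closed_diamond: "closed (diamond \<alpha> X)"
  unfolding diamond_def case_prod_beta by (intro closed_Collect_le continuous_intros)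

lemma closed_region:
  assumes "\<alpha> < 1/4"
  shows "closed (region \<alpha> f g)"
proof -
  define A where "A z = (if f z then octagon \<alpha> z else {}) \<union> (if g z then diamond \<alpha> z else {})" for z
  have "closed (\<Union>z. A z)"
  proof (rule closed_lattice_Union)
    show "closed (A z)" for z by (simp add: A_def closed_octagon closed_diamond closed_Un)
    show "\<bar>s - xc z\<bar> \<le> 2 \<and> \<bar>t - yc z\<bar> \<le> 2" if "(s, t) \<in> A z" for z s t
    proof -
      have "(s, t) \<in> octagon \<alpha> z \<or> (s, t) \<in> diamond \<alpha> z" using that by (auto simp: A_def split: if_splits)
      then show ?thesis using assms unfolding octagon_def diamond_def by auto
    qed
  qed
  moreover have "(\<Union>z. A z) = region \<alpha> f g"
    unfolding A_def region_def by (auto split: if_splits)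
  ultimately show ?thesis by simp
qed

lemma region_cover:
  "region \<alpha> f g \<union> region \<alpha> (\<lambda>z. \<not> f z) (\<lambda>X. \<not> g X) = UNIV"
proof -
  have "(\<exists>z. p \<in> octagon \<alpha> z) \<or> (\<exists>X. p \<in> diamond \<alpha> X)" for p
  proof -
    define x where "x = \<lfloor>fst p\<rfloor>"
    define y where "y = \<lfloor>snd p\<rfloor>"
    have b: "real_of_int x \<le> fst p" "fst p < real_of_int x + 1" "real_of_int y \<le> snd p" "snd p < real_of_int y + 1"
      by (simp_all add: x_def y_def)
    show ?thesis
    proof (rule ccontr)
      assume n: "\<not> ?thesis"
      then have "p \<notin> diamond \<alpha> (x, y)" "p \<notin> diamond \<alpha> (x + 1, y)" "p \<notin> diamond \<alpha> (x, y + 1)"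
        "p \<notin> diamond \<alpha> (x + 1, y + 1)" by blast+
      then have "p \<in> octagon \<alpha> (x, y)" using b
        by (simp add: octagon_def diamond_def case_prod_beta)
      then show False using n by blast
    qed
  qed
  then have "p \<in> region \<alpha> f g \<or> p \<in> region \<alpha> (\<lambda>z. \<not> f z) (\<lambda>X. \<not> g X)" for p
    unfolding region_def by (metis (mono_tags, lifting) UN_I UnI1 UnI2 mem_Collect_eq)
  then show ?thesis by blast
qed

lemma octagon_diamond:
  assumes "\<alpha> < 1/4" "p \<in> octagon \<alpha> z" "p \<in> diamond \<alpha> X"
  shows "corner z X"
proof -
  obtain s t where p: "p = (s, t)" by fastforce
  obtain x y where z: "z = (x, y)" by fastforce
  obtain u v where X: "X = (u, v)" by fastforce
  have "\<bar>s - real_of_int u\<bar> + \<bar>t - real_of_int v\<bar> \<le> 2 * \<alpha>"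
    and b: "real_of_int x \<le> s" "s \<le> real_of_int x + 1" "real_of_int y \<le> t" "t \<le> real_of_int y + 1"
    using assms(2,3) by (auto simp: octagon_def diamond_def p z X)
  then have "\<bar>s - real_of_int u\<bar> < 1/2" "\<bar>t - real_of_int v\<bar> < 1/2"
    using assms(1) by linarith+
  then have "u = x \<or> u = x + 1" "v = y \<or> v = y + 1" using b by linarith+
  then show ?thesis by (auto simp: corner_def z X)
qed

text \<open>Two squares that meet in a single lattice point have disjoint octagons, because
  \<open>0 < \<alpha>\<close> removes their corners.\<close>

lemma octagon_octagon:
  assumes "0 < \<alpha>" "p \<in> octagon \<alpha> z" "p \<in> octagon \<alpha> z'" "z \<noteq> z'"
  shows "adjacent z z'"
proof -
  obtain s t where p: "p = (s, t)" by fastforce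
  obtain x y where z: "z = (x, y)" by fastforce
  obtain u v where z': "z' = (u, v)" by fastforce
  have b: "real_of_int x \<le> s" "s \<le> real_of_int x + 1" "real_of_int y \<le> t" "t \<le> real_of_int y + 1"
    "real_of_int u \<le> s" "s \<le> real_of_int u + 1" "real_of_int v \<le> t" "t \<le> real_of_int v + 1"
    using assms by (auto simp: octagon_def p z z')
  then have d: "u = x \<or> u = x + 1 \<or> u = x - 1" "v = y \<or> v = y + 1 \<or> v = y - 1" by linarith+
  have "u = x \<or> v = y"
  proof (rule ccontr)
    assume "\<not> (u = x \<or> v = y)"
    with d have "(u = x + 1 \<or> u = x - 1) \<and> (v = y + 1 \<or> v = y - 1)" by blast
    then have "(s = real_of_int x + 1 \<or> s = real_of_int x) \<and> (t = real_of_int y + 1 \<or> t = real_of_int y)"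
      using b by auto
    then show False using assms(1,2) by (auto simp: octagon_def p z)
  qed
  then show ?thesis using d assms(4) by (auto simp: adjacent_iff z z')
qed

lemma diamond_diamond:
  assumes "\<alpha> < 1/4" "p \<in> diamond \<alpha> X" "p \<in> diamond \<alpha> Y"
  shows "X = Y"
proof -
  obtain s t where p: "p = (s, t)" by fastforce
  obtain x y where X: "X = (x, y)" by fastforce
  obtain u v where Y: "Y = (u, v)" by fastforce
  have "\<bar>s - real_of_int x\<bar> + \<bar>t - real_of_int y\<bar> \<le> 2 * \<alpha>" "\<bar>s - real_of_int u\<bar> + \<bar>t - real_of_int v\<bar> \<le> 2 * \<alpha>"
    using assms(2,3) by (auto simp: diamond_def p X Y)
  then have "\<bar>s - real_of_int x\<bar> < 1/2" "\<bar>t - real_of_int y\<bar> < 1/2" "\<bar>s - real_of_int u\<bar> < 1/2" "\<bar>t - real_of_int v\<bar> < 1/2"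
    using assms(1) by linarith+
  then have "u = x" "v = y" by linarith+
  then show ?thesis by (simp add: X Y)
qed

section \<open>Common sides of tiles as pieces of the rounded curve\<close>

lemma horizontal_segment:
  fixes a b c :: real
  assumes "a \<le> b"
  shows "(s, t) \<in> closed_segment (a, c) (b, c) \<longleftrightarrow> a \<le> s \<and> s \<le> b \<and> t = c"
proof
  assume "(s, t) \<in> closed_segment (a, c) (b, c)"
  then obtain u where u: "0 \<le> u" "u \<le> 1" "s = (1 - u) * a + u * b" "t = (1 - u) * c + u * c"
    by (auto simp: closed_segment_def)
  then have "s \<in> closed_segment a b" by (auto simp: closed_segment_def)
  then show "a \<le> s \<and> s \<le> b \<and> t = c" using u assms by (simp add: closed_segment_eq_real_ivl algebra_simps)
next
  assume *: "a \<le> s \<and> s \<le> b \<and> t = c"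
  then have "s \<in> closed_segment a b" using assms by (simp add: closed_segment_eq_real_ivl)
  then obtain u where "0 \<le> u" "u \<le> 1" "s = (1 - u) * a + u * b" by (auto simp: closed_segment_def)
  then show "(s, t) \<in> closed_segment (a, c) (b, c)"
    using * by (auto simp: closed_segment_def algebra_simps intro!: exI[of _ u])
qed

lemma vertical_segment:
  fixes a b c :: real
  assumes "a \<le> b"
  shows "(s, t) \<in> closed_segment (c, a) (c, b) \<longleftrightarrow> a \<le> t \<and> t \<le> b \<and> s = c"
proof -
  have "(s, t) \<in> closed_segment (c, a) (c, b) \<longleftrightarrow> (t, s) \<in> closed_segment (a, c) (b, c)"
    by (auto simp: closed_segment_def)
  then show ?thesis using horizontal_segment[OF assms] by simp
qed

lemma corner_segment:
  fixes x y \<alpha> \<sigma> \<tau> :: real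
  assumes "0 < \<alpha>" "\<sigma> = 1 \<or> \<sigma> = -1" "\<tau> = 1 \<or> \<tau> = -1"
  shows "(s, t) \<in> closed_segment (x + 2 * \<alpha> * \<sigma>, y) (x, y + 2 * \<alpha> * \<tau>) \<longleftrightarrow>
    0 \<le> \<sigma> * (s - x) \<and> 0 \<le> \<tau> * (t - y) \<and> \<sigma> * (s - x) + \<tau> * (t - y) = 2 * \<alpha>"
proof
  assume "(s, t) \<in> closed_segment (x + 2 * \<alpha> * \<sigma>, y) (x, y + 2 * \<alpha> * \<tau>)"
  then obtain u where u: "0 \<le> u" "u \<le> 1" "s = (1 - u) * (x + 2 * \<alpha> * \<sigma>) + u * x" "t = (1 - u) * y + u * (y + 2 * \<alpha> * \<tau>)"
    by (auto simp: closed_segment_def)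
  then have "s - x = 2 * \<alpha> * (1 - u) * \<sigma>" "t - y = 2 * \<alpha> * u * \<tau>" by (simp_all add: algebra_simps)
  moreover have "0 \<le> \<alpha> * (1 - u)" "0 \<le> \<alpha> * u" using u assms(1) by simp_all
  ultimately show "0 \<le> \<sigma> * (s - x) \<and> 0 \<le> \<tau> * (t - y) \<and> \<sigma> * (s - x) + \<tau> * (t - y) = 2 * \<alpha>"
    using assms(2,3) by (auto simp: algebra_simps)
next
  assume *: "0 \<le> \<sigma> * (s - x) \<and> 0 \<le> \<tau> * (t - y) \<and> \<sigma> * (s - x) + \<tau> * (t - y) = 2 * \<alpha>"
  define u where "u = \<tau> * (t - y) / (2 * \<alpha>)"
  have u: "0 \<le> u" "u \<le> 1" using * assms(1) by (auto simp: u_def field_simps)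
  have 1: "\<tau> * (t - y) = 2 * \<alpha> * u" using assms(1) by (simp add: u_def)
  then have "\<sigma> * (s - x) = 2 * \<alpha> * (1 - u)" using * by (simp add: algebra_simps)
  then have "s = (1 - u) * (x + 2 * \<alpha> * \<sigma>) + u * x" "t = (1 - u) * y + u * (y + 2 * \<alpha> * \<tau>)"
    using 1 assms(2,3) by (auto simp: algebra_simps)
  then show "(s, t) \<in> closed_segment (x + 2 * \<alpha> * \<sigma>, y) (x, y + 2 * \<alpha> * \<tau>)"
    using u by (auto simp: closed_segment_def intro!: exI[of _ u])
qed

lemma octagon_horizontal:
  assumes "0 < \<alpha>" "\<alpha> < 1/4"
  shows "(s, t) \<in> octagon \<alpha> (x, y) \<and> (s, t) \<in> octagon \<alpha> (x, y - 1) \<longleftrightarrow>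
    x + 2 * \<alpha> \<le> s \<and> s \<le> x + 1 - 2 * \<alpha> \<and> t = y" (is "?L \<longleftrightarrow> ?R")
proof
  assume ?L
  then have "y \<le> t" "t \<le> real_of_int (y - 1) + 1" "2 * \<alpha> \<le> (s - x) + (t - y)" "2 * \<alpha> \<le> (x + 1 - s) + (t - y)"
    by (simp_all add: octagon_def)
  then show ?R by auto
next
  assume ?R
  then have "x + 2 * \<alpha> \<le> s" "s \<le> x + 1 - 2 * \<alpha>" "t = y" by auto
  then show ?L using assms unfolding octagon_def by simp
qed

lemma octagon_vertical:
  assumes "0 < \<alpha>" "\<alpha> < 1/4"
  shows "(s, t) \<in> octagon \<alpha> (x - 1, y) \<and> (s, t) \<in> octagon \<alpha> (x, y) \<longleftrightarrow>
    y + 2 * \<alpha> \<le> t \<and> t \<le> y + 1 - 2 * \<alpha> \<and> s = x" (is "?L \<longleftrightarrow> ?R")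
proof
  assume ?L
  then have "x \<le> s" "s \<le> real_of_int (x - 1) + 1" "2 * \<alpha> \<le> (s - x) + (t - y)" "2 * \<alpha> \<le> (s - x) + (y + 1 - t)"
    by (simp_all add: octagon_def)
  then show ?R by auto
next
  assume ?R
  then have "y + 2 * \<alpha> \<le> t" "t \<le> y + 1 - 2 * \<alpha>" "s = x" by auto
  then show ?L using assms unfolding octagon_def by simp
qed

lemma trimmed_segment_octagons:
  assumes "0 < \<alpha>" "\<alpha> < 1/4" "adjacent A B"
  shows "trimmed_segment \<alpha> (A, B) = octagon \<alpha> (lface A B) \<inter> octagon \<alpha> (lface B A)"
proof (rule set_eqI)
  fix p :: "real \<times> real"
  obtain s t where p: "p = (s, t)" by fastforce
  obtain x y where A: "A = (x, y)" by fastforce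
  have o: "2 * \<alpha> \<le> 1 - 2 * \<alpha>" using assms by simp
  show "p \<in> trimmed_segment \<alpha> (A, B) \<longleftrightarrow> p \<in> octagon \<alpha> (lface A B) \<inter> octagon \<alpha> (lface B A)"
    using assms(3)
  proof (cases rule: adjacent_cases)
    case 1
    have "trimmed_segment \<alpha> (A, B) = closed_segment (x + 2 * \<alpha>, real_of_int y) (x + 1 - 2 * \<alpha>, y)"
      by (simp add: trimmed_segment_def to_plane_def direction_def 1 A)
    then show ?thesis
      using o horizontal_segment[of "x + 2 * \<alpha>" "x + 1 - 2 * \<alpha>" s t y] octagon_horizontal[OF assms(1,2), of s t x y]
      by (simp add: p 1 A lface_def conj_commute)
  next
    case 2
    have "trimmed_segment \<alpha> (A, B) = closed_segment (real_of_int x, y + 2 * \<alpha>) (x, y + 1 - 2 * \<alpha>)"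
      by (simp add: trimmed_segment_def to_plane_def direction_def 2 A)
    then show ?thesis
      using o vertical_segment[of "y + 2 * \<alpha>" "y + 1 - 2 * \<alpha>" s t x] octagon_vertical[OF assms(1,2), of s t x y]
      by (simp add: p 2 A lface_def conj_commute)
  next
    case 3
    have "trimmed_segment \<alpha> (A, B) = closed_segment (x - 1 + 2 * \<alpha>, real_of_int y) (x - 2 * \<alpha>, y)"
      by (subst closed_segment_commute) (simp add: trimmed_segment_def to_plane_def direction_def 3 A)
    then show ?thesis
      using o horizontal_segment[of "x - 1 + 2 * \<alpha>" "x - 2 * \<alpha>" s t y] octagon_horizontal[OF assms(1,2), of s t "x - 1" y]
      by (simp add: p 3 A lface_def conj_commute)
  next
    case 4
    have "trimmed_segment \<alpha> (A, B) = closed_segment (real_of_int x, y - 1 + 2 * \<alpha>) (x, y - 2 * \<alpha>)"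
      by (subst closed_segment_commute) (simp add: trimmed_segment_def to_plane_def direction_def 4 A)
    then show ?thesis
      using o vertical_segment[of "y - 1 + 2 * \<alpha>" "y - 2 * \<alpha>" s t x] octagon_vertical[OF assms(1,2), of s t x "y - 1"]
      by (simp add: p 4 A lface_def conj_commute)
  qed
qed

text \<open>The intermediate point of a corner cut is the midpoint of its ends, so the polygonal
  line is a single segment.\<close>

lemma cut_corner_segment:
  fixes A X B
  defines "u \<equiv> to_plane (X - A)" and "v \<equiv> to_plane (B - X)"
  shows "cut_corner \<alpha> (A, X) (X, B) = closed_segment (to_plane X - (2 * \<alpha>) *\<^sub>R u) (to_plane X + (2 * \<alpha>) *\<^sub>R v)"
proof -
  have m: "to_plane X + \<alpha> *\<^sub>R (v - u) = midpoint (to_plane X - (2 * \<alpha>) *\<^sub>R u) (to_plane X + (2 * \<alpha>) *\<^sub>R v)"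
    by (simp add: midpoint_def algebra_simps scaleR_2[symmetric])
  show ?thesis
    unfolding cut_corner_def Let_def direction_def fst_conv snd_conv u_def[symmetric] v_def[symmetric] m
    by (rule Un_closed_segment) simp
qed

text \<open>A corner cut is the side of the diamond facing the square inside the turn: the left
  square of the incoming edge at a left turn, the right one at a right turn.\<close>

lemma cut_corner_octagon:
  assumes \<alpha>: "0 < \<alpha>" "\<alpha> < 1/4" and ab: "(a, b) \<in> units"
  shows "cut_corner \<alpha> (X - (a, b), X) (X, X + (- b, a)) = octagon \<alpha> (lface (X - (a, b)) X) \<inter> diamond \<alpha> X"
    and "cut_corner \<alpha> (X - (a, b), X) (X, X + (b, - a)) = octagon \<alpha> (lface X (X - (a, b))) \<inter> diamond \<alpha> X"
proof -
  obtain x y where X: "X = (x, y)" by fastforce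
  let ?S = "\<lambda>\<sigma> \<tau>. closed_segment (x + 2 * \<alpha> * \<sigma>, real_of_int y) (real_of_int x, y + 2 * \<alpha> * \<tau>)"
  have ne: "(s, t) \<in> ?S 1 1 \<longleftrightarrow> (s, t) \<in> octagon \<alpha> (x, y) \<inter> diamond \<alpha> X" for s t
    using corner_segment[OF \<alpha>(1), of 1 1 s t x y] \<alpha> by (auto simp: octagon_def diamond_def X)
  have nw: "(s, t) \<in> ?S (-1) 1 \<longleftrightarrow> (s, t) \<in> octagon \<alpha> (x - 1, y) \<inter> diamond \<alpha> X" for s t
    using corner_segment[OF \<alpha>(1), of "-1" 1 s t x y] \<alpha> by (auto simp: octagon_def diamond_def X)
  have sw: "(s, t) \<in> ?S (-1) (-1) \<longleftrightarrow> (s, t) \<in> octagon \<alpha> (x - 1, y - 1) \<inter> diamond \<alpha> X" for s t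
    using corner_segment[OF \<alpha>(1), of "-1" "-1" s t x y] \<alpha> by (auto simp: octagon_def diamond_def X)
  have se: "(s, t) \<in> ?S 1 (-1) \<longleftrightarrow> (s, t) \<in> octagon \<alpha> (x, y - 1) \<inter> diamond \<alpha> X" for s t
    using corner_segment[OF \<alpha>(1), of 1 "-1" s t x y] \<alpha> by (auto simp: octagon_def diamond_def X)
  have sets: "?S 1 1 = octagon \<alpha> (x, y) \<inter> diamond \<alpha> X" "?S (-1) 1 = octagon \<alpha> (x - 1, y) \<inter> diamond \<alpha> X"
    "?S (-1) (-1) = octagon \<alpha> (x - 1, y - 1) \<inter> diamond \<alpha> X" "?S 1 (-1) = octagon \<alpha> (x, y - 1) \<inter> diamond \<alpha> X"
    using ne nw sw se by auto
  have "closed_segment (real_of_int x, y + 2 * \<alpha> * \<tau>) (x + 2 * \<alpha> * \<sigma>, real_of_int y) = ?S \<sigma> \<tau>" for \<sigma> \<tau>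
    by (rule closed_segment_commute)
  note sets' = this[of 1 1, unfolded sets] this[of 1 "-1", unfolded sets]
    this[of "-1" 1, unfolded sets] this[of "-1" "-1", unfolded sets]
  show "cut_corner \<alpha> (X - (a, b), X) (X, X + (- b, a)) = octagon \<alpha> (lface (X - (a, b)) X) \<inter> diamond \<alpha> X"
    using ab unfolding cut_corner_segment
    by (elim insertE emptyE Pair_inject)
      (insert sets sets', simp_all add: to_plane_def X lface_def)
  show "cut_corner \<alpha> (X - (a, b), X) (X, X + (b, - a)) = octagon \<alpha> (lface X (X - (a, b))) \<inter> diamond \<alpha> X"
    using ab unfolding cut_corner_segment
    by (elim insertE emptyE Pair_inject)
      (insert sets sets', simp_all add: to_plane_def X lface_def)
qed

lemma octagon_interior:
  assumes "\<alpha> < 1/4"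
    and b: "xc z < s" "s < xc z + 1" "yc z < t" "t < yc z + 1"
    and c: "2 * \<alpha> < (s - xc z) + (t - yc z)"
      "2 * \<alpha> < (xc z + 1 - s) + (t - yc z)"
      "2 * \<alpha> < (s - xc z) + (yc z + 1 - t)"
      "2 * \<alpha> < (xc z + 1 - s) + (yc z + 1 - t)"
  shows "(s, t) \<in> octagon \<alpha> w \<Longrightarrow> w = z" and "(s, t) \<notin> diamond \<alpha> X"
proof -
  show "w = z" if "(s, t) \<in> octagon \<alpha> w"
  proof -
    have "xc w \<le> s" "s \<le> xc w + 1" "yc w \<le> t" "t \<le> yc w + 1"
      using that by (simp_all add: octagon_def)
    then have "fst w = fst z" "snd w = snd z" using b by linarith+
    then show ?thesis by (simp add: prod_eq_iff)
  qed
  show "(s, t) \<notin> diamond \<alpha> X"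
  proof
    assume d: "(s, t) \<in> diamond \<alpha> X"
    have "(s, t) \<in> octagon \<alpha> z" using b c by (simp add: octagon_def)
    then have "corner z X" using octagon_diamond[OF assms(1) _ d] by blast
    then show False using d b c by (auto simp: corner_def diamond_def)
  qed
qed

lemma octagon_corner_le:
  assumes "corner z X" "(s, t) \<in> octagon \<alpha> z"
  shows "2 * \<alpha> \<le> \<bar>s - xc X\<bar> + \<bar>t - yc X\<bar>"
  using assms by (auto simp: corner_def octagon_def)

lemma to_plane_diamond:
  assumes "0 < \<alpha>" "\<alpha> < 1/4"
  shows "to_plane X \<in> diamond \<alpha> Y \<longleftrightarrow> Y = X" "to_plane X \<notin> octagon \<alpha> z"
proof -
  have X: "to_plane X \<in> diamond \<alpha> X" using assms by (simp add: diamond_def to_plane_def)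
  then show "to_plane X \<in> diamond \<alpha> Y \<longleftrightarrow> Y = X" using diamond_diamond[OF assms(2)] by blast
  show "to_plane X \<notin> octagon \<alpha> z"
  proof
    assume o: "to_plane X \<in> octagon \<alpha> z"
    then have "corner z X" using octagon_diamond[OF assms(2) _ X] by blast
    then show False
      using octagon_corner_le[of z X "xc X" "yc X" \<alpha>] o assms
      by (simp add: to_plane_def)
  qed
qed

text \<open>The midpoint of the common edge of the two squares. Being in no other tile, it connects
  the two octagons inside a coloured open region.\<close>

lemma edge_midpoint:
  assumes "0 < \<alpha>" "\<alpha> < 1/4" "adjacent z z'"
  obtains m where "m \<in> octagon \<alpha> z" "m \<in> octagon \<alpha> z'" "\<And>w. m \<in> octagon \<alpha> w \<Longrightarrow> w = z \<or> w = z'"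
    "\<And>X. m \<notin> diamond \<alpha> X"
proof -
  have right: "\<exists>m. m \<in> octagon \<alpha> z \<and> m \<in> octagon \<alpha> (z + (1,0)) \<and>
      (\<forall>w. m \<in> octagon \<alpha> w \<longrightarrow> w = z \<or> w = z + (1,0)) \<and> (\<forall>X. m \<notin> diamond \<alpha> X)" for z
  proof (intro exI conjI allI impI)
    let ?m = "(xc z + 1, yc z + 1/2)"
    show "?m \<in> octagon \<alpha> z" "?m \<in> octagon \<alpha> (z + (1,0))" using assms by (simp_all add: octagon_def)
    show "w = z \<or> w = z + (1,0)" if "?m \<in> octagon \<alpha> w" for w
    proof -
      have "xc w \<le> xc z + 1" "xc z + 1 \<le> xc w + 1"
        "yc w \<le> yc z + 1/2" "yc z + 1/2 \<le> yc w + 1"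
        using that by (simp_all add: octagon_def)
      then have "fst w = fst z \<or> fst w = fst z + 1" "snd w = snd z" by linarith+
      then show ?thesis by (auto simp: prod_eq_iff)
    qed
    show "?m \<notin> diamond \<alpha> X" for X
    proof
      assume "?m \<in> diamond \<alpha> X"
      then have "\<bar>xc z + 1 - xc X\<bar> + \<bar>yc z + 1/2 - yc X\<bar> \<le> 2 * \<alpha>"
        by (simp add: diamond_def)
      then have "\<bar>yc z + 1/2 - yc X\<bar> < 1/2" using assms by linarith
      then have "snd z < snd X" "snd X < snd z + 1" by linarith+
      then show False by simp
    qed
  qed
  have up: "\<exists>m. m \<in> octagon \<alpha> z \<and> m \<in> octagon \<alpha> (z + (0,1)) \<and>
      (\<forall>w. m \<in> octagon \<alpha> w \<longrightarrow> w = z \<or> w = z + (0,1)) \<and> (\<forall>X. m \<notin> diamond \<alpha> X)" for z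
  proof (intro exI conjI allI impI)
    let ?m = "(xc z + 1/2, yc z + 1)"
    show "?m \<in> octagon \<alpha> z" "?m \<in> octagon \<alpha> (z + (0,1))" using assms by (simp_all add: octagon_def)
    show "w = z \<or> w = z + (0,1)" if "?m \<in> octagon \<alpha> w" for w
    proof -
      have "xc w \<le> xc z + 1/2" "xc z + 1/2 \<le> xc w + 1"
        "yc w \<le> yc z + 1" "yc z + 1 \<le> yc w + 1"
        using that by (simp_all add: octagon_def)
      then have "fst w = fst z" "snd w = snd z \<or> snd w = snd z + 1" by linarith+
      then show ?thesis by (auto simp: prod_eq_iff)
    qed
    show "?m \<notin> diamond \<alpha> X" for X
    proof
      assume "?m \<in> diamond \<alpha> X"
      then have "\<bar>xc z + 1/2 - xc X\<bar> + \<bar>yc z + 1 - yc X\<bar> \<le> 2 * \<alpha>"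
        by (simp add: diamond_def)
      then have "\<bar>xc z + 1/2 - xc X\<bar> < 1/2" using assms by linarith
      then have "fst z < fst X" "fst X < fst z + 1" by linarith+
      then show False by simp
    qed
  qed
  show thesis using assms(3)
  proof (cases rule: adjacent_cases)
    case 1 then show thesis using right[of z] that by blast
  next
    case 2 then show thesis using up[of z] that by blast
  next
    case 3 then have "z = z' + (1,0)" by simp
    then show thesis using right[of z'] that by blast
  next
    case 4 then have "z = z' + (0,1)" by simp
    then show thesis using up[of z'] that by blast
  qed
qed

lemma corner_midpoint:
  assumes "0 < \<alpha>" "\<alpha> < 1/4" "corner z X"
  obtains m where "m \<in> octagon \<alpha> z" "m \<in> diamond \<alpha> X" "\<And>w. m \<in> octagon \<alpha> w \<Longrightarrow> w = z"
    "\<And>Y. m \<in> diamond \<alpha> Y \<Longrightarrow> Y = X"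
proof -
  \<comment> \<open>The midpoint of the side common to the octagon and the diamond; the signs point
    from \<open>X\<close> into the square \<open>z\<close>.\<close>
  define m where "m = (xc X + (if fst z = fst X then \<alpha> else - \<alpha>),
    yc X + (if snd z = snd X then \<alpha> else - \<alpha>))"
  have m: "m \<in> octagon \<alpha> z" "m \<in> diamond \<alpha> X"
    using assms by (auto simp: m_def octagon_def diamond_def corner_def)
  have "xc z < fst m" "fst m < xc z + 1"
    "yc z < snd m" "snd m < yc z + 1"
    using assms by (auto simp: m_def corner_def)
  then have "w = z" if "m \<in> octagon \<alpha> w" for w
  proof -
    have "xc w \<le> fst m" "fst m \<le> xc w + 1" "yc w \<le> snd m" "snd m \<le> yc w + 1"
      using that by (auto simp: octagon_def case_prod_beta)
    then have "fst w = fst z" "snd w = snd z"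
      using \<open>xc z < fst m\<close> \<open>fst m < xc z + 1\<close>
        \<open>yc z < snd m\<close> \<open>snd m < yc z + 1\<close> by linarith+
    then show ?thesis by (simp add: prod_eq_iff)
  qed
  then show thesis using that m diamond_diamond[OF assms(2) _ m(2)] by blast
qed

lemma region_compl_iff:
  "p \<in> - region \<alpha> (\<lambda>z. \<not> f z) (\<lambda>X. \<not> g X) \<longleftrightarrow>
   (\<forall>z. p \<in> octagon \<alpha> z \<longrightarrow> f z) \<and> (\<forall>X. p \<in> diamond \<alpha> X \<longrightarrow> g X)"
  by (auto simp: region_def)

text \<open>All points of the segment from the centre up to, but excluding, \<open>p\<close> are
  interior to the octagon and hence in no other tile. Only \<open>p\<close> itself relies on the
  colours of neighbouring tiles.\<close>

lemma octagon_star: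
  assumes \<alpha>: "0 < \<alpha>" "\<alpha> < 1/4" and fg: "f z"
    and p: "p \<in> - region \<alpha> (\<lambda>z. \<not> f z) (\<lambda>X. \<not> g X)" "p \<in> octagon \<alpha> z"
  shows "connected_component (- region \<alpha> (\<lambda>z. \<not> f z) (\<lambda>X. \<not> g X)) (centre z) p"
    (is "connected_component ?G _ _")
proof (rule connected_component_of_subset)
  show "connected_component (closed_segment (centre z) p) (centre z) p"
    by (rule connected_componentI[of "closed_segment (centre z) p"]) auto
  show "closed_segment (centre z) p \<subseteq> ?G"
  proof
    fix q assume "q \<in> closed_segment (centre z) p"
    then obtain u where u: "0 \<le> u" "u \<le> 1" "q = (1 - u) *\<^sub>R centre z + u *\<^sub>R p"
      by (auto simp: closed_segment_def)
    show "q \<in> ?G"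
    proof (cases "u = 1")
      case True
      then show ?thesis using u(3) p(1) by simp
    next
      case False
      then have u1: "u < 1" using u(2) by simp
      define x where "x = xc z"
      define y where "y = yc z"
      define A where "A = u * (fst p - x)"
      define B where "B = u * (snd p - y)"
      have q: "fst q = x + (1 - u) / 2 + A" "snd q = y + (1 - u) / 2 + B"
        by (simp_all add: u(3) A_def B_def x_def y_def centre_def algebra_simps)
      have o: "0 \<le> fst p - x" "0 \<le> x + 1 - fst p" "0 \<le> snd p - y" "0 \<le> y + 1 - snd p"
        "2 * \<alpha> \<le> (fst p - x) + (snd p - y)" "2 * \<alpha> \<le> (x + 1 - fst p) + (snd p - y)"
        "2 * \<alpha> \<le> (fst p - x) + (y + 1 - snd p)" "2 * \<alpha> \<le> (x + 1 - fst p) + (y + 1 - snd p)"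
        using p(2) by (auto simp: octagon_def case_prod_beta x_def y_def)
      \<comment> \<open>At the centre the corner expressions have the value \<open>1\<close>, which
        exceeds \<open>2 * \<alpha>\<close>; so the inequalities become strict before
        \<open>p\<close> is reached.\<close>
      have "0 < (1 - u) * (1 - 2 * \<alpha>)" using u1 \<alpha> by simp
      then have k: "2 * \<alpha> < (1 - u) + u * (2 * \<alpha>)" by (simp add: algebra_simps)
      note ou = o[THEN mult_left_mono[OF _ u(1)]]
      have ou': "0 \<le> A" "A \<le> u" "0 \<le> B" "B \<le> u" "u * (2 * \<alpha>) \<le> A + B" "u * (2 * \<alpha>) \<le> u - A + B"
        "u * (2 * \<alpha>) \<le> A + (u - B)" "u * (2 * \<alpha>) \<le> (u - A) + (u - B)"
        using ou by (simp_all add: A_def B_def algebra_simps)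
      have c: "x < fst q" "fst q < x + 1" "y < snd q" "snd q < y + 1"
        "2 * \<alpha> < (fst q - x) + (snd q - y)" "2 * \<alpha> < (x + 1 - fst q) + (snd q - y)"
        "2 * \<alpha> < (fst q - x) + (y + 1 - snd q)" "2 * \<alpha> < (x + 1 - fst q) + (y + 1 - snd q)"
      proof -
        define h where "h = (1 - u) / 2"
        define w where "w = u * (2 * \<alpha>)"
        have "u = 1 - 2 * h" by (simp add: h_def field_simps)
        then have h: "fst q = x + h + A" "snd q = y + h + B" "0 < h" "u = 1 - 2 * h"
          using q u1 by (simp_all add: h_def)
        note w = ou'(5-8)[folded w_def] k[folded w_def]
        show "x < fst q" "fst q < x + 1" "y < snd q" "snd q < y + 1"
          using h ou'(1-4) by linarith+
        show "2 * \<alpha> < (fst q - x) + (snd q - y)" "2 * \<alpha> < (x + 1 - fst q) + (snd q - y)"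
          "2 * \<alpha> < (fst q - x) + (y + 1 - snd q)" "2 * \<alpha> < (x + 1 - fst q) + (y + 1 - snd q)"
          using h(1,2,4) w by linarith+
      qed
      have "(fst q, snd q) \<in> octagon \<alpha> w \<Longrightarrow> w = z" "(fst q, snd q) \<notin> diamond \<alpha> X" for w X
        using octagon_interior[OF \<alpha>(2) c[unfolded x_def y_def]] by blast+
      then show ?thesis unfolding region_compl_iff using fg by auto
    qed
  qed
qed

text \<open>Towards the centre the taxicab distance shrinks by the factor \<open>u\<close>, so every
  point before \<open>p\<close> lies strictly inside the diamond and in no octagon.\<close>

lemma diamond_star:
  assumes \<alpha>: "0 < \<alpha>" "\<alpha> < 1/4" and fg: "g X"
    and p: "p \<in> - region \<alpha> (\<lambda>z. \<not> f z) (\<lambda>X. \<not> g X)" "p \<in> diamond \<alpha> X"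
  shows "connected_component (- region \<alpha> (\<lambda>z. \<not> f z) (\<lambda>X. \<not> g X)) (to_plane X) p"
    (is "connected_component ?G _ _")
proof (rule connected_component_of_subset)
  show "connected_component (closed_segment (to_plane X) p) (to_plane X) p"
    by (rule connected_componentI[of "closed_segment (to_plane X) p"]) auto
  show "closed_segment (to_plane X) p \<subseteq> ?G"
  proof
    fix q assume "q \<in> closed_segment (to_plane X) p"
    then obtain u where u: "0 \<le> u" "u \<le> 1" "q = (1 - u) *\<^sub>R to_plane X + u *\<^sub>R p"
      by (auto simp: closed_segment_def)
    show "q \<in> ?G"
    proof (cases "u = 1")
      case True
      then show ?thesis using u(3) p(1) by simp
    next
      case False
      define x where "x = xc X"
      define y where "y = yc X"
      have "fst q - x = u * (fst p - x)" "snd q - y = u * (snd p - y)"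
        by (simp_all add: u(3) x_def y_def to_plane_def algebra_simps)
      then have "\<bar>fst q - x\<bar> + \<bar>snd q - y\<bar> = u * (\<bar>fst p - x\<bar> + \<bar>snd p - y\<bar>)"
        using u(1) by (simp add: abs_mult distrib_left)
      also have "\<dots> \<le> u * (2 * \<alpha>)"
        using p(2) u(1) by (intro mult_left_mono) (auto simp: diamond_def case_prod_beta x_def y_def)
      also have "\<dots> < 2 * \<alpha>" using False u \<alpha> by simp
      finally have lt: "\<bar>fst q - x\<bar> + \<bar>snd q - y\<bar> < 2 * \<alpha>" .
      then have qX: "q \<in> diamond \<alpha> X" by (simp add: diamond_def case_prod_beta x_def y_def)
      have "q \<notin> octagon \<alpha> w" for w
        using octagon_diamond[OF \<alpha>(2) _ qX, of w] octagon_corner_le[of w X "fst q" "snd q" \<alpha>] lt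
        by (auto simp: x_def y_def)
      moreover have "Y = X" if "q \<in> diamond \<alpha> Y" for Y using diamond_diamond[OF \<alpha>(2) that qX] .
      ultimately show ?thesis unfolding region_compl_iff using fg by auto
    qed
  qed
qed

section \<open>The two coloured regions of the plane\<close>

context turning_curve
begin

text \<open>A right turn is cut on its right, so the diamond of the vertex stays on the left of the
  rounded curve. The choice of the visit \<open>c\<close> does not matter, as all visits of a vertex
  turn alike. At an exterior point the diamond takes the colour of the surrounding squares.\<close>

definition vertex_side :: "(lattice_point \<Rightarrow> bool) \<Rightarrow> lattice_point \<Rightarrow> bool" where
  "vertex_side f X \<longleftrightarrow> (if X \<in> range P then \<exists>c. P c = X \<and> tr P c = -1 else f X)"

lemma vertex_side_curve: "vertex_side f (P c) \<longleftrightarrow> tr P c = -1"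
  unfolding vertex_side_def using tr_visit by (metis rangeI)

text \<open>Tiles of different colours meet in three ways. Two octagons meet along a curve edge,
  giving a trimmed segment; an octagon and a diamond meet inside a turn, giving a corner cut; two
  different diamonds never meet.\<close>

lemma realization_region:
  assumes \<alpha>: "0 < \<alpha>" "\<alpha> < 1/4" and f: "side f"
  shows "realization \<alpha> (\<lambda>i. (P i, P (i + 1))) =
    region \<alpha> f (vertex_side f) \<inter> region \<alpha> (\<lambda>z. \<not> f z) (\<lambda>X. \<not> vertex_side f X)"
    (is "?C = ?L \<inter> ?R")
proof
  have l: "f (lface (P i) (P (i + 1)))" and r: "\<not> f (lface (P (i + 1)) (P i))" for i
    using f unfolding side_def by blast+
  have l': "f (lface (P (i - 1)) (P i))" and r': "\<not> f (lface (P i) (P (i - 1)))" for i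
    using l[of "i - 1"] r[of "i - 1"] by simp_all
  have trim: "trimmed_segment \<alpha> (P i, P (i + 1)) = octagon \<alpha> (lface (P i) (P (i + 1))) \<inter> octagon \<alpha> (lface (P (i + 1)) (P i))" for i
    by (rule trimmed_segment_octagons[OF \<alpha> adj])
  let ?cut = "\<lambda>c. cut_corner \<alpha> (P (c - 1), P c) (P c, P (c + 1))"
  have cut: "tr P c = 1 \<Longrightarrow> ?cut c = octagon \<alpha> (lface (P (c - 1)) (P c)) \<inter> diamond \<alpha> (P c)"
    "tr P c = -1 \<Longrightarrow> ?cut c = octagon \<alpha> (lface (P c) (P (c - 1))) \<inter> diamond \<alpha> (P c)" for c
  proof -
    obtain a b where ab: "(a, b) \<in> units" "P (c - 1) = P c - (a, b)"
      "tr P c = 1 \<and> P (c + 1) = P c + (- b, a) \<or> tr P c = -1 \<and> P (c + 1) = P c + (b, - a)"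
      by (rule local_shape)
    show "?cut c = octagon \<alpha> (lface (P (c - 1)) (P c)) \<inter> diamond \<alpha> (P c)" if "tr P c = 1"
      using cut_corner_octagon(1)[OF \<alpha> ab(1), of "P c"] ab(2,3) that by simp
    show "?cut c = octagon \<alpha> (lface (P c) (P (c - 1))) \<inter> diamond \<alpha> (P c)" if "tr P c = -1"
      using cut_corner_octagon(2)[OF \<alpha> ab(1), of "P c"] ab(2,3) that by simp
  qed
  have octL: "octagon \<alpha> z \<subseteq> ?L" if "f z" for z using that unfolding region_def by blast
  have octR: "octagon \<alpha> z \<subseteq> ?R" if "\<not> f z" for z using that unfolding region_def by blast
  have diaL: "diamond \<alpha> X \<subseteq> ?L" if "vertex_side f X" for X using that unfolding region_def by blast
  have diaR: "diamond \<alpha> X \<subseteq> ?R" if "\<not> vertex_side f X" for X using that unfolding region_def by blast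
  have "?cut c \<subseteq> ?L \<inter> ?R" for c
    using tr_cases[of c]
  proof
    assume "tr P c = 1"
    then show ?thesis using cut(1)[of c] octL[OF l'[of c]] diaR[of "P c"] by (auto simp: vertex_side_curve)
  next
    assume "tr P c = -1"
    then show ?thesis using cut(2)[of c] octR[OF r'[of c]] diaL[of "P c"] by (auto simp: vertex_side_curve)
  qed
  \<comment> \<open>\<open>?cut\<close> is indexed by its vertex, \<open>realization\<close> by the
    incoming segment.\<close>
  from this[of "_ + 1"] have "cut_corner \<alpha> (P i, P (i + 1)) (P (i + 1), P (i + 1 + 1)) \<subseteq> ?L \<inter> ?R" for i by simp
  moreover have "trimmed_segment \<alpha> (P i, P (i + 1)) \<subseteq> ?L \<inter> ?R" for i
    using trim[of i] octL[OF l[of i]] octR[OF r[of i]] by blast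
  ultimately show "?C \<subseteq> ?L \<inter> ?R" unfolding realization_def by blast
  have trimC: "trimmed_segment \<alpha> (P i, P (i + 1)) \<subseteq> ?C" for i
    unfolding realization_def by blast
  have "cut_corner \<alpha> (P (c - 1), P (c - 1 + 1)) (P (c - 1 + 1), P (c - 1 + 1 + 1)) \<subseteq> ?C" for c
    unfolding realization_def by blast
  then have cutC: "?cut c \<subseteq> ?C" for c by simp
  have oo: "p \<in> ?C" if p: "p \<in> octagon \<alpha> z" "p \<in> octagon \<alpha> z'" and z: "f z" "\<not> f z'" for p z z'
  proof -
    have "adjacent z z'" using octagon_octagon[OF \<alpha>(1) p] z by blast
    then obtain X Y where XY: "adjacent X Y" "lface X Y = z" "lface Y X = z'" by (rule adjacent_faces)
    then have "\<not> free P X Y" using f z unfolding side_def by blast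
    then obtain i where "{P i, P (i + 1)} = {X, Y}" using XY(1) by (auto simp: free_def)
    then have "p \<in> trimmed_segment \<alpha> (P i, P (i + 1))"
      using trim[of i] p XY by (auto simp: doubleton_eq_iff)
    then show ?thesis using trimC by blast
  qed
  have od: "p \<in> ?C" if p: "p \<in> octagon \<alpha> z" "p \<in> diamond \<alpha> X" and z: "f z \<noteq> vertex_side f X" for p z X
  proof -
    have co: "corner z X" by (rule octagon_diamond[OF \<alpha>(2) p])
    have "X \<in> range P"
    proof (rule ccontr)
      assume X: "X \<notin> range P"
      have "f z = f X"
        using ext_faces[OF f X, of "X + (1,0)"] ext_faces[OF f X, of "X - (1,0)"] co
        by (cases X) (auto simp: corner_def lface_def adjacent_iff)
      then show False using z X by (simp add: vertex_side_def)
    qed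
    then obtain c where c: "X = P c" by blast
    have co': "corner z (P c)" using co c by simp
    show ?thesis using tr_cases[of c]
    proof
      assume t: "tr P c = 1"
      then have "f z" using z by (simp add: c vertex_side_curve)
      then obtain d where "P d = P c" "tr P d = 1" "z = lface (P (d - 1)) (P d)"
        using left_corner_arc[OF f t co'] by blast
      then show ?thesis using cut(1)[of d] cutC[of d] p c by auto
    next
      assume t: "tr P c = -1"
      then have "\<not> f z" using z by (simp add: c vertex_side_curve)
      then obtain d where "P d = P c" "tr P d = -1" "z = lface (P d) (P (d - 1))"
        using right_corner_arc[OF f t co'] by blast
      then show ?thesis using cut(2)[of d] cutC[of d] p c by auto
    qed
  qed
  have dd: False if "p \<in> diamond \<alpha> X" "p \<in> diamond \<alpha> Y" "vertex_side f X" "\<not> vertex_side f Y" for p X Y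
    using diamond_diamond[OF \<alpha>(2) that(1,2)] that(3,4) by simp
  show "?L \<inter> ?R \<subseteq> ?C"
  proof
    fix p assume p: "p \<in> ?L \<inter> ?R"
    then consider z where "f z" "p \<in> octagon \<alpha> z" | X where "vertex_side f X" "p \<in> diamond \<alpha> X"
      unfolding region_def by blast
    moreover from p consider z where "\<not> f z" "p \<in> octagon \<alpha> z" | X where "\<not> vertex_side f X" "p \<in> diamond \<alpha> X"
      unfolding region_def by blast
    ultimately show "p \<in> ?C" using oo od dd by metis
  qed
qed

text \<open>Every tile of the left colour is joined to the left square of the edge with index
  \<open>0\<close>: first the left squares along the whole curve, then all left squares, then the
  diamonds and finally arbitrary points through the stars.\<close>

lemma left_region_connected:
  assumes \<alpha>: "0 < \<alpha>" "\<alpha> < 1/4" and f: "side f"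
  defines "G \<equiv> - region \<alpha> (\<lambda>z. \<not> f z) (\<lambda>X. \<not> vertex_side f X)"
  shows "connected G" "G \<noteq> {}"
proof -
  let ?g = "vertex_side f"
  let ?lf = "\<lambda>i. lface (P i) (P (i + 1))"
  have l: "f (?lf i)" and r: "\<not> f (lface (P (i + 1)) (P i))" for i
    using f unfolding side_def by blast+
  have G: "p \<in> G \<longleftrightarrow> (\<forall>z. p \<in> octagon \<alpha> z \<longrightarrow> f z) \<and> (\<forall>X. p \<in> diamond \<alpha> X \<longrightarrow> ?g X)" for p
    unfolding G_def by (rule region_compl_iff)
  have star: "connected_component G (centre z) p" if "p \<in> G" "p \<in> octagon \<alpha> z" for z p
    using octagon_star[OF \<alpha>, of f z p ?g] that G unfolding G_def by blast
  have dstar: "connected_component G (to_plane X) p" if "p \<in> G" "p \<in> diamond \<alpha> X" for X p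
    using diamond_star[OF \<alpha>, of ?g X p f] that G unfolding G_def by blast
  have corner: "connected_component G (centre z) (to_plane X)" if co: "corner z X" "f z" "?g X" for z X
  proof -
    obtain m where m: "m \<in> octagon \<alpha> z" "m \<in> diamond \<alpha> X" "\<And>w. m \<in> octagon \<alpha> w \<Longrightarrow> w = z"
      "\<And>Y. m \<in> diamond \<alpha> Y \<Longrightarrow> Y = X" using corner_midpoint[OF \<alpha> co(1)] by metis
    then have "m \<in> G" using co G by metis
    then show ?thesis using star[of m z] dstar[of m X] m connected_component_sym connected_component_trans by metis
  qed
  have edge: "connected_component G (centre z) (centre z')" if ad: "adjacent z z'" "f z" "f z'" for z z'
  proof -
    obtain m where m: "m \<in> octagon \<alpha> z" "m \<in> octagon \<alpha> z'" "\<And>w. m \<in> octagon \<alpha> w \<Longrightarrow> w = z \<or> w = z'"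
      "\<And>X. m \<notin> diamond \<alpha> X" using edge_midpoint[OF \<alpha> ad(1)] by metis
    then have "m \<in> G" using ad G by metis
    then show ?thesis using star[of m z] star[of m z'] m connected_component_sym connected_component_trans by metis
  qed
  have centre: "centre z \<in> G" if "f z" for z
    unfolding G centre_def using that \<alpha>
      octagon_interior[OF \<alpha>(2), of z "xc z + 1/2" "yc z + 1/2"] by auto
  \<comment> \<open>At a left turn both edges have the same left square. At a right turn the squares
    differ, but the diamond of the vertex lies on the left and joins them.\<close>
  have link: "connected_component G (centre (?lf i)) (centre (?lf (i + 1)))" for i
    using tr_cases[of "i + 1"]
  proof
    assume "tr P (i + 1) = 1"
    then show ?thesis
      using left_turn_face[of "i + 1"] connected_component_refl[OF centre[OF l[of i]]] by simp
  next
    assume t: "tr P (i + 1) = -1"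
    have "connected_component G (centre (?lf i)) (to_plane (P (i + 1)))"
      "connected_component G (centre (?lf (i + 1))) (to_plane (P (i + 1)))"
      using corner corner_lface[OF adj] l t vertex_side_curve by blast+
    then show ?thesis using connected_component_sym connected_component_trans by metis
  qed
  have lf: "connected_component G (centre (?lf 0)) (centre (?lf i))" for i
  proof (induction i rule: int_induct[where k = 0])
    case base show ?case using centre[OF l[of 0]] by simp
  next
    case (step1 i) then show ?case using link[of i] connected_component_trans by blast
  next
    case (step2 i)
    have "connected_component G (centre (?lf (i - 1))) (centre (?lf i))" using link[of "i - 1"] by simp
    then show ?case using step2 connected_component_trans connected_component_sym by metis
  qed
  \<comment> \<open>Walking from square to square, a step onto a left square either crosses a free
    edge from a left square, or crosses a curve edge and thus ends beside the curve, where
    \<open>lf\<close> applies.\<close>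
  have face: "f z \<longrightarrow> connected_component G (centre (?lf 0)) (centre z)" for z
  proof (rule adjacent_induct[where p = "?lf 0"])
    show "f (?lf 0) \<longrightarrow> connected_component G (centre (?lf 0)) (centre (?lf 0))" using lf by blast
    fix p q assume p: "f p \<longrightarrow> connected_component G (centre (?lf 0)) (centre p)" and pq: "adjacent p q"
    show "f q \<longrightarrow> connected_component G (centre (?lf 0)) (centre q)"
    proof
      assume q: "f q"
      obtain X Y where XY: "adjacent X Y" "lface X Y = p" "lface Y X = q" using pq by (rule adjacent_faces)
      show "connected_component G (centre (?lf 0)) (centre q)"
      proof (cases "free P X Y")
        case True
        then have "f p" using f q XY unfolding side_def by blast
        then show ?thesis using p edge[OF pq] q connected_component_trans by blast
      next
        case False
        then obtain m where "{P m, P (m + 1)} = {X, Y}" using XY(1) by (auto simp: free_def)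
        then have "q = ?lf m \<or> q = lface (P (m + 1)) (P m)" using XY(3) by (auto simp: doubleton_eq_iff)
        then show ?thesis using q r lf by blast
      qed
    qed
  qed
  have vertex: "connected_component G (centre (?lf 0)) (to_plane X)" if g: "?g X" for X
  proof -
    obtain z where "corner z X" "f z"
    proof (cases "X \<in> range P")
      case True
      then obtain c where "X = P c" by blast
      then show thesis using that corner_lface(1)[OF adj[of c]] l[of c] by blast
    next
      case False
      then have "f X" using g by (simp add: vertex_side_def)
      then show thesis using that[of X] by (simp add: corner_def)
    qed
    then show ?thesis using face[of z] corner[of z X] g connected_component_trans by blast
  qed
  have "connected_component G (centre (?lf 0)) p" if p: "p \<in> G" for p
  proof -
    have "p \<in> region \<alpha> f ?g" using region_cover[of \<alpha> f ?g] p unfolding G_def by blast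
    then consider z where "f z" "p \<in> octagon \<alpha> z" | X where "?g X" "p \<in> diamond \<alpha> X"
      unfolding region_def by blast
    then show ?thesis
      using star[OF p] dstar[OF p] face vertex connected_component_trans by metis
  qed
  then show "connected G"
    unfolding connected_iff_connected_component using connected_component_sym connected_component_trans by metis
  show "G \<noteq> {}" using centre[OF l[of 0]] by blast
qed

end

subsection \<open>Components\<close>

lemma lattice_path_conn:
  assumes "lattice_path p" "set p \<subseteq> E"
  shows "conn E (hd p) (last p)"
  using assms
proof (induction p)
  case (Cons x p)
  show ?case
  proof (cases "p = []")
    case False
    then have "lattice_path p" "adjacent x (hd p)"
      using Cons.prems(1) by (auto simp: lattice_path_def successively_Cons)
    moreover have "x \<in> E" "hd p \<in> E" "set p \<subseteq> E" using Cons.prems(2) False by auto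
    ultimately show ?thesis using Cons.IH False conn_step[of x E "hd p"] conn_trans by auto
  qed simp
qed (simp add: lattice_path_def)

lemma conn_lattice_path:
  assumes "conn E X Y" "X \<in> E"
  shows "\<exists>p. lattice_path p \<and> hd p = X \<and> last p = Y \<and> set p \<subseteq> E"
  using assms(1) unfolding conn_def
proof (induction rule: rtranclp_induct)
  case base
  show ?case using assms(2) by (intro exI[of _ "[X]"]) (simp add: lattice_path_def)
next
  case (step Y Z)
  then obtain p where p: "lattice_path p" "hd p = X" "last p = Y" "set p \<subseteq> E" by blast
  then show ?case using step(2)
    by (intro exI[of _ "p @ [Z]"]) (auto simp: lattice_path_def successively_append_iff)
qed

lemma lattice_connected_iff: "lattice_connected K \<longleftrightarrow> (\<forall>X\<in>K. \<forall>Y\<in>K. conn K X Y)"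
  unfolding lattice_connected_def using lattice_path_conn conn_lattice_path by metis

lemma conn_mono: "conn K X Y \<Longrightarrow> K \<subseteq> E \<Longrightarrow> conn E X Y"
  unfolding conn_def by (erule rtranclp_mono[THEN predicate2D, rotated]) blast

text \<open>The classes of \<open>f\<close> are the connection classes of \<open>E\<close>. A path
  in \<open>E\<close> starting in a class never leaves it, so each class is connected within itself,
  and no connected set meets two classes.\<close>

lemma lattice_components_two_sides:
  assumes conn: "\<And>X Y. X \<in> E \<Longrightarrow> Y \<in> E \<Longrightarrow> conn E X Y \<longleftrightarrow> f X = f Y"
  shows "lattice_components E = (\<lambda>X. {Y \<in> E. f Y = f X}) ` E"
proof -
  have side_connected: "lattice_connected {Y \<in> E. f Y = f X}" if "X \<in> E" for X
    unfolding lattice_connected_iff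
  proof (intro ballI)
    fix Y Z assume Y: "Y \<in> {Y \<in> E. f Y = f X}" and Z: "Z \<in> {Y \<in> E. f Y = f X}"
    then have "conn E Y Z" using conn by simp
    then show "conn {Y \<in> E. f Y = f X} Y Z"
      unfolding conn_def[of E]
    proof (induction rule: rtranclp_induct)
      case (step U V)
      then have "conn E Y U" unfolding conn_def by simp
      then have "f U = f X" using conn[of Y U] Y step(2) by simp
      moreover have "f V = f U" using conn[of U V] conn_step[of U E V] step(2) by simp
      ultimately have "conn {Y \<in> E. f Y = f X} U V" using step(2) by (intro conn_step) auto
      then show ?case using step(3) conn_trans by blast
    qed simp
  qed
  have sub: "K \<subseteq> {Y \<in> E. f Y = f X}" if "X \<in> K" "K \<subseteq> E" "lattice_connected K" for K X
  proof
    fix Y assume "Y \<in> K"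
    then have "conn E X Y" using that lattice_connected_iff conn_mono by metis
    moreover have "X \<in> E" "Y \<in> E" using that \<open>Y \<in> K\<close> by blast+
    ultimately show "Y \<in> {Y \<in> E. f Y = f X}" using conn[of X Y] by simp
  qed
  show ?thesis
  proof (intro equalityI subsetI)
    fix K assume "K \<in> lattice_components E"
    then have K: "K \<noteq> {}" "K \<subseteq> E" "lattice_connected K"
      "\<And>K'. K \<subseteq> K' \<Longrightarrow> K' \<subseteq> E \<Longrightarrow> lattice_connected K' \<Longrightarrow> K' = K"
      unfolding lattice_components_def by blast+
    then obtain X where X: "X \<in> K" by blast
    then have "{Y \<in> E. f Y = f X} = K" using sub[OF X K(2,3)] side_connected[of X] X K(2) by (intro K(4)) blast+
    then show "K \<in> (\<lambda>X. {Y \<in> E. f Y = f X}) ` E" using X K(2) by blast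
  next
    fix K assume "K \<in> (\<lambda>X. {Y \<in> E. f Y = f X}) ` E"
    then obtain X where X: "X \<in> E" "K = {Y \<in> E. f Y = f X}" by blast
    have "K' = K" if "K \<subseteq> K'" "K' \<subseteq> E" "lattice_connected K'" for K'
      using sub[of X K'] that X by auto
    then show "K \<in> lattice_components E"
      unfolding lattice_components_def using X side_connected[OF X(1)] by auto
  qed
qed

text \<open>Translation into vertex sequences: orthogonality becomes an integer identity, and
  distinctness of supports becomes distinctness of unordered edges.\<close>

lemma complete_curve_vertices:
  assumes "complete_folding_curve C"
  defines "P \<equiv> \<lambda>i. fst (C i)"
  shows "C = (\<lambda>i. (P i, P (i + 1)))" "folding_curve P"
proof -
  have C: "\<And>i. is_segment (C i)" "\<And>i. snd (C i) = fst (C (i + 1))"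
    "\<And>i. orthogonal (to_plane (direction (C i))) (to_plane (direction (C (i + 1))))"
    "\<And>i j. i \<noteq> j \<Longrightarrow> support (C i) \<noteq> support (C j)"
    and fold: "complete_folding_sequence (associated_sequence C)"
    using assms(1) unfolding complete_folding_curve_def complete_curve_def by blast+
  show CP: "C = (\<lambda>i. (P i, P (i + 1)))"
    using C(2) by (auto simp: P_def prod_eq_iff)
  have dir: "direction (C i) = P (i + 1) - P i" for i
    using C(2)[of i] by (simp add: direction_def P_def)
  have "turning_curve P"
  proof
    show "adjacent (P i) (P (i + 1))" for i
      using C(1)[of i] C(2)[of i] by (simp add: is_segment_def P_def)
    fix i
    have "inner (to_plane (P i - P (i - 1))) (to_plane (P (i + 1) - P i)) = 0"
      using C(3)[of "i - 1"] unfolding dir orthogonal_def by simp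
    then have "real_of_int (fst (P i - P (i - 1)) * fst (P (i + 1) - P i) +
        snd (P i - P (i - 1)) * snd (P (i + 1) - P i)) = 0"
      by (simp add: to_plane_def)
    then show "fst (P i - P (i - 1)) * fst (P (i + 1) - P i) + snd (P i - P (i - 1)) * snd (P (i + 1) - P i) = 0"
      using of_int_eq_0_iff by blast
  next
    fix i j assume "{P i, P (i + 1)} = {P j, P (j + 1)}"
    then have "support (C i) = support (C j)"
      using C(2)[of i] C(2)[of j]
      by (auto simp: support_def P_def doubleton_eq_iff closed_segment_commute)
    then show "i = j" using C(4) by blast
  qed
  moreover have "tr P = (\<lambda>i. associated_sequence C (i + -1))"
    by (rule ext) (simp add: tr_def associated_sequence_def dir)
  then have "complete_folding_sequence (tr P)"
    using complete_folding_sequence_shift[OF fold, of "-1"] by simp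
  ultimately show "folding_curve P" by (simp add: folding_curve_def)
qed

text \<open>The region on the right is the left region of the reversed curve, so one connectedness
  lemma serves both. The two open sets are disjoint because the two closed unions cover the
  plane.\<close>

lemma region_components:
  assumes \<alpha>: "0 < \<alpha>" "\<alpha> < 1/4" and P: "turning_curve P" and f: "turning_curve.side P f"
  defines "g \<equiv> turning_curve.vertex_side P f"
  shows "components (- realization \<alpha> (\<lambda>i. (P i, P (i + 1)))) =
      {- region \<alpha> f g, - region \<alpha> (\<lambda>z. \<not> f z) (\<lambda>X. \<not> g X)}"
    and "- region \<alpha> f g \<noteq> - region \<alpha> (\<lambda>z. \<not> f z) (\<lambda>X. \<not> g X)"
proof -
  interpret turning_curve P by fact
  interpret R: turning_curve "\<lambda>i. P (- i)" using P by (rule turning_curve_reverse)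
  let ?L = "region \<alpha> f g" and ?R = "region \<alpha> (\<lambda>z. \<not> f z) (\<lambda>X. \<not> g X)"
  have "R.vertex_side (\<lambda>p. \<not> f p) X \<longleftrightarrow> \<not> g X" for X
  proof (cases "X \<in> range P")
    case True
    then obtain c where c: "X = P c" by blast
    have "R.vertex_side (\<lambda>p. \<not> f p) (P (- (- c))) \<longleftrightarrow> tr P c = 1"
      unfolding R.vertex_side_curve[of _ "- c"] by (simp add: tr_reverse)
    then show ?thesis using tr_cases[of c] by (auto simp: c g_def vertex_side_curve)
  next
    case False
    then show ?thesis unfolding g_def R.vertex_side_def vertex_side_def range_reverse by simp
  qed
  then have "R.vertex_side (\<lambda>p. \<not> f p) = (\<lambda>X. \<not> g X)" by blast
  then have L: "connected (- ?L)" "- ?L \<noteq> {}"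
    using R.left_region_connected[OF \<alpha> side_reverse[OF P f]] by simp_all
  have R: "connected (- ?R)" "- ?R \<noteq> {}"
    using left_region_connected[OF \<alpha> f] unfolding g_def by simp_all
  have disj: "- ?L \<inter> - ?R = {}" using region_cover[of \<alpha> f g] by blast
  show ne: "- ?L \<noteq> - ?R" using disj L(2) by blast
  show "components (- realization \<alpha> (\<lambda>i. (P i, P (i + 1)))) = {- ?L, - ?R}"
  proof (rule components_open_unique)
    show "pairwise disjnt {- ?L, - ?R}" using disj by (auto simp: pairwise_def disjnt_def)
    show "\<Union> {- ?L, - ?R} = - realization \<alpha> (\<lambda>i. (P i, P (i + 1)))"
      unfolding realization_region[OF \<alpha> f] g_def by blast
    show "open S \<and> connected S \<and> S \<noteq> {}" if "S \<in> {- ?L, - ?R}" for S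
      using that L R closed_region[OF \<alpha>(2)] by (auto simp: open_Compl)
  qed
qed

theorem theorem2p4:
  fixes C :: "int \<Rightarrow> segment" and \<alpha> :: real
  assumes "0 < \<alpha>" and "\<alpha> < 1/4"
    and "complete_folding_curve C"
  shows "finite (lattice_components (Ext C)) \<and>
         card (lattice_components (Ext C)) \<in> {0, 1, 2} \<and>
         Ext C = \<Union> (lattice_components (Ext C)) \<and>
         card (components (- realization \<alpha> C)) = 2 \<and>
         (\<forall>K \<in> lattice_components (Ext C).
            infinite K \<and>
            (\<exists>D \<in> components (- realization \<alpha> C). K = {X \<in> Ext C. to_plane X \<in> D}))"
proof -
  define P where "P = (\<lambda>i. fst (C i))"
  have C: "C = (\<lambda>i. (P i, P (i + 1)))" and P: "folding_curve P"
    using complete_curve_vertices[OF assms(3)] unfolding P_def by blast+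
  have tc: "turning_curve P" using P by (simp add: folding_curve_def)
  interpret turning_curve P by (rule tc)
  obtain f where f: "side f" by (rule ex_side)
  let ?L = "region \<alpha> f (vertex_side f)" and ?R = "region \<alpha> (\<lambda>z. \<not> f z) (\<lambda>X. \<not> vertex_side f X)"
  have comps: "components (- realization \<alpha> C) = {- ?L, - ?R}" and ne: "- ?L \<noteq> - ?R"
    using region_components[OF assms(1,2) tc f] unfolding C by blast+
  have Ext: "Ext C = - range P" by (subst C) (auto simp: Ext_def)
  have conn: "conn (Ext C) X Y \<longleftrightarrow> f X = f Y" if "X \<in> Ext C" "Y \<in> Ext C" for X Y
    using conn_side[OF f, of X Y] same_side_conn[OF P f, of X Y] that unfolding Ext by blast
  have lc: "lattice_components (Ext C) = (\<lambda>X. {Y \<in> Ext C. f Y = f X}) ` Ext C"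
    by (rule lattice_components_two_sides) (rule conn)
  have "lattice_components (Ext C) \<subseteq> {{Y \<in> Ext C. f Y}, {Y \<in> Ext C. \<not> f Y}}"
    unfolding lc by auto
  then have fin: "finite (lattice_components (Ext C))" and "card (lattice_components (Ext C)) \<le> card {{Y \<in> Ext C. f Y}, {Y \<in> Ext C. \<not> f Y}}"
    by (auto intro: finite_subset card_mono)
  moreover have "card {{Y \<in> Ext C. f Y}, {Y \<in> Ext C. \<not> f Y}} \<le> 2" by (simp add: card_insert_le_m1)
  ultimately have "card (lattice_components (Ext C)) \<le> 2" by linarith
  then have card: "card (lattice_components (Ext C)) \<in> {0, 1, 2}" by auto
  have un: "Ext C = \<Union> (lattice_components (Ext C))" unfolding lc by auto
  have card2: "card (components (- realization \<alpha> C)) = 2" unfolding comps using ne by simp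
  \<comment> \<open>A lattice point lies in its own diamond and in no other tile, and for an
    exterior point the colour of that diamond is \<open>f X\<close>.\<close>
  have plane: "to_plane X \<in> - ?R \<longleftrightarrow> f X" "to_plane X \<in> - ?L \<longleftrightarrow> \<not> f X" if "X \<in> Ext C" for X
    using that to_plane_diamond[OF assms(1,2)] unfolding region_def Ext by (auto simp: vertex_side_def)
  have "infinite K \<and> (\<exists>D \<in> components (- realization \<alpha> C). K = {X \<in> Ext C. to_plane X \<in> D})"
    if K: "K \<in> lattice_components (Ext C)" for K
  proof -
    obtain X where X: "X \<in> Ext C" "K = {Y \<in> Ext C. f Y = f X}" using K unfolding lc by blast
    have "{Y. conn (Ext C) X Y} \<subseteq> K"
      using conn[OF X(1)] conn_mem[of "Ext C" X] X by blast
    moreover have "infinite {Y. conn (Ext C) X Y}"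
      using infinite_component[OF P, of X] X(1) unfolding Ext by simp
    ultimately have "infinite K" using finite_subset by blast
    moreover have "K = {Y \<in> Ext C. to_plane Y \<in> (if f X then - ?R else - ?L)}"
      unfolding X(2) using plane by auto
    moreover have "(if f X then - ?R else - ?L) \<in> components (- realization \<alpha> C)"
      unfolding comps by simp
    ultimately show ?thesis by blast
  qed
  then show ?thesis using fin card un card2 by blast
qed

end
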